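(* Let $K$ be a field of characteristic zero, $n\ge1$, $A_n$ the $n$'th Weyl algebra over $K$ with classical quotient division ring $Q(A_n)$, and $\mathbb{A}_n$ the Jacobian algebra. With the notation of the context, the following statements are equivalent: 1. ${}'Q(\mathbb{A}_n)\simeq Q(A_n)$. 2. ${}'Q_{l,cl}(\mathbb{A}_n)\simeq Q(A_n)$. 3. The set $\overline{{}'S(\mathbb{A}_n)}$ is left dense in $\mathcal{A}_n\setminus\{0\}$. 4. The set $\overline{{}'\mathcal{C}_{\mathbb{A}_n}}$ is left dense in $\mathcal{A}_n\setminus\{0\}$. 5. The set ${}'\Delta_n$ is left dense in $\mathcal{A}_n\setminus\{0\}$. 6. The set ${}'\Delta_n$ is left dense in $\Delta_n^0$. 7. For each element $s\in\Delta_n^0$, there is an element $s'\in\Delta_n^0$ such that $s's\in{}'\mathcal{C}_{F_n}$. 8. For each element $s\in\Delta_n^0$, there is an element $s'\in\Delta_n^0$ such that $s's\in{}'\mathcal{C}_{P_n'}$, where $P_n'=K[\partial_1,\ldots,\partial_n]$ is the unique simple faithful right $\mathbb{A}_n$-module.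
   Context: Localization. All rings are unital. A subset $S$ of a ring $R$ is multiplicative if $1\in S$, $SS\subseteq S$, $0\notin S$. A multiplicative set $S$ is a left Ore set if $Sr\cap Rs\neq\emptyset$ for all $r\in R$, $s\in S$; it is a left denominator set if moreover $rs=0$ ($r\in R$, $s\in S$) implies $tr=0$ for some $t\in S$; $S^{-1}R$ is the left localization. ${}'\mathcal{C}_R=\{c\in R\mid rc=0\Rightarrow r=0\}$ is the set of left regular elements; it contains a largest left denominator set of $R$, denoted ${}'S(R)$, and ${}'Q(R):={}'S(R)^{-1}R$. If ${}'\mathcal{C}_R$ is itself a left denominator set, ${}'Q_{l,cl}(R):={}'\mathcal{C}_R^{-1}R$; a statement about ${}'Q_{l,cl}(R)$ includes the assertion that it exists. For a right $R$-module $M$, ${}'\mathcal{C}_M:=\{r\in R\mid \text{the map }M\to M,\ m\mapsto mr,\text{ is injective}\}$. If $S\subseteq T$ are multiplicative sets in a ring $R$, then $S$ is left dense in $T$ if for each $t\in T$ there is $r\in R$ with $rt\in S$; in 3, 4, 5 the ring is $\mathcal{A}_n$, in 6 it is $\Delta_n$. The symbol $\simeq$ denotes isomorphism of $K$-algebras. The Jacobian algebra. Let $P_n=K[x_1,\ldots,x_n]$. $\mathbb{A}_n$ is the subalgebra of $\mathrm{End}_K(P_n)$ generated by the multiplications by $x_i$, the derivatives $\partial_i=\frac{\partial}{\partial x_i}$ and the inverses $H_i^{-1}$ of the maps $H_i:=\partial_ix_i$, $i=1,\ldots,n$; the Weyl algebra $A_n$ is the subalgebra generated by all $x_i,\partial_i$;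 $\mathbb{A}_n\simeq\mathbb{A}_1^{\otimes n}$. The algebra $\mathbb{A}_1$ has a unique proper nonzero ideal $F=\bigoplus_{i,j\ge0}KE_{ij}$, where $E_{ij}(x^k)=\delta_{jk}x^i$. $F_n:=F^{\otimes n}$ is the smallest nonzero ideal of $\mathbb{A}_n$, viewed here as a right $\mathbb{A}_n$-module. Let $\mathfrak{p}_i=\mathbb{A}_1^{\otimes(i-1)}\otimes F\otimes\mathbb{A}_1^{\otimes(n-i)}$ and $\mathfrak{a}_n=\mathfrak{p}_1+\cdots+\mathfrak{p}_n$. The factor algebra $\mathcal{A}_n:=\mathbb{A}_n/\mathfrak{a}_n$ is the skew Laurent polynomial algebra $\mathcal{L}_n[\partial_1^{\pm1},\ldots,\partial_n^{\pm1};\tau_1,\ldots,\tau_n]$, where $\mathcal{L}_n=K[H_i^{\pm1},(H_i\pm1)^{-1},(H_i\pm2)^{-1},\ldots\mid i=1,\ldots,n]$, $\tau_i(H_j)=H_j+\delta_{ij}$, $\partial_ih=\tau_i(h)\partial_i$. $\Delta_n:=\mathcal{L}_n^+[\partial_1,\ldots,\partial_n;\tau_1,\ldots,\tau_n]$ is the subalgebra of $\mathbb{A}_n$ generated by $\mathcal{L}_n^+=K[H_i^{\pm1},(H_i+1)^{-1},(H_i+2)^{-1},\ldots\mid i=1,\ldots,n]$ and $\partial_1,\ldots,\partial_n$ (a skew polynomial ring); it meets $\mathfrak{a}_n$ only in $0$ and is identified with its image in $\mathcal{A}_n$. For $S\subseteq\mathbb{A}_n$, $\overline{S}$ is its image in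 $\mathcal{A}_n$. $\Delta_n^0:=\Delta_n\setminus\{0\}$ and ${}'\Delta_n:=\Delta_n\cap{}'S(\mathbb{A}_n)$. The right module $P_n'=K[\partial_1,\ldots,\partial_n]\simeq\mathbb{A}_n/\sum_i\big(x_i\mathbb{A}_n+(H_i-1)\mathbb{A}_n\big)$ has action $\partial^\alpha\cdot\partial_i=\partial^{\alpha+e_i}$, $\partial^\alpha\cdot x_i=\alpha_i\partial^{\alpha-e_i}$, $\partial^\alpha\cdot H_i^{\pm1}=(\alpha_i+1)^{\pm1}\partial^\alpha$, where $e_1,\ldots,e_n$ is the standard basis of $\mathbb{Z}^n$. *)

theory Defs
  imports
    "HOL-Algebra.QuotRing"
    "HOL-Algebra.Generated_Rings"
    "HOL-Algebra.Module"
    "HOL-Library.Poly_Mapping"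
    "HOL-Library.Function_Algebras"
begin

section \<open>Localization of noncommutative rings\<close>

definition multiplicative_set :: "('a, 'm) ring_scheme \<Rightarrow> 'a set \<Rightarrow> bool" where
  "multiplicative_set R S \<longleftrightarrow> S \<subseteq> carrier R \<and> \<one>\<^bsub>R\<^esub> \<in> S \<and>
     (\<forall>s\<in>S. \<forall>t\<in>S. s \<otimes>\<^bsub>R\<^esub> t \<in> S) \<and> \<zero>\<^bsub>R\<^esub> \<notin> S"

definition left_Ore_set :: "('a, 'm) ring_scheme \<Rightarrow> 'a set \<Rightarrow> bool" where
  "left_Ore_set R S \<longleftrightarrow> multiplicative_set R S \<and>
     (\<forall>r\<in>carrier R. \<forall>s\<in>S. (S #>\<^bsub>R\<^esub> r) \<inter> (carrier R #>\<^bsub>R\<^esub> s) \<noteq> {})"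

definition left_denominator_set :: "('a, 'm) ring_scheme \<Rightarrow> 'a set \<Rightarrow> bool" where
  "left_denominator_set R S \<longleftrightarrow> left_Ore_set R S \<and>
     (\<forall>r\<in>carrier R. \<forall>s\<in>S. r \<otimes>\<^bsub>R\<^esub> s = \<zero>\<^bsub>R\<^esub> \<longrightarrow> (\<exists>t\<in>S. t \<otimes>\<^bsub>R\<^esub> r = \<zero>\<^bsub>R\<^esub>))"

text \<open>
  The pair \<open>(s, r)\<close> stands for the left fraction \<open>s\<inverse>r\<close>.  For a left denominator set \<open>S\<close> the
  relation below is an equivalence relation, and the unions in \<open>left_localization\<close> range over
  equal classes: from \<open>as = bt \<in> S\<close> one gets \<open>s\<inverse>r + t\<inverse>q = (as)\<inverse>(ar + bq)\<close>, and from
  \<open>ur = pt\<close> with \<open>u \<in> S\<close> one gets \<open>s\<inverse>r \<cdot> t\<inverse>q = (us)\<inverse>(pq)\<close>.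
\<close>

definition left_fraction_rel ::
  "('a, 'm) ring_scheme \<Rightarrow> 'a set \<Rightarrow> (('a \<times> 'a) \<times> ('a \<times> 'a)) set" where
  "left_fraction_rel R S = {((s, r), (t, q)).
     s \<in> S \<and> t \<in> S \<and> r \<in> carrier R \<and> q \<in> carrier R \<and>
     (\<exists>a\<in>carrier R. \<exists>b\<in>carrier R. a \<otimes>\<^bsub>R\<^esub> s = b \<otimes>\<^bsub>R\<^esub> t \<and> a \<otimes>\<^bsub>R\<^esub> s \<in> S \<and>
        a \<otimes>\<^bsub>R\<^esub> r = b \<otimes>\<^bsub>R\<^esub> q)}"

definition left_fraction ::
  "('a, 'm) ring_scheme \<Rightarrow> 'a set \<Rightarrow> 'a \<Rightarrow> 'a \<Rightarrow> ('a \<times> 'a) set" where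
  "left_fraction R S s r = left_fraction_rel R S `` {(s, r)}"

definition left_localization ::
  "('k, 'a, 'm) module_scheme \<Rightarrow> 'a set \<Rightarrow> ('k, ('a \<times> 'a) set) module" where
  "left_localization R S = \<lparr>
     carrier = (S \<times> carrier R) // left_fraction_rel R S,
     monoid.mult = (\<lambda>X Y. \<Union>{left_fraction R S (u \<otimes>\<^bsub>R\<^esub> s) (p \<otimes>\<^bsub>R\<^esub> q) | s r t q u p.
        (s, r) \<in> X \<and> (t, q) \<in> Y \<and> u \<in> S \<and> p \<in> carrier R \<and> u \<otimes>\<^bsub>R\<^esub> r = p \<otimes>\<^bsub>R\<^esub> t}),
     one = left_fraction R S \<one>\<^bsub>R\<^esub> \<one>\<^bsub>R\<^esub>,
     zero = left_fraction R S \<one>\<^bsub>R\<^esub> \<zero>\<^bsub>R\<^esub>,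
     add = (\<lambda>X Y. \<Union>{left_fraction R S (a \<otimes>\<^bsub>R\<^esub> s) (a \<otimes>\<^bsub>R\<^esub> r \<oplus>\<^bsub>R\<^esub> b \<otimes>\<^bsub>R\<^esub> q) | s r t q a b.
        (s, r) \<in> X \<and> (t, q) \<in> Y \<and> a \<in> carrier R \<and> b \<in> carrier R \<and>
        a \<otimes>\<^bsub>R\<^esub> s = b \<otimes>\<^bsub>R\<^esub> t \<and> a \<otimes>\<^bsub>R\<^esub> s \<in> S}),
     smult = (\<lambda>c X. \<Union>{left_fraction R S s (c \<odot>\<^bsub>R\<^esub> r) | s r. (s, r) \<in> X}) \<rparr>"

definition left_regular_elements :: "('a, 'm) ring_scheme \<Rightarrow> 'a set" where
  "left_regular_elements R =
     {c \<in> carrier R. \<forall>r\<in>carrier R. r \<otimes>\<^bsub>R\<^esub> c = \<zero>\<^bsub>R\<^esub> \<longrightarrow> r = \<zero>\<^bsub>R\<^esub>}"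

definition regular_elements :: "('a, 'm) ring_scheme \<Rightarrow> 'a set" where
  "regular_elements R =
     {c \<in> left_regular_elements R. \<forall>r\<in>carrier R. c \<otimes>\<^bsub>R\<^esub> r = \<zero>\<^bsub>R\<^esub> \<longrightarrow> r = \<zero>\<^bsub>R\<^esub>}"

definition largest_left_regular_denominator_set :: "('a, 'm) ring_scheme \<Rightarrow> 'a set" where
  "largest_left_regular_denominator_set R =
     (GREATEST S. left_denominator_set R S \<and> S \<subseteq> left_regular_elements R)"

definition classical_left_quotient_ring ::
  "('k, 'a, 'm) module_scheme \<Rightarrow> ('k, ('a \<times> 'a) set) module" where
  "classical_left_quotient_ring R = left_localization R (regular_elements R)"

text \<open>The scalars of an algebra are all elements of the type \<open>'k\<close>.\<close>

definition algebra_isomorphic ::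
  "('k, 'a, 'm) module_scheme \<Rightarrow> ('k, 'b, 'l) module_scheme \<Rightarrow> bool" where
  "algebra_isomorphic A B \<longleftrightarrow>
     (\<exists>f\<in>ring_iso A B. \<forall>c. \<forall>a\<in>carrier A. f (c \<odot>\<^bsub>A\<^esub> a) = c \<odot>\<^bsub>B\<^esub> f a)"

definition left_dense :: "('a, 'm) ring_scheme \<Rightarrow> 'a set \<Rightarrow> 'a set \<Rightarrow> bool" where
  "left_dense R S T \<longleftrightarrow> multiplicative_set R S \<and> multiplicative_set R T \<and> S \<subseteq> T \<and>
     (\<forall>t\<in>T. \<exists>r\<in>carrier R. r \<otimes>\<^bsub>R\<^esub> t \<in> S)"

definition regular_on_right_module ::
  "('a, 'm) ring_scheme \<Rightarrow> 'v set \<Rightarrow> ('v \<Rightarrow> 'a \<Rightarrow> 'v) \<Rightarrow> 'a set" where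
  "regular_on_right_module R M act = {r \<in> carrier R. inj_on (\<lambda>m. act m r) M}"

definition all_equivalent :: "bool list \<Rightarrow> bool" where
  "all_equivalent ps \<longleftrightarrow> (\<forall>p\<in>set ps. \<forall>q\<in>set ps. p \<longleftrightarrow> q)"


section \<open>The polynomial algebra and its linear operators\<close>

text \<open>
  The variables are indexed by a finite type \<open>'n\<close>, so that \<open>n = CARD('n) \<ge> 1\<close>.  A polynomial is a
  finitely supported function on exponent vectors; its ring structure is that of
  \<^theory>\<open>HOL-Library.Poly_Mapping\<close>.
\<close>

type_synonym 'n exponent = "'n \<Rightarrow>\<^sub>0 nat"
type_synonym ('n, 'k) polynomial = "'n exponent \<Rightarrow>\<^sub>0 'k"
type_synonym ('n, 'k) operator = "('n, 'k) polynomial \<Rightarrow> ('n, 'k) polynomial"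
type_synonym ('n, 'k) operator_algebra = "('k, ('n, 'k) operator) module"

abbreviation unit_exponent :: "'n \<Rightarrow> 'n exponent" where
  "unit_exponent i \<equiv> Poly_Mapping.single i 1"

abbreviation monomial :: "'n exponent \<Rightarrow> ('n, 'k::field_char_0) polynomial" where
  "monomial \<alpha> \<equiv> Poly_Mapping.single \<alpha> 1"

definition scale :: "'k::field_char_0 \<Rightarrow> ('n, 'k) polynomial \<Rightarrow> ('n, 'k) polynomial" where
  "scale c p = Poly_Mapping.map ((*) c) p"

definition linear_extension ::
  "('n exponent \<Rightarrow> ('n, 'k) polynomial) \<Rightarrow> ('n, 'k::field_char_0) operator" where
  "linear_extension f p =
     (\<Sum>\<alpha>\<in>Poly_Mapping.keys p. scale (Poly_Mapping.lookup p \<alpha>) (f \<alpha>))"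

definition End_polynomials :: "('n, 'k::field_char_0) operator_algebra" where
  "End_polynomials = \<lparr>
     carrier = {f. Vector_Spaces.linear scale scale f},
     monoid.mult = (\<circ>), one = id, zero = 0, add = (+),
     smult = (\<lambda>c f p. scale c (f p)) \<rparr>"

definition operator_span :: "('n, 'k) operator set \<Rightarrow> ('n, 'k::field_char_0) operator set" where
  "operator_span X = Modules.module.span (\<lambda>c f p. scale c (f p)) X"

definition generated_algebra ::
  "('n, 'k) operator set \<Rightarrow> ('n, 'k::field_char_0) operator_algebra" where
  "generated_algebra X = End_polynomials
     \<lparr>carrier := generate_ring End_polynomials
        (range (\<lambda>c. c \<odot>\<^bsub>End_polynomials\<^esub> \<one>\<^bsub>End_polynomials\<^esub>) \<union> X)\<rparr>"

definition x_op :: "'n \<Rightarrow> ('n, 'k::field_char_0) operator" where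
  "x_op i p = monomial (unit_exponent i) * p"

definition d_op :: "'n \<Rightarrow> ('n, 'k::field_char_0) operator" where
  "d_op i = linear_extension (\<lambda>\<alpha>.
     scale (of_nat (Poly_Mapping.lookup \<alpha> i)) (monomial (\<alpha> - unit_exponent i)))"

definition H_op :: "'n \<Rightarrow> ('n, 'k::field_char_0) operator" where
  "H_op i = d_op i \<circ> x_op i"

text \<open>\<open>H_shift_inv i k\<close> is \<open>(H\<^sub>i + k)\<inverse>\<close>; as \<open>H\<^sub>i x\<^sup>\<alpha> = (\<alpha>\<^sub>i + 1) x\<^sup>\<alpha>\<close>, the map \<open>H\<^sub>i + k\<close> is bijective.\<close>

definition H_shift_inv :: "'n \<Rightarrow> nat \<Rightarrow> ('n, 'k::field_char_0) operator" where
  "H_shift_inv i k = inv_into UNIV (\<lambda>p. H_op i p + scale (of_nat k) p)"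

definition H_inv :: "'n \<Rightarrow> ('n, 'k::field_char_0) operator" where
  "H_inv i = inv_into UNIV (H_op i)"


section \<open>The Weyl algebra and the Jacobian algebra\<close>

definition weyl_algebra :: "('n::finite, 'k::field_char_0) operator_algebra" where
  "weyl_algebra = generated_algebra (range x_op \<union> range d_op)"

text \<open>\<open>jacobian_algebra_on J\<close> is the tensor product of the copies of \<open>\<bbbA>\<^sub>1\<close> with indices in \<open>J\<close>.\<close>

definition jacobian_algebra_on :: "'n set \<Rightarrow> ('n::finite, 'k::field_char_0) operator_algebra" where
  "jacobian_algebra_on J = generated_algebra (x_op ` J \<union> d_op ` J \<union> H_inv ` J)"

definition jacobian_algebra :: "('n::finite, 'k::field_char_0) operator_algebra" where
  "jacobian_algebra = jacobian_algebra_on UNIV"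

text \<open>
  Inside \<open>\<bbbA>\<^sub>n = \<bbbA>\<^sub>1\<^sup>\<otimes>\<^sup>n\<close>, the element \<open>E\<^sub>k\<^sub>l\<close> of the \<open>i\<close>-th factor acts by
  \<open>x\<^sup>\<gamma> \<mapsto> \<delta>\<^bsub>l,\<gamma>\<^sub>i\<^esub> x\<^bsup>\<gamma> + (k - l) e\<^sub>i\<^esup>\<close>.
\<close>

definition matrix_unit_at :: "'n \<Rightarrow> nat \<Rightarrow> nat \<Rightarrow> ('n, 'k::field_char_0) operator" where
  "matrix_unit_at i k l = linear_extension (\<lambda>\<gamma>.
     if Poly_Mapping.lookup \<gamma> i = l then monomial (Poly_Mapping.update i k \<gamma>) else 0)"

definition F_at :: "'n \<Rightarrow> ('n, 'k::field_char_0) operator set" where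
  "F_at i = operator_span {matrix_unit_at i k l | k l. True}"

definition p_ideal :: "'n \<Rightarrow> ('n::finite, 'k::field_char_0) operator set" where
  "p_ideal i = operator_span
     {f \<circ> b | f b. f \<in> F_at i \<and> b \<in> carrier (jacobian_algebra_on (- {i}))}"

definition a_ideal :: "('n::finite, 'k::field_char_0) operator set" where
  "a_ideal = {\<Sum>i\<in>UNIV. f i | f. \<forall>i. f i \<in> p_ideal i}"

text \<open>\<open>matrix_unit \<alpha> \<beta>\<close> is the tensor product of the \<open>E\<^bsub>\<alpha>\<^sub>i\<beta>\<^sub>i\<^esub>\<close>, so these operators span \<open>F\<^sub>n = F\<^sup>\<otimes>\<^sup>n\<close>.\<close>

definition matrix_unit :: "'n exponent \<Rightarrow> 'n exponent \<Rightarrow> ('n, 'k::field_char_0) operator" where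
  "matrix_unit \<alpha> \<beta> = linear_extension (\<lambda>\<gamma>. if \<gamma> = \<beta> then monomial \<alpha> else 0)"

definition F_ideal :: "('n::finite, 'k::field_char_0) operator set" where
  "F_ideal = operator_span {matrix_unit \<alpha> \<beta> | \<alpha> \<beta>. True}"

definition jacobian_factor_algebra :: "('n::finite, 'k::field_char_0) operator set ring" where
  "jacobian_factor_algebra = jacobian_algebra Quot a_ideal"

definition jacobian_projection ::
  "('n::finite, 'k::field_char_0) operator \<Rightarrow> ('n, 'k) operator set" where
  "jacobian_projection r = a_ideal +>\<^bsub>jacobian_algebra\<^esub> r"

definition Delta :: "('n::finite, 'k::field_char_0) operator_algebra" where
  "Delta = generated_algebra
     (range H_op \<union> range H_inv \<union> {H_shift_inv i k | i k. k \<ge> 1} \<union> range d_op)"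

definition Delta_nonzero :: "('n::finite, 'k::field_char_0) operator set" where
  "Delta_nonzero = carrier Delta - {\<zero>\<^bsub>Delta\<^esub>}"

definition Delta_denominators :: "('n::finite, 'k::field_char_0) operator set" where
  "Delta_denominators = carrier Delta \<inter> largest_left_regular_denominator_set jacobian_algebra"


section \<open>The right module \<open>K[\<partial>\<^sub>1, \<dots>, \<partial>\<^sub>n]\<close>\<close>

text \<open>
  Here \<open>monomial \<alpha>\<close> stands for \<open>\<partial>\<^sup>\<alpha>\<close>.  The action is given on the generators of the Jacobian
  algebra, and \<open>right_multiplication r f\<close> says that \<open>f\<close> is the map \<open>m \<mapsto> m \<cdot> r\<close>.  As the module is
  a right module, the product \<open>r \<circ> s\<close> acts first by \<open>r\<close> and then by \<open>s\<close>.
\<close>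

inductive right_multiplication ::
  "('n::finite, 'k::field_char_0) operator \<Rightarrow> ('n, 'k) operator \<Rightarrow> bool" where
  rm_d: "right_multiplication (d_op i)
     (linear_extension (\<lambda>\<alpha>. monomial (\<alpha> + unit_exponent i)))"
| rm_x: "right_multiplication (x_op i)
     (linear_extension (\<lambda>\<alpha>.
        scale (of_nat (Poly_Mapping.lookup \<alpha> i)) (monomial (\<alpha> - unit_exponent i))))"
| rm_H_inv: "right_multiplication (H_inv i)
     (linear_extension (\<lambda>\<alpha>.
        scale (inverse (of_nat (Poly_Mapping.lookup \<alpha> i + 1))) (monomial \<alpha>)))"
| rm_scalar: "right_multiplication (scale c) (scale c)"
| rm_add: "right_multiplication r f \<Longrightarrow> right_multiplication s g \<Longrightarrow>
     right_multiplication (r + s) (f + g)"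
| rm_mult: "right_multiplication r f \<Longrightarrow> right_multiplication s g \<Longrightarrow>
     right_multiplication (r \<circ> s) (g \<circ> f)"

definition P'_act :: "('n::finite, 'k::field_char_0) polynomial \<Rightarrow> ('n, 'k) operator \<Rightarrow>
    ('n, 'k) polynomial" where
  "P'_act m r = (THE f. right_multiplication r f) m"


section \<open>Well-definedness of the definite descriptions\<close>

lemma lookup_scale: "Poly_Mapping.lookup (scale c p) \<alpha> = c * Poly_Mapping.lookup p \<alpha>"
  by (simp add: scale_def Poly_Mapping.map.rep_eq when_def)

interpretation pol: vector_space "scale :: 'k::field_char_0 \<Rightarrow> ('n, 'k) polynomial \<Rightarrow> _"
  by unfold_locales
    (auto intro!: poly_mapping_eqI simp: lookup_scale lookup_add algebra_simps)

interpretation pol_pair: vector_space_pair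
  "scale :: 'k::field_char_0 \<Rightarrow> ('n, 'k) polynomial \<Rightarrow> _"
  "scale :: 'k::field_char_0 \<Rightarrow> ('n, 'k) polynomial \<Rightarrow> _" ..

lemma linear_operatorI:
  fixes f :: "('n, 'k::field_char_0) operator"
  assumes "\<And>p q. f (p + q) = f p + f q" "\<And>c p. f (scale c p) = scale c (f p)"
  shows "Vector_Spaces.linear scale scale f"
  unfolding Vector_Spaces.linear_iff using assms pol.vector_space_axioms by blast

lemma linear_extension_superset:
  assumes "finite B" "Poly_Mapping.keys p \<subseteq> B"
  shows "linear_extension f p = (\<Sum>\<alpha>\<in>B. scale (Poly_Mapping.lookup p \<alpha>) (f \<alpha>))"
  unfolding linear_extension_def
  by (rule sum.mono_neutral_left) (use assms in \<open>auto simp: in_keys_iff\<close>)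

lemma linear_linear_extension:
  "Vector_Spaces.linear scale scale (linear_extension f :: ('n, 'k::field_char_0) operator)"
proof (rule linear_operatorI)
  fix p q :: "('n, 'k) polynomial"
  let ?B = "Poly_Mapping.keys p \<union> Poly_Mapping.keys q"
  have "linear_extension f (p + q) =
      (\<Sum>\<alpha>\<in>?B. scale (Poly_Mapping.lookup (p + q) \<alpha>) (f \<alpha>))"
    by (rule linear_extension_superset) (use keys_add[of p q] in auto)
  also have "\<dots> = (\<Sum>\<alpha>\<in>?B. scale (Poly_Mapping.lookup p \<alpha>) (f \<alpha>)) +
      (\<Sum>\<alpha>\<in>?B. scale (Poly_Mapping.lookup q \<alpha>) (f \<alpha>))"
    by (simp add: lookup_add pol.scale_left_distrib sum.distrib)
  also have "\<dots> = linear_extension f p + linear_extension f q"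
    by (simp add: linear_extension_superset[where B = ?B])
  finally show "linear_extension f (p + q) = linear_extension f p + linear_extension f q" .
next
  fix c :: 'k and p :: "('n, 'k) polynomial"
  have "Poly_Mapping.keys (scale c p) \<subseteq> Poly_Mapping.keys p"
    by (auto simp: in_keys_iff lookup_scale)
  then have "linear_extension f (scale c p) =
      (\<Sum>\<alpha>\<in>Poly_Mapping.keys p. scale (Poly_Mapping.lookup (scale c p) \<alpha>) (f \<alpha>))"
    by (intro linear_extension_superset) auto
  then show "linear_extension f (scale c p) = scale c (linear_extension f p)"
    by (simp add: lookup_scale pol.scale_sum_right linear_extension_def)
qed

lemma linear_extension_monomial [simp]: "linear_extension f (monomial \<alpha>) = f \<alpha>"
  by (simp add: linear_extension_def)

lemma linear_extension_monomials [simp]: "linear_extension monomial p = p"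
proof (rule poly_mapping_eqI)
  fix \<beta>
  have "Poly_Mapping.lookup (linear_extension monomial p) \<beta> =
      (\<Sum>\<alpha>\<in>Poly_Mapping.keys p. if \<alpha> = \<beta> then Poly_Mapping.lookup p \<alpha> else 0)"
    unfolding linear_extension_def lookup_sum
    by (rule sum.cong) (auto simp: lookup_scale lookup_single when_def)
  then show "Poly_Mapping.lookup (linear_extension monomial p) \<beta> = Poly_Mapping.lookup p \<beta>"
    by (simp add: in_keys_iff)
qed

lemma linear_expand:
  fixes f :: "('n, 'k::field_char_0) operator"
  assumes "Vector_Spaces.linear scale scale f"
  shows "f p = (\<Sum>\<alpha>\<in>Poly_Mapping.keys p. scale (Poly_Mapping.lookup p \<alpha>) (f (monomial \<alpha>)))"
proof -
  have "f p = f (linear_extension monomial p)" by simp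
  also have "\<dots> = (\<Sum>\<alpha>\<in>Poly_Mapping.keys p. scale (Poly_Mapping.lookup p \<alpha>) (f (monomial \<alpha>)))"
    unfolding linear_extension_def
    by (simp add: pol_pair.linear_sum[OF assms] pol_pair.linear_scale[OF assms])
  finally show ?thesis .
qed

lemma linear_operator_eqI:
  fixes f g :: "('n, 'k::field_char_0) operator"
  assumes "Vector_Spaces.linear scale scale f" "Vector_Spaces.linear scale scale g"
    and "\<And>\<alpha>. f (monomial \<alpha>) = g (monomial \<alpha>)"
  shows "f = g"
proof
  show "f p = g p" for p
    by (subst (1 2) linear_expand) (use assms in auto)
qed

lemma linear_x_op: "Vector_Spaces.linear scale scale (x_op i :: ('n, 'k::field_char_0) operator)"
proof (rule linear_operatorI)
  show "x_op i (p + q) = x_op i p + x_op i q" for p q :: "('n, 'k) polynomial"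
    by (simp add: x_op_def algebra_simps)
  show "x_op i (scale c p) = scale c (x_op i p)" for c and p :: "('n, 'k) polynomial"
    by (simp add: x_op_def scale_def mult_map_scale_conv_mult mult.left_commute)
qed

lemma x_op_monomial: "x_op i (monomial \<alpha>) = monomial (\<alpha> + unit_exponent i)"
  by (simp add: x_op_def mult_single add.commute)

lemma linear_d_op: "Vector_Spaces.linear scale scale (d_op i)"
  unfolding d_op_def by (rule linear_linear_extension)

lemma d_op_monomial:
  "d_op i (monomial \<alpha>) =
     scale (of_nat (Poly_Mapping.lookup \<alpha> i)) (monomial (\<alpha> - unit_exponent i))"
  by (simp add: d_op_def)

lemma linear_H_op: "Vector_Spaces.linear scale scale (H_op i)"
  unfolding H_op_def by (rule Vector_Spaces.linear_compose[OF linear_x_op linear_d_op])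

lemma H_op_monomial:
  "H_op i (monomial \<alpha>) = scale (of_nat (Poly_Mapping.lookup \<alpha> i + 1)) (monomial \<alpha>)"
  by (simp add: H_op_def x_op_monomial d_op_monomial lookup_add)

lemma linear_H_op_shift:
  "Vector_Spaces.linear scale scale (\<lambda>p. H_op i p + scale (of_nat k) p)"
  by (intro pol_pair.linear_compose_add linear_H_op pol.linear_scale_self)

lemma H_shift_inv_eq:
  "H_shift_inv i k = (linear_extension (\<lambda>\<alpha>.
     scale (inverse (of_nat (Poly_Mapping.lookup \<alpha> i + 1 + k))) (monomial \<alpha>))
     :: ('n, 'k::field_char_0) operator)" (is "_ = ?g")
proof -
  let ?f = "\<lambda>p :: ('n, 'k) polynomial. H_op i p + scale (of_nat k) p"
  have f: "?f (monomial \<alpha>) = scale (of_nat (Poly_Mapping.lookup \<alpha> i + 1 + k)) (monomial \<alpha>)" for \<alpha>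
    unfolding H_op_monomial of_nat_add[of _ k] pol.scale_left_distrib ..
  have nz: "(of_nat (Poly_Mapping.lookup \<alpha> i + 1 + k) :: 'k) \<noteq> 0" for \<alpha> :: "'n exponent"
    unfolding of_nat_eq_0_iff by simp
  have lin: "Vector_Spaces.linear scale scale ?g" by (rule linear_linear_extension)
  have "?f \<circ> ?g = id"
  proof (rule linear_operator_eqI)
    fix \<alpha> :: "'n exponent"
    let ?c = "of_nat (Poly_Mapping.lookup \<alpha> i + 1 + k) :: 'k"
    have "(?f \<circ> ?g) (monomial \<alpha>) = ?f (scale (inverse ?c) (monomial \<alpha>))"
      by (simp only: comp_def linear_extension_monomial)
    also have "\<dots> = scale (inverse ?c) (?f (monomial \<alpha>))"
      by (rule pol_pair.linear_scale[OF linear_H_op_shift])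
    also have "\<dots> = id (monomial \<alpha>)"
      unfolding f id_def pol.scale_scale using nz[of \<alpha>] by simp
    finally show "(?f \<circ> ?g) (monomial \<alpha>) = id (monomial \<alpha>)" .
  qed (rule Vector_Spaces.linear_compose[OF lin linear_H_op_shift] pol.linear_id)+
  moreover have "?g \<circ> ?f = id"
  proof (rule linear_operator_eqI)
    show "(?g \<circ> ?f) (monomial \<alpha>) = id (monomial \<alpha>)" for \<alpha>
      unfolding comp_def f pol_pair.linear_scale[OF lin] linear_extension_monomial
        id_def pol.scale_scale
      using nz[of \<alpha>] by simp
  qed (rule Vector_Spaces.linear_compose[OF linear_H_op_shift lin] pol.linear_id)+
  ultimately have "inv_into UNIV ?f = ?g"
    by (intro inv_unique_comp)
  then show ?thesis by (simp add: H_shift_inv_def)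
qed

lemma H_inv_eq_shift: "H_inv i = (H_shift_inv i 0 :: ('n, 'k::field_char_0) operator)"
  by (simp add: H_inv_def H_shift_inv_def)

lemma linear_H_inv: "Vector_Spaces.linear scale scale (H_inv i)"
  unfolding H_inv_eq_shift H_shift_inv_eq by (rule linear_linear_extension)

lemma H_inv_monomial:
  "H_inv i (monomial \<alpha>) =
     scale (inverse (of_nat (Poly_Mapping.lookup \<alpha> i + 1))) (monomial \<alpha>)"
  unfolding H_inv_eq_shift H_shift_inv_eq by simp

definition exponent_fact :: "'n::finite exponent \<Rightarrow> 'k::field_char_0" where
  "exponent_fact \<alpha> = (\<Prod>i\<in>UNIV. fact (Poly_Mapping.lookup \<alpha> i))"

lemma exponent_fact_nonzero: "exponent_fact \<alpha> \<noteq> (0 :: 'k::field_char_0)"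
  by (simp add: exponent_fact_def)

lemma exponent_fact_add_unit:
  "exponent_fact (\<alpha> + unit_exponent i) =
     of_nat (Poly_Mapping.lookup \<alpha> i + 1) * (exponent_fact \<alpha> :: 'k::field_char_0)"
proof -
  have "(\<Prod>j\<in>- {i}. fact (Poly_Mapping.lookup (\<alpha> + unit_exponent i) j) :: 'k) =
      (\<Prod>j\<in>- {i}. fact (Poly_Mapping.lookup \<alpha> j))"
    by (rule prod.cong) (auto simp: lookup_add lookup_single)
  then show ?thesis
    unfolding exponent_fact_def
    by (simp add: prod.remove[of UNIV i] Compl_eq_Diff_UNIV lookup_add algebra_simps)
qed

lemma exponent_minus_unit:
  "Poly_Mapping.lookup \<beta> i \<noteq> 0 \<Longrightarrow> (\<beta> - unit_exponent i = \<alpha>) \<longleftrightarrow> \<beta> = \<alpha> + unit_exponent i"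
  by (auto intro!: poly_mapping_eqI simp: lookup_add lookup_minus lookup_single when_def)

text \<open>Up to rescaling the bases, a map \<open>m \<mapsto> m \<cdot> r\<close> is the transpose of \<open>r\<close>.\<close>

lemma right_multiplication_transpose:
  fixes r f :: "('n::finite, 'k::field_char_0) operator"
  assumes "right_multiplication r f"
  shows "Vector_Spaces.linear scale scale r \<and> Vector_Spaces.linear scale scale f \<and>
    (\<forall>\<alpha> \<beta>. exponent_fact \<beta> * Poly_Mapping.lookup (f (monomial \<alpha>)) \<beta> =
       exponent_fact \<alpha> * Poly_Mapping.lookup (r (monomial \<beta>)) \<alpha>)"
  using assms
proof induction
  case (rm_d i)
  have "(exponent_fact \<beta> :: 'k) * Poly_Mapping.lookup (monomial (\<alpha> + unit_exponent i)) \<beta> =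
      exponent_fact \<alpha> * Poly_Mapping.lookup (d_op i (monomial \<beta>)) \<alpha>"
    for \<alpha> \<beta> :: "'n exponent"
  proof (cases "\<beta> = \<alpha> + unit_exponent i")
    case True
    show ?thesis
      unfolding True exponent_fact_add_unit d_op_monomial lookup_scale
      by (simp add: lookup_add)
  next
    case False
    have "of_nat (Poly_Mapping.lookup \<beta> i) *
        Poly_Mapping.lookup (monomial (\<beta> - unit_exponent i)) \<alpha> = (0 :: 'k)"
    proof (cases "Poly_Mapping.lookup \<beta> i = 0")
      case nz: False
      then have "\<beta> - unit_exponent i \<noteq> \<alpha>"
        using exponent_minus_unit[OF nz, of \<alpha>] False by blast
      then show ?thesis by (simp add: lookup_single_not_eq)
    qed simp
    moreover have "Poly_Mapping.lookup (monomial (\<alpha> + unit_exponent i)) \<beta> = (0 :: 'k)"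
      using False by (intro lookup_single_not_eq) blast
    ultimately show ?thesis
      unfolding d_op_monomial lookup_scale by simp
  qed
  then show ?case
    unfolding linear_extension_monomial
    by (intro conjI allI linear_linear_extension linear_d_op)
next
  case (rm_x i)
  have "(exponent_fact \<beta> :: 'k) * Poly_Mapping.lookup
        (scale (of_nat (Poly_Mapping.lookup \<alpha> i)) (monomial (\<alpha> - unit_exponent i))) \<beta> =
      exponent_fact \<alpha> * Poly_Mapping.lookup (x_op i (monomial \<beta>)) \<alpha>"
    for \<alpha> \<beta> :: "'n exponent"
  proof (cases "Poly_Mapping.lookup \<alpha> i = 0")
    case True
    then have "\<beta> + unit_exponent i \<noteq> \<alpha>" by (auto simp: lookup_add)
    with True show ?thesis by (simp add: x_op_monomial lookup_scale lookup_single when_def)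
  next
    case False
    show ?thesis
    proof (cases "\<alpha> = \<beta> + unit_exponent i")
      case True
      then show ?thesis
        by (simp only: exponent_fact_add_unit)
          (simp add: x_op_monomial lookup_scale lookup_add)
    next
      case neq: False
      with exponent_minus_unit[OF False, of \<beta>] show ?thesis
        by (simp add: x_op_monomial lookup_scale lookup_single when_def)
    qed
  qed
  then show ?case
    unfolding linear_extension_monomial
    by (intro conjI allI linear_linear_extension linear_x_op)
next
  case (rm_H_inv i)
  show ?case
    unfolding linear_extension_monomial H_inv_monomial lookup_scale lookup_single
    by (intro conjI allI linear_linear_extension linear_H_inv) (simp add: when_def)
next
  case (rm_scalar c)
  then show ?case
    by (auto simp: lookup_scale lookup_single when_def pol.linear_scale_self)
next
  case (rm_add r f s g)
  then have "Vector_Spaces.linear scale scale (r + s)" "Vector_Spaces.linear scale scale (f + g)"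
    unfolding plus_fun_def by (blast intro: pol_pair.linear_compose_add)+
  moreover have "exponent_fact \<beta> * Poly_Mapping.lookup ((f + g) (monomial \<alpha>)) \<beta> =
      exponent_fact \<alpha> * Poly_Mapping.lookup ((r + s) (monomial \<beta>)) \<alpha>" for \<alpha> \<beta>
    unfolding plus_fun_apply lookup_add distrib_left
    by (rule arg_cong2[where f = "(+)"]) (use rm_add.IH in blast)+
  ultimately show ?case by blast
next
  case (rm_mult r f s g)
  have lin: "Vector_Spaces.linear scale scale r" "Vector_Spaces.linear scale scale f"
      "Vector_Spaces.linear scale scale s" "Vector_Spaces.linear scale scale g"
    and rf: "\<And>\<alpha> \<beta>. exponent_fact \<beta> * Poly_Mapping.lookup (f (monomial \<alpha>)) \<beta> =
       exponent_fact \<alpha> * Poly_Mapping.lookup (r (monomial \<beta>)) \<alpha>"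
    and sg: "\<And>\<alpha> \<beta>. exponent_fact \<beta> * Poly_Mapping.lookup (g (monomial \<alpha>)) \<beta> =
       exponent_fact \<alpha> * Poly_Mapping.lookup (s (monomial \<beta>)) \<alpha>"
    using rm_mult.IH by blast+
  have "exponent_fact \<beta> * Poly_Mapping.lookup (g (f (monomial \<alpha>))) \<beta> =
      exponent_fact \<alpha> * Poly_Mapping.lookup (r (s (monomial \<beta>))) \<alpha>" for \<alpha> \<beta>
  proof -
    let ?B = "Poly_Mapping.keys (f (monomial \<alpha>)) \<union> Poly_Mapping.keys (s (monomial \<beta>))"
    have ex: "h p = (\<Sum>\<gamma>\<in>?B. scale (Poly_Mapping.lookup p \<gamma>) (h (monomial \<gamma>)))"
      if "Vector_Spaces.linear scale scale h" "Poly_Mapping.keys p \<subseteq> ?B"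
      for h :: "('n, 'k) operator" and p
      using linear_expand[OF that(1), of p]
        linear_extension_superset[of ?B p "\<lambda>\<gamma>. h (monomial \<gamma>)"] that(2)
      by (simp add: linear_extension_def)
    have "exponent_fact \<beta> * Poly_Mapping.lookup (g (f (monomial \<alpha>))) \<beta> =
        (\<Sum>\<gamma>\<in>?B. Poly_Mapping.lookup (f (monomial \<alpha>)) \<gamma> *
           (exponent_fact \<beta> * Poly_Mapping.lookup (g (monomial \<gamma>)) \<beta>))"
      unfolding ex[OF lin(4), of "f (monomial \<alpha>)", OF Un_upper1] lookup_sum lookup_scale
        sum_distrib_left by (rule sum.cong[OF refl mult.left_commute])
    also have "\<dots> = (\<Sum>\<gamma>\<in>?B. (exponent_fact \<gamma> * Poly_Mapping.lookup (f (monomial \<alpha>)) \<gamma>) *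
        Poly_Mapping.lookup (s (monomial \<beta>)) \<gamma>)"
      unfolding sg by (rule sum.cong) (simp_all only: mult_ac)
    also have "\<dots> = (\<Sum>\<gamma>\<in>?B. exponent_fact \<alpha> * (Poly_Mapping.lookup (s (monomial \<beta>)) \<gamma> *
        Poly_Mapping.lookup (r (monomial \<gamma>)) \<alpha>))"
      unfolding rf by (rule sum.cong) (simp_all only: mult_ac)
    also have "\<dots> = exponent_fact \<alpha> * Poly_Mapping.lookup (r (s (monomial \<beta>))) \<alpha>"
      unfolding ex[OF lin(1), of "s (monomial \<beta>)", OF Un_upper2] lookup_sum lookup_scale
        sum_distrib_left ..
    finally show ?thesis .
  qed
  then show ?case
    using Vector_Spaces.linear_compose[OF lin(3,1)]
      Vector_Spaces.linear_compose[OF lin(2,4)] unfolding comp_def by blast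
qed

lemma right_multiplication_unique:
  assumes "right_multiplication r f" "right_multiplication r g"
  shows "f = g"
proof (rule linear_operator_eqI)
  show "f (monomial \<alpha>) = g (monomial \<alpha>)" for \<alpha>
  proof (rule poly_mapping_eqI)
    fix \<beta>
    have "exponent_fact \<beta> * Poly_Mapping.lookup (f (monomial \<alpha>)) \<beta> =
        exponent_fact \<beta> * Poly_Mapping.lookup (g (monomial \<alpha>)) \<beta>"
      using assms[THEN right_multiplication_transpose] by metis
    then show "Poly_Mapping.lookup (f (monomial \<alpha>)) \<beta> = Poly_Mapping.lookup (g (monomial \<alpha>)) \<beta>"
      using exponent_fact_nonzero[of \<beta>, where ?'k = 'b] by simp
  qed
qed (use assms[THEN right_multiplication_transpose] in blast)+

lemma ring_End_polynomials: "ring (End_polynomials :: ('n, 'k::field_char_0) operator_algebra)"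
proof (rule ringI)
  show "abelian_group (End_polynomials :: ('n, 'k) operator_algebra)"
  proof (rule abelian_groupI)
    fix f :: "('n, 'k) operator"
    assume "f \<in> carrier End_polynomials"
    then show "\<exists>g\<in>carrier End_polynomials. g \<oplus>\<^bsub>End_polynomials\<^esub> f = \<zero>\<^bsub>End_polynomials\<^esub>"
      by (intro bexI[of _ "\<lambda>p. - f p"])
        (auto simp: End_polynomials_def fun_eq_iff intro: pol_pair.linear_compose_neg)
  qed (auto simp: End_polynomials_def add_ac plus_fun_def zero_fun_def
      intro: pol_pair.linear_compose_add pol_pair.linear_zero)
  show "monoid (End_polynomials :: ('n, 'k) operator_algebra)"
    by (rule monoidI)
      (auto simp: End_polynomials_def comp_assoc pol.linear_id
        intro: Vector_Spaces.linear_compose[unfolded comp_def] Vector_Spaces.linear_compose)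
qed (auto simp: End_polynomials_def fun_eq_iff pol_pair.linear_add)

lemma a_inv_End_polynomials:
  assumes "Vector_Spaces.linear scale scale f"
  shows "\<ominus>\<^bsub>End_polynomials\<^esub> f = (\<lambda>p. - f p)"
proof (rule abelian_group.minus_equality[OF ring.is_abelian_group[OF ring_End_polynomials]])
qed (use assms in \<open>auto simp: End_polynomials_def fun_eq_iff intro: pol_pair.linear_compose_neg\<close>)

lemma right_multiplication_exists:
  assumes "r \<in> carrier jacobian_algebra"
  shows "\<exists>f. right_multiplication r f"
proof -
  have "r \<in> generate_ring End_polynomials
      (range (\<lambda>c. c \<odot>\<^bsub>End_polynomials\<^esub> \<one>\<^bsub>End_polynomials\<^esub>) \<union>
        (range x_op \<union> range d_op \<union> range H_inv))"
    using assms by (simp add: jacobian_algebra_def jacobian_algebra_on_def generated_algebra_def)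
  then show ?thesis
  proof induction
    case one
    have "scale 1 = (\<one>\<^bsub>End_polynomials\<^esub> :: ('a, 'b) operator)"
      by (simp add: fun_eq_iff End_polynomials_def)
    then show ?case
      by (metis right_multiplication.rm_scalar)
  next
    case (incl h)
    then show ?case
      by (auto simp: End_polynomials_def intro: right_multiplication.intros)
  next
    case (a_inv h)
    then obtain f where f: "right_multiplication h f" by auto
    have "\<ominus>\<^bsub>End_polynomials\<^esub> h = scale (- 1) \<circ> h"
      using right_multiplication_transpose[OF f]
      by (simp add: a_inv_End_polynomials fun_eq_iff)
    then show ?case
      using right_multiplication.rm_mult[OF right_multiplication.rm_scalar f] by metis
  next
    case (eng_add h1 h2)
    then obtain f1 f2 where "right_multiplication h1 f1" "right_multiplication h2 f2" by blast
    from right_multiplication.rm_add[OF this] show ?case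
      unfolding End_polynomials_def ring.simps by blast
  next
    case (eng_mult h1 h2)
    then obtain f1 f2 where "right_multiplication h1 f1" "right_multiplication h2 f2" by blast
    from right_multiplication.rm_mult[OF this] show ?case
      unfolding End_polynomials_def monoid.simps by blast
  qed
qed

lemma right_multiplication_P'_act:
  assumes "r \<in> carrier jacobian_algebra"
  shows "right_multiplication r (\<lambda>m. P'_act m r)"
  unfolding P'_act_def
  using right_multiplication_exists[OF assms] right_multiplication_unique
  by (metis (no_types, lifting) ext theI')

inductive_set left_denominator_products :: "('a, 'm) ring_scheme \<Rightarrow> 'a set" for R where
  ldp_one: "\<one>\<^bsub>R\<^esub> \<in> left_denominator_products R"
| ldp_mult: "s \<in> left_denominator_products R \<Longrightarrow> left_denominator_set R S \<Longrightarrow>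
     S \<subseteq> left_regular_elements R \<Longrightarrow> t \<in> S \<Longrightarrow> s \<otimes>\<^bsub>R\<^esub> t \<in> left_denominator_products R"

lemma largest_left_regular_denominator_set:
  assumes "ring R" and "\<one>\<^bsub>R\<^esub> \<noteq> \<zero>\<^bsub>R\<^esub>"
  shows "left_denominator_set R (largest_left_regular_denominator_set R) \<and>
    largest_left_regular_denominator_set R \<subseteq> left_regular_elements R \<and>
    (\<forall>S. left_denominator_set R S \<and> S \<subseteq> left_regular_elements R \<longrightarrow>
       S \<subseteq> largest_left_regular_denominator_set R)"
proof -
  interpret ring R by fact
  let ?P = "left_denominator_products R"
  have reg: "?P \<subseteq> left_regular_elements R"
  proof
    fix s assume "s \<in> ?P"
    then show "s \<in> left_regular_elements R"
    proof induction
      case ldp_one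
      then show ?case by (simp add: left_regular_elements_def)
    next
      case (ldp_mult s S t)
      then have "t \<in> left_regular_elements R" by blast
      then have t: "t \<in> carrier R" "\<And>r. r \<in> carrier R \<Longrightarrow> r \<otimes>\<^bsub>R\<^esub> t = \<zero>\<^bsub>R\<^esub> \<Longrightarrow> r = \<zero>\<^bsub>R\<^esub>"
        by (auto simp: left_regular_elements_def)
      from ldp_mult.IH have s: "s \<in> carrier R"
          "\<And>r. r \<in> carrier R \<Longrightarrow> r \<otimes>\<^bsub>R\<^esub> s = \<zero>\<^bsub>R\<^esub> \<Longrightarrow> r = \<zero>\<^bsub>R\<^esub>"
        by (auto simp: left_regular_elements_def)
      show ?case
        unfolding left_regular_elements_def
      proof (intro CollectI conjI ballI impI)
        fix r assume r: "r \<in> carrier R" "r \<otimes>\<^bsub>R\<^esub> (s \<otimes>\<^bsub>R\<^esub> t) = \<zero>\<^bsub>R\<^esub>"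
        then have "(r \<otimes>\<^bsub>R\<^esub> s) \<otimes>\<^bsub>R\<^esub> t = \<zero>\<^bsub>R\<^esub>" using s(1) t(1) by (simp add: m_assoc)
        then have "r \<otimes>\<^bsub>R\<^esub> s = \<zero>\<^bsub>R\<^esub>" by (rule t(2)[OF m_closed[OF r(1) s(1)]])
        then show "r = \<zero>\<^bsub>R\<^esub>" by (rule s(2)[OF r(1)])
      qed (rule m_closed[OF s(1) t(1)])
    qed
  qed
  then have car: "?P \<subseteq> carrier R" by (auto simp: left_regular_elements_def)
  have ge: "S \<subseteq> ?P" if "left_denominator_set R S" "S \<subseteq> left_regular_elements R" for S
  proof
    fix t assume t: "t \<in> S"
    then have "t \<in> carrier R" using that(2) by (auto simp: left_regular_elements_def)
    with left_denominator_products.ldp_mult[OF left_denominator_products.ldp_one that t]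
    show "t \<in> ?P" by simp
  qed
  have mult: "s \<otimes>\<^bsub>R\<^esub> t \<in> ?P" if "s \<in> ?P" "t \<in> ?P" for s t
    using that(2)
  proof induction
    case ldp_one
    then show ?case using that(1) car by auto
  next
    case (ldp_mult u S t)
    then have "t \<in> carrier R" "u \<in> carrier R"
      using car by (auto simp: left_regular_elements_def)
    moreover have "(s \<otimes>\<^bsub>R\<^esub> u) \<otimes>\<^bsub>R\<^esub> t \<in> ?P"
      using left_denominator_products.ldp_mult[OF ldp_mult.IH ldp_mult.hyps(2-4)] .
    ultimately show ?case using that(1) car by (auto simp: m_assoc)
  qed
  have ore: "\<exists>t\<in>?P. \<exists>q\<in>carrier R. t \<otimes>\<^bsub>R\<^esub> r = q \<otimes>\<^bsub>R\<^esub> s" if "s \<in> ?P" "r \<in> carrier R" for r s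
    using that
  proof (induction arbitrary: r)
    case ldp_one
    then show ?case
      by (intro bexI[of _ "\<one>\<^bsub>R\<^esub>"] bexI[of _ r]) (auto intro: left_denominator_products.ldp_one)
  next
    case (ldp_mult s S t)
    have tc: "t \<in> carrier R" and sc: "s \<in> carrier R"
      using ldp_mult car by (auto simp: left_regular_elements_def)
    have "(S #>\<^bsub>R\<^esub> r) \<inter> (carrier R #>\<^bsub>R\<^esub> t) \<noteq> {}"
      using ldp_mult.hyps(2,4) ldp_mult.prems
      unfolding left_denominator_set_def left_Ore_set_def by blast
    then obtain u p where u: "u \<in> S" "p \<in> carrier R" "u \<otimes>\<^bsub>R\<^esub> r = p \<otimes>\<^bsub>R\<^esub> t"
      by (auto simp: r_coset_def)
    obtain v q where v: "v \<in> ?P" "q \<in> carrier R" "v \<otimes>\<^bsub>R\<^esub> p = q \<otimes>\<^bsub>R\<^esub> s"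
      using ldp_mult.IH[OF u(2)] by blast
    have uP: "u \<in> ?P" using ge[OF ldp_mult.hyps(2,3)] u(1) by blast
    then have uc: "u \<in> carrier R" and vc: "v \<in> carrier R" using v car by auto
    have "(v \<otimes>\<^bsub>R\<^esub> u) \<otimes>\<^bsub>R\<^esub> r = v \<otimes>\<^bsub>R\<^esub> (p \<otimes>\<^bsub>R\<^esub> t)"
      using m_assoc[OF vc uc ldp_mult.prems] u(3) by simp
    also have "\<dots> = q \<otimes>\<^bsub>R\<^esub> (s \<otimes>\<^bsub>R\<^esub> t)"
      using m_assoc[OF vc u(2) tc] m_assoc[OF v(2) sc tc] v(3) by simp
    finally show ?case using mult[OF v(1) uP] v(2) by blast
  qed
  have zero: "\<zero>\<^bsub>R\<^esub> \<notin> left_regular_elements R"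
  proof
    assume "\<zero>\<^bsub>R\<^esub> \<in> left_regular_elements R"
    then have "\<one>\<^bsub>R\<^esub> \<otimes>\<^bsub>R\<^esub> \<zero>\<^bsub>R\<^esub> = \<zero>\<^bsub>R\<^esub> \<longrightarrow> \<one>\<^bsub>R\<^esub> = \<zero>\<^bsub>R\<^esub>"
      unfolding left_regular_elements_def using one_closed by blast
    then show False using assms(2) r_null[OF one_closed] by blast
  qed
  have "left_denominator_set R ?P"
    unfolding left_denominator_set_def left_Ore_set_def multiplicative_set_def
  proof (intro conjI ballI impI)
    show "(?P #>\<^bsub>R\<^esub> r) \<inter> (carrier R #>\<^bsub>R\<^esub> s) \<noteq> {}" if "r \<in> carrier R" "s \<in> ?P" for r s
      using ore[OF that(2,1)] unfolding r_coset_def by blast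
    show "\<exists>t\<in>?P. t \<otimes>\<^bsub>R\<^esub> r = \<zero>\<^bsub>R\<^esub>"
      if "r \<in> carrier R" "s \<in> ?P" "r \<otimes>\<^bsub>R\<^esub> s = \<zero>\<^bsub>R\<^esub>" for r s
    proof -
      have "r = \<zero>\<^bsub>R\<^esub>"
        using that reg unfolding left_regular_elements_def by blast
      then show ?thesis
        using left_denominator_products.ldp_one[of R] r_null[OF one_closed] by blast
    qed
    show "\<zero>\<^bsub>R\<^esub> \<notin> ?P" using reg zero by blast
  qed (rule car mult left_denominator_products.ldp_one; assumption?)+
  then have "largest_left_regular_denominator_set R = ?P"
    unfolding largest_left_regular_denominator_set_def
    using reg ge by (intro Greatest_equality) blast+
  with \<open>left_denominator_set R ?P\<close> reg ge show ?thesis by simp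
qed

end

theory Submission
  imports Defs "HOL-Computational_Algebra.Polynomial"
begin

text \<open>
  Let \<open>\<Theta>\<close> be the set of the monomials \<open>\<partial>\<^sup>\<beta>\<close>.  The ideal \<open>\<aa>\<^sub>n\<close> consists of the elements of \<open>\<bbbA>\<^sub>n\<close>
  that are killed from the left by an element of \<open>\<Theta>\<close>, equivalently by a nonzero element of the Weyl
  algebra \<open>A\<^sub>n\<close>, and \<open>\<Theta>\<close> is a left Ore set of left regular elements, so that \<open>\<Theta>\<close> is contained in
  the largest left denominator set \<open>'S\<close>.  Every element of \<open>\<bbbA>\<^sub>n\<close> has a left multiple by \<open>\<Theta>\<close> in
  \<open>\<Delta>\<^sub>n\<close> and a nonzero left multiple by \<open>A\<^sub>n\<close> in \<open>A\<^sub>n\<close>; as \<open>A\<^sub>n\<close> is a left Ore domain, the complement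
  \<open>T\<close> of \<open>\<aa>\<^sub>n\<close> is a left denominator set with \<open>T\<inverse>\<bbbA>\<^sub>n \<simeq> Q(A\<^sub>n)\<close>.  All statements then say that
  each element of \<open>T\<close> has a left multiple in \<open>'S\<close> or, equivalently, in \<open>'C\<close>: if \<open>'C\<close> has this
  property, it inherits the Ore condition from \<open>T\<close> and equals \<open>'S\<close>, and if \<open>'S\<inverse>\<bbbA>\<^sub>n\<close> is a division
  ring, the inverse of \<open>t \<in> T\<close> yields a left multiple of \<open>t\<close> in \<open>'S\<close>.  The last two statements only
  rephrase left regularity: a matrix unit multiplied from the left cuts out a single row, which lies in
  \<open>F\<^sub>n\<close>, and the action on \<open>P\<^sub>n'\<close> is the transpose of the action on \<open>P\<^sub>n\<close>.
\<close>

section \<open>Left localizations\<close>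

text \<open>Derivations are left regular but have nonzero right annihilators: d_i e = 0 for the
  projection e onto the polynomials without x_i. Hence the map into the localization at
  \<open>T\<close> is not injective, and every cancellation between fractions costs a left factor.
  The localizations are sets of classes with operations given as unions and are never shown to be
  rings, so all maps between them are built from representatives, and the localization of the
  Jacobian algebra and Q(A_n) are both compared with the localization at \<open>T\<close>. An
  isomorphism in statements 1 and 2 is abstract and unrelated to the inclusion of A_n; what can be
  transported along it is the existence of inverses in Q(A_n). The factor algebra is handled without
  its skew Laurent structure: equality modulo the ideal is equality after left multiplication by a
  monomial in the derivations. Characteristic zero enters through the nonvanishing of \<gamma>_i + 1
  + k and of the falling factorials.\<close>

locale denominator_algebra = ring R for R :: "('k, 'a, 'm) module_scheme" (structure) +
  fixes S :: "'a set"
  assumes denominator: "left_denominator_set R S"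
    and smult_closed: "r \<in> carrier R \<Longrightarrow> c \<odot> r \<in> carrier R"
    and mult_smult: "\<lbrakk>a \<in> carrier R; r \<in> carrier R\<rbrakk> \<Longrightarrow> a \<otimes> (c \<odot> r) = c \<odot> (a \<otimes> r)"
begin

abbreviation frac :: "'a \<Rightarrow> 'a \<Rightarrow> ('a \<times> 'a) set" where
  "frac s r \<equiv> left_fraction R S s r"

lemma S_closed: "s \<in> S \<Longrightarrow> s \<in> carrier R"
  and one_S: "\<one> \<in> S"
  and mult_S: "s \<in> S \<Longrightarrow> t \<in> S \<Longrightarrow> s \<otimes> t \<in> S"
  and zero_notin_S: "\<zero> \<notin> S"
  using denominator
  unfolding left_denominator_set_def left_Ore_set_def multiplicative_set_def by blast+

lemma ore:
  assumes "r \<in> carrier R" "s \<in> S"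
  obtains u p where "u \<in> S" "p \<in> carrier R" "u \<otimes> r = p \<otimes> s"
proof -
  have "(S #> r) \<inter> (carrier R #> s) \<noteq> {}"
    using denominator assms unfolding left_denominator_set_def left_Ore_set_def by blast
  then show thesis using that by (auto simp: r_coset_def)
qed

lemma common_multiple:
  assumes "s \<in> S" "t \<in> S"
  obtains k l where "k \<in> S" "l \<in> carrier R" "k \<otimes> s = l \<otimes> t" "k \<otimes> s \<in> S"
  using ore[OF S_closed[OF assms(1)] assms(2)] mult_S assms(1) by metis

text \<open>The denominator condition turns a right annihilator of the difference into a left one:
  (a - b) s = 0 gives z (a - b) = 0.\<close>

lemma cancel_up_to_torsion:
  assumes s: "s \<in> S" and ab: "a \<in> carrier R" "b \<in> carrier R" "a \<otimes> s = b \<otimes> s"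
  obtains z where "z \<in> S" "z \<otimes> a = z \<otimes> b"
proof -
  have sc: "s \<in> carrier R" using s by (rule S_closed)
  have "(a \<ominus> b) \<otimes> s = \<zero>"
    using ab sc by (simp add: minus_eq l_distr l_minus r_neg)
  then obtain z where z: "z \<in> S" "z \<otimes> (a \<ominus> b) = \<zero>"
    using s ab denominator unfolding left_denominator_set_def by (metis minus_closed)
  then have "z \<otimes> a \<ominus> z \<otimes> b = \<zero>"
    using ab S_closed[OF z(1)] by (simp add: minus_eq r_distr r_minus)
  then have "z \<otimes> a = z \<otimes> b"
    using ab S_closed[OF z(1)] by simp
  then show thesis using that z(1) by blast
qed

lemma mult_common_multiple:
  assumes "k \<in> carrier R" "e \<in> carrier R" "p \<in> carrier R" "q \<in> carrier R" "e \<otimes> p = e \<otimes> q"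
  shows "(k \<otimes> e) \<otimes> p = (k \<otimes> e) \<otimes> q"
  using assms by (simp add: m_assoc)

text \<open>A left factor witnessing an equality still does so after further left multiplication, so
  a common left multiple of \<open>e\<close> and \<open>e'\<close> in \<open>S\<close> witnesses
  both.\<close>

lemma simultaneous:
  assumes "e \<in> S" "e' \<in> S" "p \<in> carrier R" "q \<in> carrier R" "p' \<in> carrier R" "q' \<in> carrier R"
    "e \<otimes> p = e \<otimes> q" "e' \<otimes> p' = e' \<otimes> q'"
  obtains f where "f \<in> S" "f \<otimes> p = f \<otimes> q" "f \<otimes> p' = f \<otimes> q'"
proof -
  obtain k l where kl: "k \<in> S" "l \<in> carrier R" "k \<otimes> e = l \<otimes> e'" "k \<otimes> e \<in> S"
    using common_multiple[OF assms(1,2)] .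
  show thesis
  proof
    show "k \<otimes> e \<in> S" by fact
    show "(k \<otimes> e) \<otimes> p = (k \<otimes> e) \<otimes> q"
      by (rule mult_common_multiple) (use assms kl S_closed in auto)
    show "(k \<otimes> e) \<otimes> p' = (k \<otimes> e) \<otimes> q'"
      unfolding kl(3) by (rule mult_common_multiple) (use assms kl S_closed in auto)
  qed
qed

text \<open>Equality of fractions asserts that one pair of multipliers exists; transitivity and
  well-definedness need the conclusion for whatever pair is at hand. By the Ore condition
  \<open>c s\<close> and \<open>a s\<close> have a common multiple, and cancelling s on one side and
  t on the other identifies (x c, x d) with (y a, y b) up to a left factor.\<close>

lemma fraction_rel_any_multiple:
  assumes st: "s \<in> S" "t \<in> S"
    and rq: "r \<in> carrier R" "q \<in> carrier R"
    and ab: "a \<in> carrier R" "b \<in> carrier R" "a \<otimes> s = b \<otimes> t" "a \<otimes> s \<in> S" "a \<otimes> r = b \<otimes> q"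
    and cd: "c \<in> carrier R" "d \<in> carrier R" "c \<otimes> s = d \<otimes> t"
  obtains e where "e \<in> S" "e \<otimes> (c \<otimes> r) = e \<otimes> (d \<otimes> q)"
proof -
  have sc: "s \<in> carrier R" and tc: "t \<in> carrier R"
    using st S_closed by auto
  obtain x y where xy: "x \<in> S" "y \<in> carrier R" "x \<otimes> (c \<otimes> s) = y \<otimes> (a \<otimes> s)"
    by (rule ore[OF m_closed[OF cd(1) sc] ab(4)])
  have xc: "x \<in> carrier R" using xy S_closed by blast
  have 1: "(x \<otimes> c) \<otimes> s = (y \<otimes> a) \<otimes> s"
    using xy xc cd ab sc by (simp add: m_assoc)
  have 2: "(x \<otimes> d) \<otimes> t = (y \<otimes> b) \<otimes> t"
    using xy xc cd ab tc by (simp add: m_assoc)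
  obtain z where z: "z \<in> S" "z \<otimes> (x \<otimes> c) = z \<otimes> (y \<otimes> a)"
    by (rule cancel_up_to_torsion[OF st(1) _ _ 1]) (use xc xy cd ab in simp_all)
  obtain z' where z': "z' \<in> S" "z' \<otimes> (x \<otimes> d) = z' \<otimes> (y \<otimes> b)"
    by (rule cancel_up_to_torsion[OF st(2) _ _ 2]) (use xc xy cd ab in simp_all)
  \<comment> \<open>One factor has to serve both cancellations, since r and q are linked only
    through a r = b q.\<close>
  obtain f where f: "f \<in> S" "f \<otimes> (x \<otimes> c) = f \<otimes> (y \<otimes> a)" "f \<otimes> (x \<otimes> d) = f \<otimes> (y \<otimes> b)"
    by (rule simultaneous[OF z(1) z'(1) _ _ _ _ z(2) z'(2)]) (use xc xy cd ab in simp_all)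
  have fc: "f \<in> carrier R" using f S_closed by blast
  have "(f \<otimes> x) \<otimes> (c \<otimes> r) = (f \<otimes> (x \<otimes> c)) \<otimes> r"
    using fc xc cd rq by (simp add: m_assoc)
  also have "\<dots> = f \<otimes> (y \<otimes> (a \<otimes> r))"
    unfolding f(2) using fc xy ab rq by (simp add: m_assoc)
  also have "\<dots> = (f \<otimes> (y \<otimes> b)) \<otimes> q"
    unfolding ab(5) using fc xy ab rq by (simp add: m_assoc)
  also have "\<dots> = (f \<otimes> x) \<otimes> (d \<otimes> q)"
    unfolding f(3)[symmetric] using fc xc cd rq by (simp add: m_assoc)
  finally show thesis using that mult_S[OF f(1) xy(1)] by blast
qed

section \<open>Equality of left fractions\<close>

definition fraction_eq :: "'a \<Rightarrow> 'a \<Rightarrow> 'a \<Rightarrow> 'a \<Rightarrow> bool" where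
  "fraction_eq s r t q \<longleftrightarrow> ((s, r), (t, q)) \<in> left_fraction_rel R S"

lemma fraction_eq_iff:
  "fraction_eq s r t q \<longleftrightarrow> s \<in> S \<and> t \<in> S \<and> r \<in> carrier R \<and> q \<in> carrier R \<and>
     (\<exists>a\<in>carrier R. \<exists>b\<in>carrier R. a \<otimes> s = b \<otimes> t \<and> a \<otimes> s \<in> S \<and> a \<otimes> r = b \<otimes> q)"
  unfolding fraction_eq_def left_fraction_rel_def by simp

lemma fraction_eq_multiple:
  assumes "fraction_eq s r t q" "c \<in> carrier R" "d \<in> carrier R" "c \<otimes> s = d \<otimes> t"
  obtains e where "e \<in> S" "e \<otimes> (c \<otimes> r) = e \<otimes> (d \<otimes> q)"
proof -
  from assms(1) obtain a b where "s \<in> S" "t \<in> S" "r \<in> carrier R" "q \<in> carrier R"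
    "a \<in> carrier R" "b \<in> carrier R" "a \<otimes> s = b \<otimes> t" "a \<otimes> s \<in> S" "a \<otimes> r = b \<otimes> q"
    unfolding fraction_eq_iff by blast
  from fraction_rel_any_multiple[OF this assms(2-4)]
  show thesis using that .
qed

lemma fraction_eqI:
  assumes "s \<in> S" "t \<in> S" "r \<in> carrier R" "q \<in> carrier R" "c \<in> carrier R" "d \<in> carrier R"
    "c \<otimes> s = d \<otimes> t" "c \<otimes> s \<in> S" "e \<in> S" "e \<otimes> (c \<otimes> r) = e \<otimes> (d \<otimes> q)"
  shows "fraction_eq s r t q"
proof -
  have c: "s \<in> carrier R" "t \<in> carrier R" "e \<in> carrier R" using assms S_closed by auto
  have "(e \<otimes> c) \<otimes> s = (e \<otimes> d) \<otimes> t" "(e \<otimes> c) \<otimes> r = (e \<otimes> d) \<otimes> q" "(e \<otimes> c) \<otimes> s \<in> S"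
    using assms c mult_S[OF assms(9,8)] by (simp_all add: m_assoc)
  then show ?thesis
    unfolding fraction_eq_iff using assms(1-4) m_closed[OF c(3) assms(5)] m_closed[OF c(3) assms(6)]
    by blast
qed

lemma fraction_eq_sym: "fraction_eq s r t q \<Longrightarrow> fraction_eq t q s r"
  unfolding fraction_eq_iff by metis

lemma fraction_eq_refl: "s \<in> S \<Longrightarrow> r \<in> carrier R \<Longrightarrow> fraction_eq s r s r"
  by (rule fraction_eqI[where c = \<one> and d = \<one> and e = \<one>]) (simp_all add: one_S S_closed)

lemma fraction_eq_trans:
  assumes 1: "fraction_eq s r t q" and 2: "fraction_eq t q v p"
  shows "fraction_eq s r v p"
proof -
  have S: "s \<in> S" "t \<in> S" "v \<in> S" and R: "r \<in> carrier R" "q \<in> carrier R" "p \<in> carrier R"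
    using 1 2 unfolding fraction_eq_iff by auto
  note c = S[THEN S_closed] R
  obtain a b where ab: "a \<in> S" "b \<in> carrier R" "a \<otimes> s = b \<otimes> t" "a \<otimes> s \<in> S"
    using common_multiple[OF S(1,2)] .
  \<comment> \<open>\<open>x a s\<close> is a common multiple of all three denominators and equals
    \<open>x b t\<close>, so the two hypotheses are applied with the same multiplier of t.\<close>
  obtain x y where xy: "x \<in> S" "y \<in> carrier R" "x \<otimes> (a \<otimes> s) = y \<otimes> v" "x \<otimes> (a \<otimes> s) \<in> S"
    using common_multiple[OF ab(4) S(3)] .
  note c = c S_closed[OF ab(1)] ab(2) S_closed[OF xy(1)] xy(2)
  have eq: "(x \<otimes> a) \<otimes> s = (x \<otimes> b) \<otimes> t"
    using ab c by (simp add: m_assoc)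
  obtain e where e: "e \<in> S" "e \<otimes> ((x \<otimes> a) \<otimes> r) = e \<otimes> ((x \<otimes> b) \<otimes> q)"
    by (rule fraction_eq_multiple[OF 1 _ _ eq]) (simp_all add: c)
  have eq: "(x \<otimes> b) \<otimes> t = y \<otimes> v"
    using ab xy c by (simp add: m_assoc)
  obtain e' where e': "e' \<in> S" "e' \<otimes> ((x \<otimes> b) \<otimes> q) = e' \<otimes> (y \<otimes> p)"
    by (rule fraction_eq_multiple[OF 2 _ _ eq]) (simp_all add: c)
  obtain f where f: "f \<in> S" "f \<otimes> ((x \<otimes> a) \<otimes> r) = f \<otimes> ((x \<otimes> b) \<otimes> q)"
      "f \<otimes> ((x \<otimes> b) \<otimes> q) = f \<otimes> (y \<otimes> p)"
    by (rule simultaneous[OF e(1) e'(1) _ _ _ _ e(2) e'(2)]) (simp_all add: c)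
  show ?thesis
    by (rule fraction_eqI[where c = "x \<otimes> a" and d = y and e = f])
      (use S R c ab xy f in \<open>simp_all add: m_assoc\<close>)
qed

lemma equiv_fractions: "equiv (S \<times> carrier R) (left_fraction_rel R S)"
proof (rule equivI)
  show "left_fraction_rel R S \<subseteq> (S \<times> carrier R) \<times> (S \<times> carrier R)"
    unfolding left_fraction_rel_def by auto
  show "refl_on (S \<times> carrier R) (left_fraction_rel R S)"
    unfolding refl_on_def using fraction_eq_refl[unfolded fraction_eq_def] by auto
  show "sym (left_fraction_rel R S)"
    using fraction_eq_sym[unfolded fraction_eq_def] by (auto simp: sym_def)
  show "trans (left_fraction_rel R S)"
    using fraction_eq_trans[unfolded fraction_eq_def] unfolding trans_def by (metis surj_pair)
qed

lemma frac_eq_iff: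
  assumes "s \<in> S" "r \<in> carrier R" "t \<in> S" "q \<in> carrier R"
  shows "frac s r = frac t q \<longleftrightarrow> fraction_eq s r t q"
  unfolding left_fraction_def fraction_eq_def
  by (rule eq_equiv_class_iff[OF equiv_fractions]) (use assms in auto)

lemma frac_cong: "fraction_eq s r t q \<Longrightarrow> frac s r = frac t q"
  by (metis frac_eq_iff fraction_eq_iff)

lemma in_frac_iff: "(t, q) \<in> frac s r \<longleftrightarrow> fraction_eq s r t q"
  unfolding left_fraction_def fraction_eq_def by simp

section \<open>Elements and operations of the localization\<close>

lemma carrier_localization:
  "carrier (left_localization R S) = {frac s r | s r. s \<in> S \<and> r \<in> carrier R}"
  unfolding left_localization_def left_fraction_def quotient_def by force

lemma add_well_defined:
  assumes 1: "fraction_eq s r s' r'" and 2: "fraction_eq t q t' q'"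
    and ab: "a \<in> carrier R" "b \<in> carrier R" "a \<otimes> s = b \<otimes> t" "a \<otimes> s \<in> S"
    and ab': "a' \<in> carrier R" "b' \<in> carrier R" "a' \<otimes> s' = b' \<otimes> t'" "a' \<otimes> s' \<in> S"
  shows "fraction_eq (a \<otimes> s) (a \<otimes> r \<oplus> b \<otimes> q) (a' \<otimes> s') (a' \<otimes> r' \<oplus> b' \<otimes> q')"
proof -
  have S: "s \<in> S" "t \<in> S" "s' \<in> S" "t' \<in> S"
    and R: "r \<in> carrier R" "q \<in> carrier R" "r' \<in> carrier R" "q' \<in> carrier R"
    using 1 2 unfolding fraction_eq_iff by auto
  \<comment> \<open>A common multiple of the two sum denominators is a common multiple of s, s' and
    also of t, t', so both hypotheses apply with the same outer factors.\<close>
  obtain x y where xy: "x \<in> S" "y \<in> carrier R" "x \<otimes> (a \<otimes> s) = y \<otimes> (a' \<otimes> s')"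
      "x \<otimes> (a \<otimes> s) \<in> S"
    using common_multiple[OF ab(4) ab'(4)] .
  note c = S[THEN S_closed] R ab(1,2) ab'(1,2) S_closed[OF xy(1)] xy(2)
  have eq: "(x \<otimes> a) \<otimes> s = (y \<otimes> a') \<otimes> s'"
    using xy c by (simp add: m_assoc)
  obtain e where e: "e \<in> S" "e \<otimes> ((x \<otimes> a) \<otimes> r) = e \<otimes> ((y \<otimes> a') \<otimes> r')"
    by (rule fraction_eq_multiple[OF 1 _ _ eq]) (simp_all add: c)
  have eq: "(x \<otimes> b) \<otimes> t = (y \<otimes> b') \<otimes> t'"
    using xy c ab(3) ab'(3) by (metis m_assoc)
  obtain e' where e': "e' \<in> S" "e' \<otimes> ((x \<otimes> b) \<otimes> q) = e' \<otimes> ((y \<otimes> b') \<otimes> q')"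
    by (rule fraction_eq_multiple[OF 2 _ _ eq]) (simp_all add: c)
  obtain f where f: "f \<in> S" "f \<otimes> ((x \<otimes> a) \<otimes> r) = f \<otimes> ((y \<otimes> a') \<otimes> r')"
      "f \<otimes> ((x \<otimes> b) \<otimes> q) = f \<otimes> ((y \<otimes> b') \<otimes> q')"
    by (rule simultaneous[OF e(1) e'(1) _ _ _ _ e(2) e'(2)]) (simp_all add: c)
  show ?thesis
    by (rule fraction_eqI[where c = x and d = y and e = f])
      (use xy f c ab ab' S_closed[OF f(1)] in \<open>simp_all add: m_assoc r_distr\<close>)
qed

lemma mult_well_defined:
  assumes 1: "fraction_eq s r s' r'" and 2: "fraction_eq t q t' q'"
    and up: "u \<in> S" "p \<in> carrier R" "u \<otimes> r = p \<otimes> t"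
    and up': "u' \<in> S" "p' \<in> carrier R" "u' \<otimes> r' = p' \<otimes> t'"
  shows "fraction_eq (u \<otimes> s) (p \<otimes> q) (u' \<otimes> s') (p' \<otimes> q')"
proof -
  have S: "s \<in> S" "t \<in> S" "s' \<in> S" "t' \<in> S"
    and R: "r \<in> carrier R" "q \<in> carrier R" "r' \<in> carrier R" "q' \<in> carrier R"
    using 1 2 unfolding fraction_eq_iff by auto
  have us: "u \<otimes> s \<in> S" "u' \<otimes> s' \<in> S" using mult_S up up' S by auto
  obtain x y where xy: "x \<in> S" "y \<in> carrier R" "x \<otimes> (u \<otimes> s) = y \<otimes> (u' \<otimes> s')"
      "x \<otimes> (u \<otimes> s) \<in> S"
    using common_multiple[OF us] .
  note c = S[THEN S_closed] R up(2) up'(2) up(1)[THEN S_closed] up'(1)[THEN S_closed]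
    S_closed[OF xy(1)] xy(2)
  have eq: "(x \<otimes> u) \<otimes> s = (y \<otimes> u') \<otimes> s'"
    using xy c by (simp add: m_assoc)
  obtain e where e: "e \<in> S" "e \<otimes> ((x \<otimes> u) \<otimes> r) = e \<otimes> ((y \<otimes> u') \<otimes> r')"
    by (rule fraction_eq_multiple[OF 1 _ _ eq]) (simp_all add: c)
  have ec: "e \<in> carrier R" using e S_closed by blast
  \<comment> \<open>The first hypothesis equates x u r with y u' r' after the factor e. As u r = p t
    and u' r' = p' t', this is the equation of denominators that the second hypothesis
    requires.\<close>
  have eq: "(e \<otimes> (x \<otimes> p)) \<otimes> t = (e \<otimes> (y \<otimes> p')) \<otimes> t'"
    using e(2) c ec by (simp add: m_assoc up(3) up'(3))
  obtain f where f: "f \<in> S" "f \<otimes> ((e \<otimes> (x \<otimes> p)) \<otimes> q) = f \<otimes> ((e \<otimes> (y \<otimes> p')) \<otimes> q')"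
    by (rule fraction_eq_multiple[OF 2 _ _ eq]) (simp_all add: c ec)
  show ?thesis
    by (rule fraction_eqI[where c = x and d = y and e = "f \<otimes> e"])
      (use us xy f(2) c ec mult_S[OF f(1) e(1)] S_closed[OF f(1)] in \<open>simp_all add: m_assoc\<close>)
qed

text \<open>The union in the definition of addition collapses because all choices of representatives
  and multipliers give one and the same class.\<close>

lemma frac_add:
  assumes "s \<in> S" "r \<in> carrier R" "t \<in> S" "q \<in> carrier R"
    and ab: "a \<in> carrier R" "b \<in> carrier R" "a \<otimes> s = b \<otimes> t" "a \<otimes> s \<in> S"
  shows "frac s r \<oplus>\<^bsub>left_localization R S\<^esub> frac t q = frac (a \<otimes> s) (a \<otimes> r \<oplus> b \<otimes> q)"
proof -
  have "{frac (a' \<otimes> s') (a' \<otimes> r' \<oplus> b' \<otimes> q') | s' r' t' q' a' b'.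
        (s', r') \<in> frac s r \<and> (t', q') \<in> frac t q \<and> a' \<in> carrier R \<and> b' \<in> carrier R \<and>
        a' \<otimes> s' = b' \<otimes> t' \<and> a' \<otimes> s' \<in> S} = {frac (a \<otimes> s) (a \<otimes> r \<oplus> b \<otimes> q)}" (is "?A = _")
  proof (intro subset_antisym subsetI)
    fix X assume "X \<in> ?A"
    then show "X \<in> {frac (a \<otimes> s) (a \<otimes> r \<oplus> b \<otimes> q)}"
      unfolding in_frac_iff using frac_cong[OF add_well_defined[OF _ _ ab]] by force
  next
    fix X assume "X \<in> {frac (a \<otimes> s) (a \<otimes> r \<oplus> b \<otimes> q)}"
    then show "X \<in> ?A"
      using fraction_eq_refl[OF assms(1,2)] fraction_eq_refl[OF assms(3,4)] ab
      unfolding in_frac_iff by blast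
  qed
  then show ?thesis unfolding left_localization_def by simp
qed

lemma frac_mult:
  assumes "s \<in> S" "r \<in> carrier R" "t \<in> S" "q \<in> carrier R"
    and up: "u \<in> S" "p \<in> carrier R" "u \<otimes> r = p \<otimes> t"
  shows "frac s r \<otimes>\<^bsub>left_localization R S\<^esub> frac t q = frac (u \<otimes> s) (p \<otimes> q)"
proof -
  have "{frac (u' \<otimes> s') (p' \<otimes> q') | s' r' t' q' u' p'.
        (s', r') \<in> frac s r \<and> (t', q') \<in> frac t q \<and> u' \<in> S \<and> p' \<in> carrier R \<and>
        u' \<otimes> r' = p' \<otimes> t'} = {frac (u \<otimes> s) (p \<otimes> q)}" (is "?A = _")
  proof (intro subset_antisym subsetI)
    fix X assume "X \<in> ?A"
    then show "X \<in> {frac (u \<otimes> s) (p \<otimes> q)}"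
      unfolding in_frac_iff using frac_cong[OF mult_well_defined[OF _ _ up]] by force
  next
    fix X assume "X \<in> {frac (u \<otimes> s) (p \<otimes> q)}"
    then show "X \<in> ?A"
      using fraction_eq_refl[OF assms(1,2)] fraction_eq_refl[OF assms(3,4)] up
      unfolding in_frac_iff by blast
  qed
  then show ?thesis unfolding left_localization_def by simp
qed

lemma frac_smult:
  assumes "s \<in> S" "r \<in> carrier R"
  shows "c \<odot>\<^bsub>left_localization R S\<^esub> frac s r = frac s (c \<odot> r)"
proof -
  have eq: "fraction_eq s (c \<odot> r) s' (c \<odot> r')" if "fraction_eq s r s' r'" for s' r'
    using that smult_closed S_closed unfolding fraction_eq_iff by (metis mult_smult)
  have "{frac s' (c \<odot> r') | s' r'. (s', r') \<in> frac s r} = {frac s (c \<odot> r)}" (is "?A = _")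
  proof (intro subset_antisym subsetI)
    fix X assume "X \<in> ?A"
    then show "X \<in> {frac s (c \<odot> r)}"
      unfolding in_frac_iff using frac_cong[OF eq] by force
  next
    fix X assume "X \<in> {frac s (c \<odot> r)}"
    then show "X \<in> ?A"
      using fraction_eq_refl[OF assms] unfolding in_frac_iff by blast
  qed
  then show ?thesis unfolding left_localization_def by simp
qed

lemma frac_one: "\<one>\<^bsub>left_localization R S\<^esub> = frac \<one> \<one>"
  unfolding left_localization_def by simp

lemma localization_closed:
  assumes "X \<in> carrier (left_localization R S)" "Y \<in> carrier (left_localization R S)"
  shows "X \<otimes>\<^bsub>left_localization R S\<^esub> Y \<in> carrier (left_localization R S)"
    and "X \<oplus>\<^bsub>left_localization R S\<^esub> Y \<in> carrier (left_localization R S)"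
    and "c \<odot>\<^bsub>left_localization R S\<^esub> X \<in> carrier (left_localization R S)"
proof -
  have frac_in: "frac s r \<in> carrier (left_localization R S)" if "s \<in> S" "r \<in> carrier R" for s r
    using that unfolding carrier_localization by blast
  obtain s r t q where X: "X = frac s r" "s \<in> S" "r \<in> carrier R"
    and Y: "Y = frac t q" "t \<in> S" "q \<in> carrier R"
    using assms unfolding carrier_localization by blast
  obtain u p where up: "u \<in> S" "p \<in> carrier R" "u \<otimes> r = p \<otimes> t" using ore[OF X(3) Y(2)] .
  show "X \<otimes>\<^bsub>left_localization R S\<^esub> Y \<in> carrier (left_localization R S)"
    unfolding X(1) Y(1) frac_mult[OF X(2,3) Y(2,3) up]
    by (rule frac_in[OF mult_S[OF up(1) X(2)] m_closed[OF up(2) Y(3)]])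
  obtain a b where ab: "a \<in> S" "b \<in> carrier R" "a \<otimes> s = b \<otimes> t" "a \<otimes> s \<in> S"
    using common_multiple[OF X(2) Y(2)] .
  have a: "a \<in> carrier R" using ab S_closed by blast
  show "X \<oplus>\<^bsub>left_localization R S\<^esub> Y \<in> carrier (left_localization R S)"
    unfolding X(1) Y(1) frac_add[OF X(2,3) Y(2,3) a ab(2-)]
    by (rule frac_in[OF ab(4)]) (use a ab X Y in simp)
  show "c \<odot>\<^bsub>left_localization R S\<^esub> X \<in> carrier (left_localization R S)"
    unfolding X(1) frac_smult[OF X(2,3)] by (rule frac_in[OF X(2) smult_closed[OF X(3)]])
qed

end

text \<open>Closure properties stand in for ring axioms, since the localizations are not shown to be
  rings. Closure of \<open>Y\<close> lets products and sums in \<open>Z\<close> be pulled back along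
  the second isomorphism.\<close>

lemma algebra_isomorphic_common_target:
  fixes X :: "('k, 'x, 'm) module_scheme" and Y :: "('k, 'y, 'l) module_scheme"
    and Z :: "('k, 'z, 'p) module_scheme"
  assumes XZ: "algebra_isomorphic X Z" and YZ: "algebra_isomorphic Y Z"
    and closed: "\<And>a b. \<lbrakk>a \<in> carrier Y; b \<in> carrier Y\<rbrakk> \<Longrightarrow> a \<otimes>\<^bsub>Y\<^esub> b \<in> carrier Y"
      "\<And>a b. \<lbrakk>a \<in> carrier Y; b \<in> carrier Y\<rbrakk> \<Longrightarrow> a \<oplus>\<^bsub>Y\<^esub> b \<in> carrier Y"
      "\<And>c a. a \<in> carrier Y \<Longrightarrow> c \<odot>\<^bsub>Y\<^esub> a \<in> carrier Y" "\<one>\<^bsub>Y\<^esub> \<in> carrier Y"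
  shows "algebra_isomorphic X Y"
proof -
  obtain f where f: "f \<in> ring_hom X Z" "bij_betw f (carrier X) (carrier Z)"
      "\<And>c a. a \<in> carrier X \<Longrightarrow> f (c \<odot>\<^bsub>X\<^esub> a) = c \<odot>\<^bsub>Z\<^esub> f a"
    using XZ unfolding algebra_isomorphic_def ring_iso_def by blast
  obtain g where g: "g \<in> ring_hom Y Z" "bij_betw g (carrier Y) (carrier Z)"
      "\<And>c a. a \<in> carrier Y \<Longrightarrow> g (c \<odot>\<^bsub>Y\<^esub> a) = c \<odot>\<^bsub>Z\<^esub> g a"
    using YZ unfolding algebra_isomorphic_def ring_iso_def by blast
  define h where "h = inv_into (carrier Y) g"
  have bij: "bij_betw (h \<circ> f) (carrier X) (carrier Y)"
    unfolding h_def by (rule bij_betw_trans[OF f(2) bij_betw_inv_into[OF g(2)]])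
  have hY: "h (f x) \<in> carrier Y" if "x \<in> carrier X" for x
    using bij that by (auto simp: bij_betw_def)
  have gh: "g (h (f x)) = f x" if "x \<in> carrier X" for x
    unfolding h_def using that f(2) g(2) by (meson bij_betw_apply bij_betw_inv_into_right)
  have hg: "h (g y) = y" if "y \<in> carrier Y" for y
    unfolding h_def using that g(2) by (meson bij_betw_inv_into_left)
  have "h \<circ> f \<in> ring_hom X Y"
  proof (rule ring_hom_memI)
    show "(h \<circ> f) x \<in> carrier Y" if "x \<in> carrier X" for x using hY that by simp
    fix x y assume xy: "x \<in> carrier X" "y \<in> carrier X"
    have "f (x \<otimes>\<^bsub>X\<^esub> y) = g (h (f x) \<otimes>\<^bsub>Y\<^esub> h (f y))"
      using ring_hom_mult[OF f(1) xy] ring_hom_mult[OF g(1) hY hY] gh xy by simp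
    then show "(h \<circ> f) (x \<otimes>\<^bsub>X\<^esub> y) = (h \<circ> f) x \<otimes>\<^bsub>Y\<^esub> (h \<circ> f) y"
      using hg closed(1)[OF hY[OF xy(1)] hY[OF xy(2)]] by simp
    have "f (x \<oplus>\<^bsub>X\<^esub> y) = g (h (f x) \<oplus>\<^bsub>Y\<^esub> h (f y))"
      using ring_hom_add[OF f(1) xy] ring_hom_add[OF g(1) hY hY] gh xy by simp
    then show "(h \<circ> f) (x \<oplus>\<^bsub>X\<^esub> y) = (h \<circ> f) x \<oplus>\<^bsub>Y\<^esub> (h \<circ> f) y"
      using hg closed(2)[OF hY[OF xy(1)] hY[OF xy(2)]] by simp
  next
    show "(h \<circ> f) \<one>\<^bsub>X\<^esub> = \<one>\<^bsub>Y\<^esub>"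
      using ring_hom_one[OF f(1)] ring_hom_one[OF g(1)] hg[OF closed(4)] by simp
  qed
  moreover have "(h \<circ> f) (c \<odot>\<^bsub>X\<^esub> x) = c \<odot>\<^bsub>Y\<^esub> (h \<circ> f) x" if "x \<in> carrier X" for c x
  proof -
    have "f (c \<odot>\<^bsub>X\<^esub> x) = g (c \<odot>\<^bsub>Y\<^esub> h (f x))"
      using f(3)[OF that] g(3)[OF hY[OF that]] gh[OF that] by simp
    then show ?thesis using hg closed(3)[OF hY[OF that]] by simp
  qed
  ultimately show ?thesis
    unfolding algebra_isomorphic_def ring_iso_def using bij by blast
qed

text \<open>The isomorphism sends the class of (s, r) to the class of the same pair over
  \<open>R\<close>. Here \<open>inj\<close> turns an equality witnessed in \<open>S\<close> into one
  witnessed in \<open>S'\<close>, and \<open>surj\<close> expands any fraction by a left factor to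
  one over \<open>S'\<close> and \<open>B\<close>. It is applied with \<open>B\<close> the whole
  ring and a smaller denominator set, and with \<open>B\<close> the Weyl algebra.\<close>

lemma (in denominator_algebra) localization_of_subalgebra:
  assumes sub: "denominator_algebra (R\<lparr>carrier := B\<rparr>) S'" and B: "B \<subseteq> carrier R" and S': "S' \<subseteq> S"
    and inj: "\<And>e p q. \<lbrakk>e \<in> S; p \<in> B; q \<in> B; e \<otimes> p = e \<otimes> q\<rbrakk> \<Longrightarrow> \<exists>f\<in>S'. f \<otimes> p = f \<otimes> q"
    and surj: "\<And>s r. \<lbrakk>s \<in> S; r \<in> carrier R\<rbrakk> \<Longrightarrow> \<exists>a\<in>carrier R. a \<otimes> s \<in> S' \<and> a \<otimes> r \<in> B"
  shows "algebra_isomorphic (left_localization (R\<lparr>carrier := B\<rparr>) S') (left_localization R S)"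
proof -
  interpret sub: denominator_algebra "R\<lparr>carrier := B\<rparr>" S' by (rule sub)
  let ?L = "left_localization (R\<lparr>carrier := B\<rparr>) S'"
  let ?M = "left_localization R S"
  define F where "F X = \<Union>{frac s r | s r. (s, r) \<in> X}" for X
  have S'B: "s \<in> B" if "s \<in> S'" for s using sub.S_closed that by simp
  have eq: "fraction_eq s r t q" if "sub.fraction_eq s r t q" for s r t q
  proof -
    have "s \<in> S' \<and> t \<in> S' \<and> r \<in> B \<and> q \<in> B \<and>
        (\<exists>a\<in>B. \<exists>b\<in>B. a \<otimes> s = b \<otimes> t \<and> a \<otimes> s \<in> S' \<and> a \<otimes> r = b \<otimes> q)"
      using that unfolding sub.fraction_eq_iff by simp
    then show ?thesis unfolding fraction_eq_iff using B S' by blast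
  qed
  have F: "F (sub.frac s r) = frac s r" if "s \<in> S'" "r \<in> B" for s r
  proof -
    have "{frac s' r' | s' r'. (s', r') \<in> sub.frac s r} = {frac s r}" (is "?A = _")
    proof (intro subset_antisym subsetI)
      show "X \<in> {frac s r}" if "X \<in> ?A" for X
        using that unfolding sub.in_frac_iff using frac_cong[OF eq] by force
      show "X \<in> ?A" if "X \<in> {frac s r}" for X
        using that sub.fraction_eq_refl[of s r] \<open>s \<in> S'\<close> \<open>r \<in> B\<close>
        unfolding sub.in_frac_iff by auto
    qed
    then show ?thesis unfolding F_def by simp
  qed
  have carL: "carrier ?L = {sub.frac s r | s r. s \<in> S' \<and> r \<in> B}"
    unfolding sub.carrier_localization by simp
  have elim: thesis if "X \<in> carrier ?L"
    "\<And>s r. \<lbrakk>X = sub.frac s r; s \<in> S'; r \<in> B; s \<in> S; r \<in> carrier R; F X = frac s r\<rbrakk> \<Longrightarrow> thesis"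
    for X thesis
    using that S' B F unfolding carL by blast
  have hom: "F \<in> ring_hom ?L ?M"
  proof (rule ring_hom_memI)
    show "F X \<in> carrier ?M" if "X \<in> carrier ?L" for X
      using that by (rule elim) (auto simp: carrier_localization)
    fix X Y assume X: "X \<in> carrier ?L" and Y: "Y \<in> carrier ?L"
    from X obtain s r where X: "X = sub.frac s r" "s \<in> S'" "r \<in> B" "s \<in> S" "r \<in> carrier R"
      "F X = frac s r" by (rule elim)
    from Y obtain t q where Y: "Y = sub.frac t q" "t \<in> S'" "q \<in> B" "t \<in> S" "q \<in> carrier R"
      "F Y = frac t q" by (rule elim)
    obtain u p where up: "u \<in> S'" "p \<in> B" "u \<otimes> r = p \<otimes> t"
      using sub.ore[of r t] X Y by auto
    have "X \<otimes>\<^bsub>?L\<^esub> Y = sub.frac (u \<otimes> s) (p \<otimes> q)"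
      using sub.frac_mult[of s r t q u p] X Y up by simp
    moreover have "u \<otimes> s \<in> S'" "p \<otimes> q \<in> B"
      using sub.mult_S[OF up(1) X(2)] sub.m_closed[of p q] up Y by simp_all
    moreover have "frac s r \<otimes>\<^bsub>?M\<^esub> frac t q = frac (u \<otimes> s) (p \<otimes> q)"
      using frac_mult[of s r t q u p] X Y up B S' by blast
    ultimately show "F (X \<otimes>\<^bsub>?L\<^esub> Y) = F X \<otimes>\<^bsub>?M\<^esub> F Y"
      using F X Y by simp
    obtain a b where ab: "a \<in> S'" "b \<in> B" "a \<otimes> s = b \<otimes> t" "a \<otimes> s \<in> S'"
      using sub.common_multiple[of s t] X Y by auto
    have aB: "a \<in> B" using ab S'B by blast
    have "X \<oplus>\<^bsub>?L\<^esub> Y = sub.frac (a \<otimes> s) (a \<otimes> r \<oplus> b \<otimes> q)"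
      using sub.frac_add[of s r t q a b] X Y ab aB by simp
    moreover have "a \<otimes> r \<oplus> b \<otimes> q \<in> B"
      using sub.add.m_closed[of "a \<otimes> r" "b \<otimes> q"] sub.m_closed[of a r] sub.m_closed[of b q]
        ab aB X Y by simp
    moreover have "frac s r \<oplus>\<^bsub>?M\<^esub> frac t q = frac (a \<otimes> s) (a \<otimes> r \<oplus> b \<otimes> q)"
      using frac_add[of s r t q a b] X Y ab aB B S' by blast
    ultimately show "F (X \<oplus>\<^bsub>?L\<^esub> Y) = F X \<oplus>\<^bsub>?M\<^esub> F Y"
      using F X Y ab by simp
  next
    show "F \<one>\<^bsub>?L\<^esub> = \<one>\<^bsub>?M\<^esub>"
      using F[of \<one> \<one>] sub.one_S S'B by (simp add: frac_one sub.frac_one)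
  qed
  have smult: "F (c \<odot>\<^bsub>?L\<^esub> X) = c \<odot>\<^bsub>?M\<^esub> F X" if "X \<in> carrier ?L" for c X
    using that
  proof (rule elim)
    fix s r assume X: "X = sub.frac s r" "s \<in> S'" "r \<in> B" "s \<in> S" "r \<in> carrier R" "F X = frac s r"
    have "c \<odot> r \<in> B" using sub.smult_closed[of r c] X by simp
    then show ?thesis
      using sub.frac_smult[of s r c] X F frac_smult[of s r c] by simp
  qed
  have "inj_on F (carrier ?L)"
  proof (rule inj_onI)
    fix X Y assume X: "X \<in> carrier ?L" and Y: "Y \<in> carrier ?L" and FXY: "F X = F Y"
    from X obtain s r where X: "X = sub.frac s r" "s \<in> S'" "r \<in> B" "s \<in> S" "r \<in> carrier R"
      "F X = frac s r" by (rule elim)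
    from Y obtain t q where Y: "Y = sub.frac t q" "t \<in> S'" "q \<in> B" "t \<in> S" "q \<in> carrier R"
      "F Y = frac t q" by (rule elim)
    \<comment> \<open>The multipliers are taken inside \<open>B\<close>, so that \<open>a r\<close>
      and \<open>b q\<close> lie in \<open>B\<close> and \<open>inj\<close> can replace the witness
      e by one from \<open>S'\<close>.\<close>
    obtain a b where ab: "a \<in> S'" "b \<in> B" "a \<otimes> s = b \<otimes> t" "a \<otimes> s \<in> S'"
      using sub.common_multiple[of s t] X Y by auto
    have aB: "a \<in> B" using ab S'B by blast
    have "fraction_eq s r t q" using FXY X Y frac_eq_iff by metis
    then obtain e where e: "e \<in> S" "e \<otimes> (a \<otimes> r) = e \<otimes> (b \<otimes> q)"
      by (rule fraction_eq_multiple[of s r t q a b]) (use ab aB B in auto)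
    have c: "a \<otimes> r \<in> B" "b \<otimes> q \<in> B"
      using sub.m_closed[of a r] sub.m_closed[of b q] ab aB X Y by simp_all
    obtain f where f: "f \<in> S'" "f \<otimes> (a \<otimes> r) = f \<otimes> (b \<otimes> q)"
      using inj[OF e(1) c e(2)] by blast
    have "sub.fraction_eq s r t q"
      by (rule sub.fraction_eqI[of s t r q a b f]) (use X Y ab aB f in simp_all)
    then show "X = Y" using X Y sub.frac_cong by simp
  qed
  moreover have "F ` carrier ?L = carrier ?M"
  proof (intro subset_antisym subsetI)
    show "Y \<in> carrier ?M" if "Y \<in> F ` carrier ?L" for Y
      using that ring_hom_closed[OF hom] by blast
    fix Y assume "Y \<in> carrier ?M"
    then obtain s r where Y: "Y = frac s r" "s \<in> S" "r \<in> carrier R"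
      unfolding carrier_localization by blast
    obtain a where a: "a \<in> carrier R" "a \<otimes> s \<in> S'" "a \<otimes> r \<in> B" using surj[OF Y(2,3)] by blast
    have "fraction_eq s r (a \<otimes> s) (a \<otimes> r)"
      by (rule fraction_eqI[where c = a and d = \<one> and e = \<one>])
        (use Y a S' B one_S S_closed in auto)
    then have "Y = F (sub.frac (a \<otimes> s) (a \<otimes> r))"
      using frac_cong F a Y by simp
    then show "Y \<in> F ` carrier ?L" unfolding carL using a by blast
  qed
  ultimately show ?thesis
    unfolding algebra_isomorphic_def ring_iso_def using hom smult by (auto simp: bij_betw_def)
qed

section \<open>Density and left quotient rings\<close>

text \<open>\<open>R\<close>, \<open>A\<close>, \<open>D\<close> and \<open>\<Theta>\<close> stand for \<open>\<bbbA>\<^sub>n\<close>, \<open>A\<^sub>n\<close>, \<open>\<Delta>\<^sub>n\<close> and the set of the monomials \<open>\<partial>\<^sup>\<beta>\<close>.\<close>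

locale jacobian_setting = ring R for R :: "('k, 'a, 'm) module_scheme" (structure) +
  fixes A D \<Theta> :: "'a set"
  assumes smult_closed: "r \<in> carrier R \<Longrightarrow> c \<odot> r \<in> carrier R"
    and smult_closed_A: "r \<in> A \<Longrightarrow> c \<odot> r \<in> A"
    and mult_smult: "\<lbrakk>a \<in> carrier R; r \<in> carrier R\<rbrakk> \<Longrightarrow> a \<otimes> (c \<odot> r) = c \<odot> (a \<otimes> r)"
    and one_not_zero: "\<one> \<noteq> \<zero>"
    and A: "subring A R" and D: "subring D R"
    and \<Theta>_A: "\<theta> \<in> \<Theta> \<Longrightarrow> \<theta> \<in> A" and \<Theta>_D: "\<theta> \<in> \<Theta> \<Longrightarrow> \<theta> \<in> D"
    and one_\<Theta>: "\<one> \<in> \<Theta>" and mult_\<Theta>: "\<lbrakk>\<theta> \<in> \<Theta>; \<eta> \<in> \<Theta>\<rbrakk> \<Longrightarrow> \<theta> \<otimes> \<eta> \<in> \<Theta>"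
    and \<Theta>_left_regular: "\<lbrakk>\<theta> \<in> \<Theta>; r \<in> carrier R; r \<otimes> \<theta> = \<zero>\<rbrakk> \<Longrightarrow> r = \<zero>"
    and \<Theta>_ore: "\<lbrakk>r \<in> carrier R; \<theta> \<in> \<Theta>\<rbrakk> \<Longrightarrow> \<exists>\<eta>\<in>\<Theta>. \<exists>d\<in>D. \<eta> \<otimes> r = d \<otimes> \<theta>"
    and A_domain: "\<lbrakk>a \<in> A; b \<in> A; a \<otimes> b = \<zero>\<rbrakk> \<Longrightarrow> a = \<zero> \<or> b = \<zero>"
    and A_ore: "\<lbrakk>a \<in> A; b \<in> A; a \<noteq> \<zero>; b \<noteq> \<zero>\<rbrakk> \<Longrightarrow>
      \<exists>u\<in>A. \<exists>v\<in>A. u \<otimes> a = v \<otimes> b \<and> u \<otimes> a \<noteq> \<zero>"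
    and A_clears: "r \<in> carrier R \<Longrightarrow> \<exists>w\<in>A. w \<noteq> \<zero> \<and> w \<otimes> r \<in> A"
    and D_torsion_free: "\<lbrakk>w \<in> A; w \<noteq> \<zero>; d \<in> D; w \<otimes> d = \<zero>\<rbrakk> \<Longrightarrow> d = \<zero>"
begin

lemma A_closed: "a \<in> A \<Longrightarrow> a \<in> carrier R" and D_closed: "d \<in> D \<Longrightarrow> d \<in> carrier R"
  using subringE(1)[OF A] subringE(1)[OF D] by blast+

lemma \<Theta>_closed: "\<theta> \<in> \<Theta> \<Longrightarrow> \<theta> \<in> carrier R"
  using \<Theta>_A A_closed by blast

lemma \<Theta>_nonzero: "\<theta> \<in> \<Theta> \<Longrightarrow> \<theta> \<noteq> \<zero>"
  using \<Theta>_left_regular[of \<theta> \<one>] one_not_zero by fastforce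

lemma mult_A: "a \<in> A \<Longrightarrow> b \<in> A \<Longrightarrow> a \<otimes> b \<in> A" and one_A: "\<one> \<in> A"
  and mult_D: "d \<in> D \<Longrightarrow> d' \<in> D \<Longrightarrow> d \<otimes> d' \<in> D" and one_D: "\<one> \<in> D"
  using subringE(3,6)[OF A] subringE(3,6)[OF D] by blast+

lemma minus_A: "a \<in> A \<Longrightarrow> b \<in> A \<Longrightarrow> a \<ominus> b \<in> A"
  using subringE(5,7)[OF A] by (simp add: minus_eq)

lemma \<Theta>_into_D:
  assumes "r \<in> carrier R" obtains \<theta> where "\<theta> \<in> \<Theta>" "\<theta> \<otimes> r \<in> D"
  using \<Theta>_ore[OF assms one_\<Theta>] D_closed that by fastforce

section \<open>The torsion ideal\<close>

definition torsion :: "'a set" where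
  "torsion = {r \<in> carrier R. \<exists>\<theta>\<in>\<Theta>. \<theta> \<otimes> r = \<zero>}"

lemma torsion_closed: "r \<in> torsion \<Longrightarrow> r \<in> carrier R"
  unfolding torsion_def by blast

text \<open>If w kills r and \<theta> moves r into \<open>D\<close>, a common left multiple u
  \<theta> = v w kills r. So u kills \<theta> r, and since \<open>D\<close> has no torsion over
  \<open>A\<close>, already \<theta> kills r.\<close>

lemma torsion_iff:
  assumes r: "r \<in> carrier R"
  shows "r \<in> torsion \<longleftrightarrow> (\<exists>w\<in>A. w \<noteq> \<zero> \<and> w \<otimes> r = \<zero>)"
proof
  show "\<exists>w\<in>A. w \<noteq> \<zero> \<and> w \<otimes> r = \<zero>" if "r \<in> torsion"
    using that \<Theta>_A \<Theta>_nonzero unfolding torsion_def by blast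
  assume "\<exists>w\<in>A. w \<noteq> \<zero> \<and> w \<otimes> r = \<zero>"
  then obtain w where w: "w \<in> A" "w \<noteq> \<zero>" "w \<otimes> r = \<zero>" by blast
  obtain \<theta> where \<theta>: "\<theta> \<in> \<Theta>" "\<theta> \<otimes> r \<in> D" using \<Theta>_into_D[OF r] .
  obtain u v where uv: "u \<in> A" "v \<in> A" "u \<otimes> \<theta> = v \<otimes> w" "u \<otimes> \<theta> \<noteq> \<zero>"
    using A_ore[OF \<Theta>_A[OF \<theta>(1)] w(1) \<Theta>_nonzero[OF \<theta>(1)] w(2)] by blast
  note c = uv(1,2)[THEN A_closed] w(1)[THEN A_closed] \<Theta>_closed[OF \<theta>(1)] r
  have u: "u \<noteq> \<zero>" using uv(4) c by auto
  have "u \<otimes> (\<theta> \<otimes> r) = v \<otimes> (w \<otimes> r)" using uv(3) c by (metis m_assoc)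
  then have "u \<otimes> (\<theta> \<otimes> r) = \<zero>" using w(3) c by simp
  then show "r \<in> torsion"
    using D_torsion_free[OF uv(1) u \<theta>(2)] \<theta>(1) r unfolding torsion_def by blast
qed

lemma A_torsion_free: "a \<in> A \<Longrightarrow> a \<in> torsion \<Longrightarrow> a = \<zero>"
  using A_domain \<Theta>_A \<Theta>_nonzero unfolding torsion_def by blast

lemma D_torsion: "d \<in> D \<Longrightarrow> d \<in> torsion \<Longrightarrow> d = \<zero>"
  using D_torsion_free \<Theta>_A \<Theta>_nonzero unfolding torsion_def by blast

lemma zero_torsion: "\<zero> \<in> torsion"
  unfolding torsion_def using one_\<Theta> r_null[OF one_closed] by blast

text \<open>The left side is the delicate one: the annihilator \<theta> of f has to be moved past r,
  which the Ore condition for \<Theta> provides.\<close>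

lemma torsion_mult_left:
  assumes "f \<in> torsion" "r \<in> carrier R" shows "r \<otimes> f \<in> torsion"
proof -
  obtain \<theta> where \<theta>: "\<theta> \<in> \<Theta>" "\<theta> \<otimes> f = \<zero>" "f \<in> carrier R"
    using assms unfolding torsion_def by blast
  obtain \<eta> d where \<eta>: "\<eta> \<in> \<Theta>" "d \<in> D" "\<eta> \<otimes> r = d \<otimes> \<theta>" using \<Theta>_ore[OF assms(2) \<theta>(1)] by blast
  have "\<eta> \<otimes> (r \<otimes> f) = d \<otimes> (\<theta> \<otimes> f)"
    using \<eta> \<theta>(3) \<Theta>_closed[OF \<eta>(1)] \<Theta>_closed[OF \<theta>(1)] D_closed[OF \<eta>(2)] assms(2) by (metis m_assoc)
  then have "\<eta> \<otimes> (r \<otimes> f) = \<zero>" using \<theta>(2) D_closed[OF \<eta>(2)] by simp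
  then show ?thesis using \<eta>(1) \<theta>(3) assms(2) unfolding torsion_def by blast
qed

lemma torsion_mult_right:
  assumes "f \<in> torsion" "r \<in> carrier R" shows "f \<otimes> r \<in> torsion"
proof -
  obtain \<theta> where \<theta>: "\<theta> \<in> \<Theta>" "\<theta> \<otimes> f = \<zero>" "f \<in> carrier R"
    using assms unfolding torsion_def by blast
  have "\<theta> \<otimes> (f \<otimes> r) = \<zero>"
    using \<theta> \<Theta>_closed[OF \<theta>(1)] assms(2) by (simp add: m_assoc[symmetric])
  then show ?thesis using \<theta> assms(2) unfolding torsion_def by blast
qed

lemma torsion_add:
  assumes "f \<in> torsion" "g \<in> torsion" shows "f \<oplus> g \<in> torsion"
proof -
  obtain \<theta> where \<theta>: "\<theta> \<in> \<Theta>" "\<theta> \<otimes> f = \<zero>" "f \<in> carrier R"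
    using assms unfolding torsion_def by blast
  \<comment> \<open>The second annihilator is chosen for \<theta> g and not for g, so that the
    product \<eta> \<theta> kills both summands.\<close>
  have "\<theta> \<otimes> g \<in> torsion" using torsion_mult_left[OF assms(2)] \<Theta>_closed[OF \<theta>(1)] .
  then obtain \<eta> where \<eta>: "\<eta> \<in> \<Theta>" "\<eta> \<otimes> (\<theta> \<otimes> g) = \<zero>" unfolding torsion_def by blast
  have g: "g \<in> carrier R" using assms torsion_closed by blast
  note c = \<Theta>_closed[OF \<theta>(1)] \<Theta>_closed[OF \<eta>(1)] g \<theta>(3)
  have "(\<eta> \<otimes> \<theta>) \<otimes> (f \<oplus> g) = \<eta> \<otimes> (\<theta> \<otimes> f) \<oplus> \<eta> \<otimes> (\<theta> \<otimes> g)"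
    using c by (simp add: r_distr m_assoc)
  then have "(\<eta> \<otimes> \<theta>) \<otimes> (f \<oplus> g) = \<zero>" using \<theta>(2) \<eta>(2) c by simp
  then show ?thesis using mult_\<Theta>[OF \<eta>(1) \<theta>(1)] c unfolding torsion_def by blast
qed

lemma torsion_ideal: "ideal torsion R"
proof (rule idealI)
  show "subgroup torsion (add_monoid R)"
  proof (rule add.subgroupI)
    show "\<ominus> a \<in> torsion" if a: "a \<in> torsion" for a
      using torsion_mult_left[OF a, of "\<ominus> \<one>"] torsion_closed[OF a] by (simp add: l_minus)
  qed (use zero_torsion torsion_add torsion_closed in auto)
qed (use torsion_mult_left torsion_mult_right ring_axioms in auto)

text \<open>The product is tested in the domain \<open>A\<close>. Clearing gives nonzero u r and v s
  in \<open>A\<close>, and x (u r) = q v brings v next to s, so that x u r s = q (v s) is a nonzero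
  element of \<open>A\<close>, which has no torsion.\<close>

lemma torsion_prime:
  assumes r: "r \<in> carrier R" and s: "s \<in> carrier R" and rs: "r \<otimes> s \<in> torsion"
  shows "r \<in> torsion \<or> s \<in> torsion"
proof (rule ccontr)
  assume "\<not> ?thesis"
  then have nr: "r \<notin> torsion" and ns: "s \<notin> torsion" by auto
  obtain u where u: "u \<in> A" "u \<noteq> \<zero>" "u \<otimes> r \<in> A" using A_clears[OF r] by blast
  obtain v where v: "v \<in> A" "v \<noteq> \<zero>" "v \<otimes> s \<in> A" using A_clears[OF s] by blast
  have ur: "u \<otimes> r \<noteq> \<zero>" and vs: "v \<otimes> s \<noteq> \<zero>"
    using u v nr ns torsion_iff[OF r] torsion_iff[OF s] by auto
  obtain x q where xq: "x \<in> A" "q \<in> A" "x \<otimes> (u \<otimes> r) = q \<otimes> v" "x \<otimes> (u \<otimes> r) \<noteq> \<zero>"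
    using A_ore[OF u(3) v(1) ur v(2)] by blast
  note c = u(1)[THEN A_closed] v(1)[THEN A_closed] xq(1,2)[THEN A_closed] r s
  have q: "q \<noteq> \<zero>" using xq(3,4) c by auto
  have x: "x \<noteq> \<zero>" using xq(4) c by auto
  have qvs: "q \<otimes> (v \<otimes> s) \<noteq> \<zero>" using A_domain[OF xq(2) v(3)] q vs by blast
  have "(x \<otimes> u) \<otimes> (r \<otimes> s) = (x \<otimes> (u \<otimes> r)) \<otimes> s" using c by (simp add: m_assoc)
  also have "\<dots> = q \<otimes> (v \<otimes> s)" unfolding xq(3) using c by (simp add: m_assoc)
  finally have "q \<otimes> (v \<otimes> s) = (x \<otimes> u) \<otimes> (r \<otimes> s)" by simp
  moreover have "(x \<otimes> u) \<otimes> (r \<otimes> s) \<in> torsion" using torsion_mult_left[OF rs] c by simp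
  ultimately show False using A_torsion_free[OF mult_A[OF xq(2) v(3)]] qvs by simp
qed

lemma D_domain: "\<lbrakk>d \<in> D; d' \<in> D; d \<otimes> d' = \<zero>\<rbrakk> \<Longrightarrow> d = \<zero> \<or> d' = \<zero>"
  using torsion_prime[OF D_closed D_closed] D_torsion zero_torsion by metis

lemma left_regular_not_torsion: "c \<in> left_regular_elements R \<Longrightarrow> c \<notin> torsion"
  using \<Theta>_nonzero \<Theta>_closed unfolding left_regular_elements_def torsion_def by blast

lemma left_regular_mult:
  assumes "b \<in> left_regular_elements R" "c \<in> left_regular_elements R"
  shows "b \<otimes> c \<in> left_regular_elements R"
proof -
  have bc: "b \<in> carrier R" "c \<in> carrier R" using assms by (auto simp: left_regular_elements_def)
  have "r = \<zero>" if "r \<in> carrier R" "r \<otimes> (b \<otimes> c) = \<zero>" for r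
  proof -
    have "(r \<otimes> b) \<otimes> c = \<zero>" using that bc by (simp add: m_assoc)
    then have "r \<otimes> b = \<zero>" using assms(2) that bc by (simp add: left_regular_elements_def)
    then show ?thesis using assms(1) that by (simp add: left_regular_elements_def)
  qed
  then show ?thesis using bc by (simp add: left_regular_elements_def)
qed

lemma one_left_regular: "\<one> \<in> left_regular_elements R"
  by (simp add: left_regular_elements_def)

lemma \<Theta>_subset_left_regular: "\<theta> \<in> \<Theta> \<Longrightarrow> \<theta> \<in> left_regular_elements R"
  using \<Theta>_left_regular \<Theta>_closed by (auto simp: left_regular_elements_def)

lemma left_denominator_setI:
  assumes "S \<subseteq> carrier R" "\<one> \<in> S" "\<And>s t. \<lbrakk>s \<in> S; t \<in> S\<rbrakk> \<Longrightarrow> s \<otimes> t \<in> S" "\<zero> \<notin> S"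
    and "\<And>r s. \<lbrakk>r \<in> carrier R; s \<in> S\<rbrakk> \<Longrightarrow> \<exists>u\<in>S. \<exists>p\<in>carrier R. u \<otimes> r = p \<otimes> s"
    and "\<And>r s. \<lbrakk>r \<in> carrier R; s \<in> S; r \<otimes> s = \<zero>\<rbrakk> \<Longrightarrow> \<exists>t\<in>S. t \<otimes> r = \<zero>"
  shows "left_denominator_set R S"
proof -
  have "(S #> r) \<inter> (carrier R #> s) \<noteq> {}" if "r \<in> carrier R" "s \<in> S" for r s
    using assms(5)[OF that] unfolding r_coset_def by blast
  then show ?thesis
    unfolding left_denominator_set_def left_Ore_set_def multiplicative_set_def
    using assms(1-4,6) by blast
qed

text \<open>For left regular elements the annihilator condition holds with t = 1, since r s = 0
  forces r = 0.\<close>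

lemma left_regular_denominator_setI:
  assumes "S \<subseteq> left_regular_elements R" "\<one> \<in> S" "\<And>s t. \<lbrakk>s \<in> S; t \<in> S\<rbrakk> \<Longrightarrow> s \<otimes> t \<in> S"
    and "\<And>r s. \<lbrakk>r \<in> carrier R; s \<in> S\<rbrakk> \<Longrightarrow> \<exists>u\<in>S. \<exists>p\<in>carrier R. u \<otimes> r = p \<otimes> s"
  shows "left_denominator_set R S"
proof (rule left_denominator_setI)
  show "S \<subseteq> carrier R" using assms(1) by (auto simp: left_regular_elements_def)
  show "\<zero> \<notin> S" using assms(1) left_regular_not_torsion zero_torsion by blast
  show "\<exists>t\<in>S. t \<otimes> r = \<zero>" if "r \<in> carrier R" "s \<in> S" "r \<otimes> s = \<zero>" for r s
    using that assms(1,2) by (auto simp: left_regular_elements_def intro!: bexI[of _ \<one>])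
qed (use assms in blast)+

abbreviation (input) "largest \<equiv> largest_left_regular_denominator_set R"

lemma largest_denominator: "left_denominator_set R largest"
  and largest_left_regular: "largest \<subseteq> left_regular_elements R"
  and largest_greatest: "\<lbrakk>left_denominator_set R S; S \<subseteq> left_regular_elements R\<rbrakk> \<Longrightarrow> S \<subseteq> largest"
  using largest_left_regular_denominator_set[OF ring_axioms one_not_zero] by blast+

lemma \<Theta>_largest: "\<Theta> \<subseteq> largest"
proof (rule largest_greatest)
  show "left_denominator_set R \<Theta>"
    by (rule left_regular_denominator_setI)
      (use \<Theta>_subset_left_regular one_\<Theta> mult_\<Theta> \<Theta>_ore D_closed in blast)+
qed (use \<Theta>_subset_left_regular in blast)

lemma mult_set_largest: "multiplicative_set R largest"
  using largest_denominator unfolding left_denominator_set_def left_Ore_set_def by blast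

lemma denominator_algebra_R: "left_denominator_set R S \<Longrightarrow> denominator_algebra R S"
  by unfold_locales (use smult_closed mult_smult in auto)

section \<open>Localization at the complement of the torsion ideal\<close>

definition T where "T = carrier R - torsion"

lemma left_regular_T: "left_regular_elements R \<subseteq> T"
  using left_regular_not_torsion by (auto simp: T_def left_regular_elements_def)

lemma T_denominator: "left_denominator_set R T"
proof (rule left_denominator_setI)
  show "\<one> \<in> T"
    unfolding T_def using A_torsion_free one_A one_not_zero by blast
  show "s \<otimes> t \<in> T" if "s \<in> T" "t \<in> T" for s t
    using that torsion_prime unfolding T_def by blast
  show "\<zero> \<notin> T" unfolding T_def using zero_torsion by blast
  show "\<exists>t\<in>T. t \<otimes> r = \<zero>" if rs: "r \<in> carrier R" "s \<in> T" "r \<otimes> s = \<zero>" for r s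
  proof -
    have "r \<in> torsion"
      using torsion_prime[of r s] rs zero_torsion unfolding T_def by auto
    then obtain \<theta> where "\<theta> \<in> \<Theta>" "\<theta> \<otimes> r = \<zero>" unfolding torsion_def by blast
    moreover have "\<theta> \<in> T"
      unfolding T_def using calculation A_torsion_free \<Theta>_A \<Theta>_nonzero \<Theta>_closed by blast
    ultimately show ?thesis by blast
  qed
  show "\<exists>t\<in>T. \<exists>p\<in>carrier R. t \<otimes> r = p \<otimes> s" if r: "r \<in> carrier R" and s: "s \<in> T" for r s
  proof -
    have sc: "s \<in> carrier R" "s \<notin> torsion" using s unfolding T_def by auto
    obtain w where w: "w \<in> A" "w \<noteq> \<zero>" "w \<otimes> r \<in> A" using A_clears[OF r] by blast
    obtain v where v: "v \<in> A" "v \<noteq> \<zero>" "v \<otimes> s \<in> A" using A_clears[OF sc(1)] by blast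
    have vs: "v \<otimes> s \<noteq> \<zero>" using torsion_iff[OF sc(1)] sc(2) v by blast
    have wc: "w \<in> carrier R" and vc: "v \<in> carrier R" using w v A_closed by auto
    have TI: "a \<in> T" if "a \<in> A" "a \<noteq> \<zero>" for a
      using that A_torsion_free A_closed unfolding T_def by blast
    show ?thesis
    proof (cases "w \<otimes> r = \<zero>")
      case True
      \<comment> \<open>Here w kills r, so w itself is the left factor and the other side is 0
        s.\<close>
      then show ?thesis using TI[OF w(1,2)] sc(1) by (intro bexI[of _ w] bexI[of _ \<zero>]) auto
    next
      case False
      obtain u c where uc: "u \<in> A" "c \<in> A" "u \<otimes> (w \<otimes> r) = c \<otimes> (v \<otimes> s)" "u \<otimes> (w \<otimes> r) \<noteq> \<zero>"
        using A_ore[OF w(3) v(3) False vs] by blast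
      note cl = uc(1,2)[THEN A_closed] wc vc r sc(1)
      have "u \<noteq> \<zero>" using uc(4) cl by auto
      then have "u \<otimes> w \<noteq> \<zero>" using A_domain[OF uc(1) w(1)] w(2) by blast
      then have "u \<otimes> w \<in> T" using TI mult_A uc w by blast
      moreover have "(u \<otimes> w) \<otimes> r = (c \<otimes> v) \<otimes> s" using uc(3) cl by (simp add: m_assoc)
      ultimately show ?thesis using cl m_closed by blast
    qed
  qed
qed (auto simp: T_def)

definition dense :: "'a set \<Rightarrow> bool" where
  "dense S \<longleftrightarrow> (\<forall>t\<in>T. \<exists>a\<in>carrier R. a \<otimes> t \<in> S)"

lemma denseE:
  assumes "dense S" "t \<in> T" obtains a where "a \<in> carrier R" "a \<otimes> t \<in> S"
  using assms unfolding dense_def by blast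

lemma carrier_update_self: "R\<lparr>carrier := carrier R\<rparr> = R"
  by simp

text \<open>The subalgebra lemma with \<open>B\<close> the whole ring: density turns a witness e in
  \<open>T\<close> into k e in \<open>S\<close>, and expands a denominator in \<open>T\<close> to
  one in \<open>S\<close>.\<close>

lemma dense_iso_T:
  assumes S: "left_denominator_set R S" "S \<subseteq> left_regular_elements R" and d: "dense S"
  shows "algebra_isomorphic (left_localization R S) (left_localization R T)"
proof -
  interpret loc: denominator_algebra R T by (rule denominator_algebra_R[OF T_denominator])
  have inj: "\<exists>f\<in>S. f \<otimes> p = f \<otimes> q"
    if e: "e \<in> T" and pq: "p \<in> carrier R" "q \<in> carrier R" "e \<otimes> p = e \<otimes> q" for e p q
  proof -
    obtain k where k: "k \<in> carrier R" "k \<otimes> e \<in> S" by (rule denseE[OF d e])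
    have "(k \<otimes> e) \<otimes> p = (k \<otimes> e) \<otimes> q"
      by (rule loc.mult_common_multiple[OF k(1) loc.S_closed[OF e] pq])
    then show ?thesis using k(2) by blast
  qed
  have surj: "\<exists>a\<in>carrier R. a \<otimes> s \<in> S \<and> a \<otimes> r \<in> carrier R"
    if "s \<in> T" "r \<in> carrier R" for s r
    by (rule denseE[OF d that(1)]) (use that(2) m_closed in blast)
  have "denominator_algebra (R\<lparr>carrier := carrier R\<rparr>) S"
    unfolding carrier_update_self by (rule denominator_algebra_R[OF S(1)])
  from loc.localization_of_subalgebra[OF this subset_refl subset_trans[OF S(2) left_regular_T] inj surj]
  show ?thesis unfolding carrier_update_self .
qed

abbreviation "A_algebra \<equiv> R\<lparr>carrier := A\<rparr>"

lemma ring_A: "ring A_algebra"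
  by (rule subring_is_ring[OF A])

lemma regular_elements_A: "regular_elements A_algebra = A - {\<zero>}"
proof (intro subset_antisym subsetI)
  fix a assume "a \<in> regular_elements A_algebra"
  then have "a \<in> A" "\<one> \<otimes> a = \<zero> \<longrightarrow> \<one> = \<zero>"
    using one_A by (auto simp: regular_elements_def left_regular_elements_def)
  then show "a \<in> A - {\<zero>}" using one_not_zero by auto
next
  fix a assume "a \<in> A - {\<zero>}"
  then show "a \<in> regular_elements A_algebra"
    using A_domain by (auto simp: regular_elements_def left_regular_elements_def)
qed

lemma A_nonzero_denominator: "left_denominator_set A_algebra (A - {\<zero>})"
  unfolding left_denominator_set_def left_Ore_set_def multiplicative_set_def r_coset_def
proof (intro conjI ballI impI)
  fix r s assume r: "r \<in> carrier A_algebra" and s: "s \<in> A - {\<zero>}"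
  show "(\<Union>h\<in>A - {\<zero>}. {h \<otimes>\<^bsub>A_algebra\<^esub> r}) \<inter> (\<Union>h\<in>carrier A_algebra. {h \<otimes>\<^bsub>A_algebra\<^esub> s}) \<noteq> {}"
  proof (cases "r = \<zero>")
    case True
    have "\<one> \<otimes> r = \<zero> \<otimes> s" using True s A_closed by simp
    moreover have "\<one> \<in> A - {\<zero>}" "\<zero> \<in> A" using one_A one_not_zero subringE(2)[OF A] by auto
    ultimately show ?thesis by auto
  next
    case False
    then obtain u v where "u \<in> A" "v \<in> A" "u \<otimes> r = v \<otimes> s" "u \<otimes> r \<noteq> \<zero>"
      using A_ore[of r s] r s by auto
    moreover have "u \<noteq> \<zero>" using calculation(4) r A_closed by auto
    ultimately show ?thesis by auto
  qed
next
  fix r s assume "r \<in> carrier A_algebra" "s \<in> A - {\<zero>}" "r \<otimes>\<^bsub>A_algebra\<^esub> s = \<zero>\<^bsub>A_algebra\<^esub>"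
  then have "r = \<zero>" using A_domain[of r s] by auto
  then show "\<exists>t\<in>A - {\<zero>}. t \<otimes>\<^bsub>A_algebra\<^esub> r = \<zero>\<^bsub>A_algebra\<^esub>"
    using one_A one_not_zero by (intro bexI[of _ \<one>]) auto
qed (use A_domain mult_A one_A one_not_zero in auto)

lemma denominator_algebra_A: "denominator_algebra A_algebra (A - {\<zero>})"
proof -
  interpret A: ring A_algebra by (rule ring_A)
  show ?thesis
    by unfold_locales (use A_nonzero_denominator smult_closed_A mult_smult A_closed in auto)
qed

lemma A_iso_T:
  "algebra_isomorphic (left_localization A_algebra (A - {\<zero>})) (left_localization R T)"
proof -
  interpret loc: denominator_algebra R T by (rule denominator_algebra_R[OF T_denominator])
  show ?thesis
  proof (rule loc.localization_of_subalgebra[OF denominator_algebra_A])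
    show "A \<subseteq> carrier R" using A_closed by blast
    show "A - {\<zero>} \<subseteq> T" using A_closed A_torsion_free unfolding T_def by blast
    show "\<exists>f\<in>A - {\<zero>}. f \<otimes> p = f \<otimes> q" if "e \<in> T" "p \<in> A" "q \<in> A" "e \<otimes> p = e \<otimes> q" for e p q
    proof -
      have c: "e \<in> carrier R" "p \<in> carrier R" "q \<in> carrier R" using that A_closed loc.S_closed by auto
      have "e \<otimes> (p \<ominus> q) = \<zero>"
        using c that(4) by (simp add: minus_eq r_distr r_minus r_neg)
      \<comment> \<open>As e is not torsion, primality makes p - q torsion, and the torsion ideal
        meets \<open>A\<close> only in 0. The witness is then f = 1.\<close>
      then have "p \<ominus> q \<in> torsion"
        using torsion_prime[of e "p \<ominus> q"] c zero_torsion that(1) unfolding T_def by auto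
      then have "p \<ominus> q = \<zero>" using A_torsion_free minus_A that by blast
      then have "p = q" using c by simp
      then show ?thesis using one_A one_not_zero by blast
    qed
    show "\<exists>a\<in>carrier R. a \<otimes> s \<in> A - {\<zero>} \<and> a \<otimes> r \<in> A" if s: "s \<in> T" and r: "r \<in> carrier R" for s r
    proof -
      have sc: "s \<in> carrier R" "s \<notin> torsion" using s unfolding T_def by auto
      obtain w where w: "w \<in> A" "w \<noteq> \<zero>" "w \<otimes> s \<in> A" using A_clears[OF sc(1)] by blast
      have wc: "w \<in> carrier R" using w A_closed by blast
      \<comment> \<open>Two clearings in succession: v is chosen for w r, and v (w s) stays in
        \<open>A\<close> because w s is already there.\<close>
      obtain v where v: "v \<in> A" "v \<noteq> \<zero>" "v \<otimes> (w \<otimes> r) \<in> A"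
        using A_clears[of "w \<otimes> r"] wc r by auto
      have vc: "v \<in> carrier R" using v A_closed by blast
      have "(v \<otimes> w) \<otimes> s \<in> A" "(v \<otimes> w) \<otimes> r \<in> A"
        using v w mult_A[OF v(1) w(3)] vc wc sc r by (simp_all add: m_assoc)
      moreover have "(v \<otimes> w) \<otimes> s \<noteq> \<zero>"
        using torsion_iff[OF sc(1)] sc(2) A_domain[OF v(1) w(1)] v(2) w(2) mult_A[OF v(1) w(1)]
        by blast
      ultimately show ?thesis using vc wc by (intro bexI[of _ "v \<otimes> w"]) auto
    qed
  qed
qed

text \<open>Since the isomorphism need not respect the embedding of \<open>A\<close>, the forward
  direction uses only that a nonzero fraction s^-1 r over \<open>A\<close> has the inverse r^-1 s.
  The preimage of this inverse is a left inverse of t, and comparing fractions yields a left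
  multiple of t in \<open>S\<close>.\<close>

lemma iso_iff_dense:
  assumes S: "left_denominator_set R S" "S \<subseteq> left_regular_elements R"
  shows "algebra_isomorphic (left_localization R S) (classical_left_quotient_ring A_algebra)
    \<longleftrightarrow> dense S" (is "algebra_isomorphic ?X ?Y \<longleftrightarrow> _")
proof -
  interpret A: denominator_algebra A_algebra "A - {\<zero>}" by (rule denominator_algebra_A)
  interpret S: denominator_algebra R S by (rule denominator_algebra_R[OF S(1)])
  have Y: "?Y = left_localization A_algebra (A - {\<zero>})"
    unfolding classical_left_quotient_ring_def regular_elements_A ..
  have oneY: "\<one>\<^bsub>?Y\<^esub> \<in> carrier ?Y"
    unfolding Y A.frac_one A.carrier_localization using one_A one_not_zero by auto
  show ?thesis
  proof
    assume "dense S"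
    from algebra_isomorphic_common_target[OF dense_iso_T[OF S this] A_iso_T, folded Y]
    show "algebra_isomorphic ?X ?Y"
      using A.localization_closed oneY unfolding Y by blast
  next
    assume "algebra_isomorphic ?X ?Y"
    then obtain f where f: "f \<in> ring_hom ?X ?Y" "bij_betw f (carrier ?X) (carrier ?Y)"
      unfolding algebra_isomorphic_def ring_iso_def by blast
    show "dense S"
      unfolding dense_def
    proof
      fix t assume t: "t \<in> T"
      have tc: "t \<in> carrier R" "t \<notin> torsion" using t unfolding T_def by auto
      let ?t = "S.frac \<one> t"
      have tX: "?t \<in> carrier ?X" unfolding S.carrier_localization using S.one_S tc by blast
      then have "f ?t \<in> carrier ?Y" using f(2) by (rule bij_betw_apply[rotated])
      then obtain s r where sr: "f ?t = A.frac s r" "s \<in> A" "s \<noteq> \<zero>" "r \<in> A"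
        unfolding Y A.carrier_localization by auto
      have c: "s \<in> carrier R" "r \<in> carrier R" using sr A_closed by auto
      have inj: "x = y" if "f x = f y" "x \<in> carrier ?X" "y \<in> carrier ?X" for x y
        using that f(2) by (auto simp: bij_betw_def inj_on_def)
      show "\<exists>a\<in>carrier R. a \<otimes> t \<in> S"
      proof (cases "r = \<zero>")
        case True
        have "f (?t \<oplus>\<^bsub>?X\<^esub> ?t) = f ?t \<oplus>\<^bsub>?Y\<^esub> f ?t"
          by (rule ring_hom_add[OF f(1) tX tX])
        also have "\<dots> = A.frac s r"
          unfolding sr(1) Y using A.frac_add[of s r s r \<one> \<one>] sr one_A c by (simp add: True)
        finally have "?t \<oplus>\<^bsub>?X\<^esub> ?t = ?t"
          using inj S.localization_closed(2)[OF tX tX] tX sr(1) by metis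
        moreover have "?t \<oplus>\<^bsub>?X\<^esub> ?t = S.frac \<one> (t \<oplus> t)"
          using S.frac_add[of \<one> t \<one> t \<one> \<one>] S.one_S tc by simp
        ultimately have "S.fraction_eq \<one> (t \<oplus> t) \<one> t"
          using S.frac_eq_iff[of \<one> "t \<oplus> t" \<one> t] S.one_S tc by simp
        then obtain a b where ab: "a \<in> carrier R" "b \<in> carrier R" "a \<otimes> \<one> = b \<otimes> \<one>" "a \<otimes> \<one> \<in> S"
          "a \<otimes> (t \<oplus> t) = b \<otimes> t" unfolding S.fraction_eq_iff by blast
        have "a = b" "a \<in> S" using ab by auto
        then have "a \<otimes> t \<oplus> a \<otimes> t = a \<otimes> t" using ab tc by (simp add: r_distr)
        then have "a \<otimes> t = \<zero>" using ab tc by (metis add.r_cancel_one' m_closed)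
        \<comment> \<open>The element a lies in \<open>S\<close>, so it is left regular and not
          torsion, while t lies in \<open>T\<close>: the case r = 0 is impossible.\<close>
        then have "a \<in> torsion \<or> t \<in> torsion"
          using torsion_prime[of a t] ab tc zero_torsion by simp
        then show ?thesis
          using tc(2) left_regular_not_torsion S(2) \<open>a \<in> S\<close> by blast
      next
        case False
        have "r \<in> A - {\<zero>}" "s \<in> carrier A_algebra" using False sr by auto
        then have "A.frac r s \<in> carrier ?Y" unfolding Y A.carrier_localization by blast
        then have "A.frac r s \<in> f ` carrier ?X" using f(2) by (simp add: bij_betw_def)
        then obtain x where fx: "A.frac r s = f x" and xX: "x \<in> carrier ?X" by (rule imageE)
        note x = xX fx[symmetric]
        obtain v q where v: "x = S.frac v q" "v \<in> S" "q \<in> carrier R"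
          using x(1) unfolding S.carrier_localization by blast
        have "f (x \<otimes>\<^bsub>?X\<^esub> ?t) = A.frac r s \<otimes>\<^bsub>?Y\<^esub> A.frac s r"
          using ring_hom_mult[OF f(1) x(1) tX] x(2) sr(1) by simp
        also have "\<dots> = A.frac r r"
          unfolding Y using A.frac_mult[of r s s r \<one> \<one>] sr False one_A one_not_zero c by simp
        also have "\<dots> = A.frac \<one> \<one>"
          by (rule A.frac_cong, rule A.fraction_eqI[where c = \<one> and d = r and e = \<one>])
            (use sr False c one_A one_not_zero in auto)
        also have "\<dots> = f (S.frac \<one> \<one>)"
          using ring_hom_one[OF f(1)] by (simp add: S.frac_one Y A.frac_one)
        finally have "x \<otimes>\<^bsub>?X\<^esub> ?t = S.frac \<one> \<one>"
        proof (rule inj[OF _ S.localization_closed(1)[OF x(1) tX]])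
          show "S.frac \<one> \<one> \<in> carrier ?X"
            unfolding S.carrier_localization using S.one_S by blast
        qed
        moreover have "x \<otimes>\<^bsub>?X\<^esub> ?t = S.frac v (q \<otimes> t)"
          unfolding v(1) using S.frac_mult[of v q \<one> t \<one> q] v S.one_S tc S.S_closed by simp
        \<comment> \<open>On representatives, x t = 1 reads a v = b and a q t = b with a v in
          \<open>S\<close>, so a q is the required multiplier of t.\<close>
        ultimately have "S.fraction_eq v (q \<otimes> t) \<one> \<one>"
          using S.frac_eq_iff[of v "q \<otimes> t" \<one> \<one>] S.one_S v tc by simp
        then obtain a b where ab: "a \<in> carrier R" "b \<in> carrier R" "a \<otimes> v = b \<otimes> \<one>" "a \<otimes> v \<in> S"
          "a \<otimes> (q \<otimes> t) = b \<otimes> \<one>" unfolding S.fraction_eq_iff by blast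
        have "(a \<otimes> q) \<otimes> t \<in> S" using ab v tc by (simp add: m_assoc)
        then show ?thesis using ab v by blast
      qed
    qed
  qed
qed

section \<open>Density in the factor ring\<close>

abbreviation "proj r \<equiv> torsion +> r"

text \<open>Two elements agree modulo torsion when some \<theta> equates them from the left. Hence a
  congruence a t = s in the factor ring becomes \<theta> a t = \<theta> s, and closure of
  \<open>S\<close> under left multiplication by \<Theta> lifts density to \<open>R\<close>.\<close>

lemma left_dense_factor_iff:
  assumes S: "multiplicative_set R S" "S \<subseteq> left_regular_elements R" "\<And>\<theta> s. \<lbrakk>\<theta> \<in> \<Theta>; s \<in> S\<rbrakk> \<Longrightarrow> \<theta> \<otimes> s \<in> S"
  shows "left_dense (R Quot torsion) (proj ` S) (carrier (R Quot torsion) - {\<zero>\<^bsub>R Quot torsion\<^esub>})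
    \<longleftrightarrow> dense S" (is "left_dense ?Q _ _ \<longleftrightarrow> _")
proof -
  interpret I: ideal torsion R by (rule torsion_ideal)
  have SC: "s \<in> carrier R" if "s \<in> S" for s using S(1) that unfolding multiplicative_set_def by blast
  have eq: "proj a = proj b \<longleftrightarrow> a \<ominus> b \<in> torsion" if "a \<in> carrier R" "b \<in> carrier R" for a b
    using quotient_eq_iff_same_a_r_cos[OF torsion_ideal that] by simp
  have zero: "proj a = \<zero>\<^bsub>?Q\<^esub> \<longleftrightarrow> a \<in> torsion" if "a \<in> carrier R" for a
  proof -
    have "\<zero>\<^bsub>?Q\<^esub> = proj \<zero>"
      unfolding FactRing_def by (simp add: I.a_rcos_const[OF zero_torsion])
    then show ?thesis using eq[OF that zero_closed] that by (simp add: minus_eq)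
  qed
  have car: "carrier ?Q = proj ` carrier R"
    unfolding FactRing_def A_RCOSETS_defs a_r_coset_def by auto
  have mult: "proj a \<otimes>\<^bsub>?Q\<^esub> proj b = proj (a \<otimes> b)" if "a \<in> carrier R" "b \<in> carrier R" for a b
    unfolding FactRing_def using I.rcoset_mult_add[OF that] by simp
  have one: "\<one>\<^bsub>?Q\<^esub> = proj \<one>" unfolding FactRing_def by simp
  have carT: "carrier ?Q - {\<zero>\<^bsub>?Q\<^esub>} = proj ` T"
    unfolding T_def car using zero by auto
  have ST: "S \<subseteq> T" using S(2) left_regular_T by blast
  have TC: "t \<in> carrier R" if "t \<in> T" for t using that unfolding T_def by blast
  have multset: "multiplicative_set ?Q (proj ` X)" if X: "multiplicative_set R X" "X \<subseteq> T" for X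
    unfolding multiplicative_set_def
  proof (intro conjI ballI)
    show "proj ` X \<subseteq> carrier ?Q" unfolding car using X TC by blast
    show "\<one>\<^bsub>?Q\<^esub> \<in> proj ` X" unfolding one using X(1) unfolding multiplicative_set_def by blast
    show "\<zero>\<^bsub>?Q\<^esub> \<notin> proj ` X" using X(2) carT by blast
    fix a b assume "a \<in> proj ` X" "b \<in> proj ` X"
    then obtain s t where "a = proj s" "b = proj t" "s \<in> X" "t \<in> X" by blast
    then have "a \<otimes>\<^bsub>?Q\<^esub> b = proj (s \<otimes> t)" "s \<otimes> t \<in> X"
      using mult[of s t] X TC unfolding multiplicative_set_def by blast+
    then show "a \<otimes>\<^bsub>?Q\<^esub> b \<in> proj ` X" by simp
  qed
  have multT: "multiplicative_set R T"
    using T_denominator unfolding left_denominator_set_def left_Ore_set_def by blast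
  have "left_dense ?Q (proj ` S) (proj ` T) \<longleftrightarrow>
      (\<forall>t\<in>T. \<exists>a\<in>carrier R. proj (a \<otimes> t) \<in> proj ` S)"
    unfolding left_dense_def car using multset[OF S(1) ST] multset[OF multT subset_refl] ST mult TC
    by auto
  also have "\<dots> \<longleftrightarrow> dense S"
    unfolding dense_def
  proof (intro ball_cong refl iffI)
    fix t assume t: "t \<in> T" and "\<exists>a\<in>carrier R. proj (a \<otimes> t) \<in> proj ` S"
    then obtain a s where a: "a \<in> carrier R" "s \<in> S" "proj (a \<otimes> t) = proj s" by blast
    then have "a \<otimes> t \<ominus> s \<in> torsion" using eq[of "a \<otimes> t" s] TC[OF t] SC by simp
    then obtain \<theta> where \<theta>: "\<theta> \<in> \<Theta>" "\<theta> \<otimes> (a \<otimes> t \<ominus> s) = \<zero>" unfolding torsion_def by blast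
    note c = \<Theta>_closed[OF \<theta>(1)] a(1) TC[OF t] SC[OF a(2)]
    have "\<theta> \<otimes> (a \<otimes> t) \<ominus> \<theta> \<otimes> s = \<zero>" using \<theta>(2) c by (simp add: minus_eq r_distr r_minus)
    then have "(\<theta> \<otimes> a) \<otimes> t = \<theta> \<otimes> s" using c by (simp add: m_assoc)
    then show "\<exists>a\<in>carrier R. a \<otimes> t \<in> S" using S(3)[OF \<theta>(1) a(2)] c by (metis m_closed)
  qed blast
  finally show ?thesis unfolding carT .
qed

lemma dense_mono: "dense S \<Longrightarrow> S \<subseteq> S' \<Longrightarrow> dense S'"
  unfolding dense_def by blast

lemma left_regular_multiplicative: "multiplicative_set R (left_regular_elements R)"
  unfolding multiplicative_set_def
  using left_regular_mult one_left_regular left_regular_not_torsion zero_torsion left_regular_T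
  unfolding T_def by blast

lemma dense_left_regular_denominator:
  assumes "dense (left_regular_elements R)"
  shows "left_denominator_set R (left_regular_elements R)"
proof (rule left_regular_denominator_setI)
  fix r s assume r: "r \<in> carrier R" and s: "s \<in> left_regular_elements R"
  interpret loc: denominator_algebra R T by (rule denominator_algebra_R[OF T_denominator])
  have sT: "s \<in> T" using s left_regular_T by blast
  obtain u p where u: "u \<in> T" "p \<in> carrier R" "u \<otimes> r = p \<otimes> s" using loc.ore[OF r sT] .
  obtain a where a: "a \<in> carrier R" "a \<otimes> u \<in> left_regular_elements R"
    by (rule denseE[OF assms u(1)])
  have "(a \<otimes> u) \<otimes> r = (a \<otimes> p) \<otimes> s" using u a r loc.S_closed[OF u(1)] loc.S_closed[OF sT] by (simp add: m_assoc)
  then show "\<exists>u\<in>left_regular_elements R. \<exists>p\<in>carrier R. u \<otimes> r = p \<otimes> s"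
    using a u m_closed by blast
qed (use one_left_regular left_regular_mult in auto)

lemma largest_eq_left_regular:
  "left_denominator_set R (left_regular_elements R) \<Longrightarrow> largest = left_regular_elements R"
  using largest_greatest largest_left_regular by blast

abbreviation "D_algebra \<equiv> R\<lparr>carrier := D\<rparr>"

text \<open>There are seven entries, not eight, because regularity on F_n and regularity on P_n'
  both turn out to be left regularity.\<close>

theorem equivalences:
  "all_equivalent
    [algebra_isomorphic (left_localization R largest) (classical_left_quotient_ring A_algebra),
     left_denominator_set R (left_regular_elements R) \<and>
       algebra_isomorphic (left_localization R (left_regular_elements R))
         (classical_left_quotient_ring A_algebra),
     left_dense (R Quot torsion) (proj ` largest)
       (carrier (R Quot torsion) - {\<zero>\<^bsub>R Quot torsion\<^esub>}),
     left_dense (R Quot torsion) (proj ` left_regular_elements R)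
       (carrier (R Quot torsion) - {\<zero>\<^bsub>R Quot torsion\<^esub>}),
     left_dense (R Quot torsion) (proj ` (D \<inter> largest))
       (carrier (R Quot torsion) - {\<zero>\<^bsub>R Quot torsion\<^esub>}),
     left_dense D_algebra (D \<inter> largest) (D - {\<zero>}),
     \<forall>s\<in>D - {\<zero>}. \<exists>s'\<in>D - {\<zero>}. s' \<otimes> s \<in> left_regular_elements R]"
    (is "all_equivalent [?P1, ?P2, ?P3, ?P4, ?P5, ?P6, ?P7]")
proof -
  interpret L: denominator_algebra R largest by (rule denominator_algebra_R[OF largest_denominator])
  have \<Theta>L: "\<theta> \<otimes> s \<in> largest" if "\<theta> \<in> \<Theta>" "s \<in> largest" for \<theta> s
    using L.mult_S that \<Theta>_largest by blast
  have multDL: "multiplicative_set R (D \<inter> largest)"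
    unfolding multiplicative_set_def using mult_D one_D L.mult_S L.one_S L.zero_notin_S D_closed by auto
  have DT: "d \<in> T" if "d \<in> D" "d \<noteq> \<zero>" for d
    using that D_torsion D_closed unfolding T_def by blast
  have P1: "?P1 \<longleftrightarrow> dense largest"
    by (rule iso_iff_dense[OF largest_denominator largest_left_regular])
  have P2: "?P2 \<longleftrightarrow> left_denominator_set R (left_regular_elements R) \<and> dense (left_regular_elements R)"
    using iso_iff_dense by blast
  have P3: "?P3 \<longleftrightarrow> dense largest"
    by (rule left_dense_factor_iff[OF mult_set_largest largest_left_regular \<Theta>L])
  have P4: "?P4 \<longleftrightarrow> dense (left_regular_elements R)"
    by (rule left_dense_factor_iff[OF left_regular_multiplicative subset_refl])
      (use \<Theta>_subset_left_regular left_regular_mult in blast)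
  have P5: "?P5 \<longleftrightarrow> dense (D \<inter> largest)"
    by (rule left_dense_factor_iff[OF multDL])
      (use largest_left_regular \<Theta>L \<Theta>_D mult_D in blast)+
  have 42: "dense (left_regular_elements R) \<Longrightarrow> left_denominator_set R (left_regular_elements R)"
    by (rule dense_left_regular_denominator)
  have 41: "dense (left_regular_elements R) \<Longrightarrow> dense largest"
    using 42 largest_eq_left_regular by simp
  have 15: "dense (D \<inter> largest)" if d: "dense largest"
    unfolding dense_def
  proof
    fix t assume t: "t \<in> T"
    obtain a where a: "a \<in> carrier R" "a \<otimes> t \<in> largest" by (rule denseE[OF d t])
    have tc: "t \<in> carrier R" using t unfolding T_def by blast
    \<comment> \<open>A further factor \<theta> moves the multiple into \<open>D\<close> without
      leaving the largest denominator set, which contains \<Theta>.\<close>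
    obtain \<theta> where \<theta>: "\<theta> \<in> \<Theta>" "\<theta> \<otimes> (a \<otimes> t) \<in> D" using \<Theta>_into_D[of "a \<otimes> t"] a tc by auto
    have "(\<theta> \<otimes> a) \<otimes> t \<in> D \<inter> largest"
      using \<theta> \<Theta>L[OF \<theta>(1) a(2)] a tc \<Theta>_closed by (simp add: m_assoc)
    then show "\<exists>a\<in>carrier R. a \<otimes> t \<in> D \<inter> largest"
      using a \<Theta>_closed[OF \<theta>(1)] m_closed by blast
  qed
  have 56: "?P6" if "dense (D \<inter> largest)"
    unfolding left_dense_def
  proof (intro conjI ballI)
    show "multiplicative_set D_algebra (D \<inter> largest)"
      using multDL unfolding multiplicative_set_def by auto
    show "multiplicative_set D_algebra (D - {\<zero>})"
      unfolding multiplicative_set_def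
      using mult_D one_D one_not_zero D_domain by auto
    show "D \<inter> largest \<subseteq> D - {\<zero>}" using L.zero_notin_S by blast
    fix t assume t: "t \<in> D - {\<zero>}"
    then have "t \<in> T" using DT by blast
    from that this obtain a where a: "a \<in> carrier R" "a \<otimes> t \<in> D \<inter> largest" by (rule denseE)
    have tc: "t \<in> carrier R" using t D_closed by blast
    \<comment> \<open>Density inside \<open>D\<close> asks for a multiplier from \<open>D\<close>; a
      factor \<theta> moves a there and keeps the product in both sets.\<close>
    obtain \<theta> where \<theta>: "\<theta> \<in> \<Theta>" "\<theta> \<otimes> a \<in> D" using \<Theta>_into_D[OF a(1)] .
    have "(\<theta> \<otimes> a) \<otimes> t = \<theta> \<otimes> (a \<otimes> t)" using \<Theta>_closed[OF \<theta>(1)] a tc by (simp add: m_assoc)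
    then have "(\<theta> \<otimes> a) \<otimes> t \<in> D \<inter> largest"
      using \<Theta>L[OF \<theta>(1)] mult_D \<Theta>_D[OF \<theta>(1)] a(2) by auto
    then show "\<exists>r\<in>carrier D_algebra. r \<otimes>\<^bsub>D_algebra\<^esub> t \<in> D \<inter> largest" using \<theta>(2) by auto
  qed
  have 67: "?P7" if P6: "?P6"
  proof
    fix s assume s: "s \<in> D - {\<zero>}"
    then obtain r where r: "r \<in> D" "r \<otimes> s \<in> largest" using P6 unfolding left_dense_def by auto
    then have "r \<noteq> \<zero>" using L.zero_notin_S s D_closed by auto
    then show "\<exists>s'\<in>D - {\<zero>}. s' \<otimes> s \<in> left_regular_elements R"
      using r largest_left_regular by blast
  qed
  have 74: "dense (left_regular_elements R)" if P7: "?P7"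
    unfolding dense_def
  proof
    fix t assume t: "t \<in> T"
    have tc: "t \<in> carrier R" "t \<notin> torsion" using t unfolding T_def by auto
    obtain \<theta> where \<theta>: "\<theta> \<in> \<Theta>" "\<theta> \<otimes> t \<in> D" using \<Theta>_into_D[OF tc(1)] .
    have "\<theta> \<otimes> t \<noteq> \<zero>" using tc \<theta>(1) unfolding torsion_def by blast
    then obtain s' where s': "s' \<in> D" "s' \<otimes> (\<theta> \<otimes> t) \<in> left_regular_elements R"
      using P7 \<theta> by blast
    then have "(s' \<otimes> \<theta>) \<otimes> t \<in> left_regular_elements R"
      using D_closed \<Theta>_closed[OF \<theta>(1)] tc by (simp add: m_assoc)
    then show "\<exists>a\<in>carrier R. a \<otimes> t \<in> left_regular_elements R"
      using s' D_closed \<Theta>_closed[OF \<theta>(1)] m_closed by blast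
  qed
  have "dense largest \<Longrightarrow> dense (left_regular_elements R)"
    using dense_mono largest_left_regular by blast
  then show ?thesis
    unfolding all_equivalent_def list.set ball_simps P1 P2 P3 P4 P5
    using 41 42 15 56 67 74 by blast
qed

end

section \<open>Linear operators on polynomials\<close>

text \<open>The simplifier would otherwise rewrite \<open>unit_exponent i\<close>.\<close>

declare One_nat_def [simp del]

abbreviation "lookup \<equiv> Poly_Mapping.lookup"

abbreviation lin :: "('n, 'k::field_char_0) operator \<Rightarrow> bool" where
  "lin f \<equiv> Vector_Spaces.linear scale scale f"

text \<open>Operators with pointwise scaling form a vector space, which makes the library theory of
  spans and independence available; \<open>operator_span\<close> is the span in this space.\<close>

interpretation op: vector_space
  "(\<lambda>c f p. scale c (f p)) :: 'k::field_char_0 \<Rightarrow> ('n, 'k) operator \<Rightarrow> ('n, 'k) operator"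
  by unfold_locales (auto simp: fun_eq_iff pol.scale_right_distrib pol.scale_left_distrib)

lemma operator_span_eq: "operator_span X = op.span X"
  by (simp add: operator_span_def)

lemma lin_comp: "lin f \<Longrightarrow> lin g \<Longrightarrow> lin (f \<circ> g)"
  by (rule Vector_Spaces.linear_compose)

lemma lin_add: "lin f \<Longrightarrow> lin g \<Longrightarrow> lin (f + g)"
  unfolding plus_fun_def by (rule pol_pair.linear_compose_add)

lemma lin_scale_op: "lin f \<Longrightarrow> lin (\<lambda>p. scale c (f p))"
  by (rule pol_pair.linear_compose_scale_right)

lemma lin_scale: "lin (scale c)"
  by (rule pol.linear_scale_self)

lemma lin_zero: "lin 0"
  unfolding zero_fun_def by (rule pol_pair.linear_zero)

lemma lin_id: "lin id"
  by (rule pol.linear_id)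

lemma lin_app_scale: "lin f \<Longrightarrow> f (scale c p) = scale c (f p)"
  and lin_app_add: "lin f \<Longrightarrow> f (p + q) = f p + f q"
  and lin_app_zero: "lin f \<Longrightarrow> f 0 = 0"
  by (rule pol_pair.linear_scale pol_pair.linear_add pol_pair.linear_0; assumption)+

lemma lin_app_sum: "lin f \<Longrightarrow> f (sum g I) = (\<Sum>i\<in>I. f (g i))"
  by (rule pol_pair.linear_sum)

lemma sum_fun_app: "(\<Sum>i\<in>I. f i) p = (\<Sum>i\<in>I. f i p)"
  by (induction I rule: infinite_finite_induct) auto

lemma lookup_monomial: "lookup (monomial \<alpha>) \<beta> = (if \<alpha> = \<beta> then 1 else 0)"
  by (simp add: lookup_single when_def)

lemma linear_eq_zeroI: "lin f \<Longrightarrow> (\<And>\<gamma>. f (monomial \<gamma>) = 0) \<Longrightarrow> f = 0"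
  by (rule linear_operator_eqI[OF _ lin_zero]) auto

lemma exponent_eqI: "(\<And>i. lookup \<alpha> i = lookup \<beta> i) \<Longrightarrow> \<alpha> = \<beta>"
  by (rule poly_mapping_eqI)

lemma lookup_unit: "lookup (unit_exponent i) j = (if i = j then 1 else 0)"
  by (simp add: lookup_single when_def)

lemma exponent_induct [case_names zero add]:
  fixes \<alpha> :: "'n::finite exponent"
  assumes "P 0" and "\<And>\<alpha> i. P \<alpha> \<Longrightarrow> P (\<alpha> + unit_exponent i)"
  shows "P \<alpha>"
proof (induction "\<Sum>i\<in>UNIV. lookup \<alpha> i" arbitrary: \<alpha>)
  case 0
  then have "\<alpha> = 0" by (intro exponent_eqI) simp
  then show ?case using assms(1) by simp
next
  case (Suc k)
  then obtain i where i: "lookup \<alpha> i \<noteq> 0"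
    by (metis nat.distinct(1) sum.neutral)
  let ?\<beta> = "\<alpha> - unit_exponent i"
  have \<alpha>: "\<alpha> = ?\<beta> + unit_exponent i"
    by (rule exponent_eqI) (use i in \<open>auto simp: lookup_add lookup_minus lookup_unit\<close>)
  have "Suc k = (\<Sum>j\<in>UNIV. lookup (?\<beta> + unit_exponent i) j)" using Suc(2) \<alpha> by simp
  also have "\<dots> = (\<Sum>j\<in>UNIV. lookup ?\<beta> j) + 1"
    unfolding lookup_add sum.distrib by (simp add: lookup_unit)
  finally have "P ?\<beta>" using Suc(1) by simp
  then show ?case using assms(2) \<alpha> by metis
qed


section \<open>A basis of the Weyl algebra\<close>

definition x_power :: "'n exponent \<Rightarrow> ('n, 'k::field_char_0) operator" where
  "x_power \<alpha> p = monomial \<alpha> * p"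

lemma lin_x_power: "lin (x_power \<alpha>)"
proof (rule linear_operatorI)
  show "x_power \<alpha> (scale c p) = scale c (x_power \<alpha> p)" for c p
    by (simp add: x_power_def scale_def mult_map_scale_conv_mult mult.left_commute)
qed (simp add: x_power_def algebra_simps)

lemma x_power_monomial: "x_power \<alpha> (monomial \<gamma>) = monomial (\<alpha> + \<gamma>)"
  by (simp add: x_power_def mult_single)

lemma x_power_0: "x_power 0 = id"
  by (simp add: fun_eq_iff x_power_def)

lemma x_power_add: "x_power (\<alpha> + \<beta>) = x_power \<alpha> \<circ> x_power \<beta>"
proof (rule linear_operator_eqI[OF lin_x_power lin_comp[OF lin_x_power lin_x_power]])
qed (simp add: x_power_monomial add.assoc)

lemma x_power_unit: "x_power (unit_exponent i) = x_op i"
  by (simp add: fun_eq_iff x_power_def x_op_def)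

text \<open>The product vanishes as soon as \<open>\<beta>\<^sub>i > \<gamma>\<^sub>i\<close> for some \<open>i\<close>, so that truncated differences of
  exponents do no harm below.\<close>

definition falling :: "'n::finite exponent \<Rightarrow> 'n exponent \<Rightarrow> 'k::field_char_0" where
  "falling \<beta> \<gamma> = (\<Prod>i\<in>UNIV. \<Prod>k<lookup \<beta> i. of_nat (lookup \<gamma> i) - of_nat k)"

lemma falling_eq_0_iff: "falling \<beta> \<gamma> = (0 :: 'k::field_char_0) \<longleftrightarrow> (\<exists>i. lookup \<gamma> i < lookup \<beta> i)"
  by (auto simp: falling_def)

lemma falling_unit:
  "falling (\<beta> + unit_exponent i) \<gamma> =
     of_nat (lookup \<gamma> i) * (falling \<beta> (\<gamma> - unit_exponent i) :: 'k::field_char_0)"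
proof -
  let ?g = "\<lambda>\<beta> \<gamma> j. \<Prod>k<lookup \<beta> j. of_nat (lookup \<gamma> j) - of_nat k :: 'k"
  have 1: "?g (\<beta> + unit_exponent i) \<gamma> j = ?g \<beta> (\<gamma> - unit_exponent i) j" if "j \<noteq> i" for j
    using that by (simp add: lookup_add lookup_minus lookup_unit)
  have 2: "?g (\<beta> + unit_exponent i) \<gamma> i = of_nat (lookup \<gamma> i) * ?g \<beta> (\<gamma> - unit_exponent i) i"
  proof (cases "lookup \<gamma> i")
    case 0
    then show ?thesis by (auto simp: lookup_add lookup_unit)
  next
    case (Suc m)
    have "lookup (\<beta> + unit_exponent i) i = Suc (lookup \<beta> i)"
      by (simp add: lookup_add lookup_unit)
    then show ?thesis
      using Suc by (simp add: lookup_minus lookup_unit prod.lessThan_Suc_shift del: prod.lessThan_Suc)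
  qed
  have "falling (\<beta> + unit_exponent i) \<gamma> =
      ?g (\<beta> + unit_exponent i) \<gamma> i * (\<Prod>j\<in>UNIV - {i}. ?g (\<beta> + unit_exponent i) \<gamma> j)"
    unfolding falling_def by (rule prod.remove) auto
  also have "(\<Prod>j\<in>UNIV - {i}. ?g (\<beta> + unit_exponent i) \<gamma> j) =
      (\<Prod>j\<in>UNIV - {i}. ?g \<beta> (\<gamma> - unit_exponent i) j)"
    by (rule prod.cong[OF refl 1]) auto
  also have "?g (\<beta> + unit_exponent i) \<gamma> i * \<dots> = of_nat (lookup \<gamma> i) *
      (?g \<beta> (\<gamma> - unit_exponent i) i * (\<Prod>j\<in>UNIV - {i}. ?g \<beta> (\<gamma> - unit_exponent i) j))"
    unfolding 2 by (simp only: mult.assoc)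
  also have "?g \<beta> (\<gamma> - unit_exponent i) i * (\<Prod>j\<in>UNIV - {i}. ?g \<beta> (\<gamma> - unit_exponent i) j) =
      falling \<beta> (\<gamma> - unit_exponent i)"
    unfolding falling_def by (rule prod.remove[symmetric]) auto
  finally show ?thesis .
qed

text \<open>The iterated derivation, given by its values on monomials so that evaluating it needs no
  induction; \<open>d_power_add_unit\<close> identifies it with the product of the
  \<open>d_op i\<close>.\<close>

definition d_power :: "'n::finite exponent \<Rightarrow> ('n, 'k::field_char_0) operator" where
  "d_power \<beta> = linear_extension (\<lambda>\<gamma>. scale (falling \<beta> \<gamma>) (monomial (\<gamma> - \<beta>)))"

lemma lin_d_power: "lin (d_power \<beta>)"
  unfolding d_power_def by (rule linear_linear_extension)

lemma d_power_monomial: "d_power \<beta> (monomial \<gamma>) = scale (falling \<beta> \<gamma>) (monomial (\<gamma> - \<beta>))"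
  by (simp add: d_power_def)

lemma d_power_0: "d_power 0 = id"
  by (rule linear_operator_eqI[OF lin_d_power lin_id]) (simp add: d_power_monomial falling_def)

lemma d_power_add_unit: "d_power (\<beta> + unit_exponent i) = d_power \<beta> \<circ> d_op i"
proof (rule linear_operator_eqI[OF lin_d_power lin_comp[OF lin_d_power linear_d_op]])
  fix \<gamma> :: "'a exponent"
  have "\<gamma> - (\<beta> + unit_exponent i) = \<gamma> - unit_exponent i - \<beta>"
    by (rule exponent_eqI) (simp add: lookup_minus lookup_add)
  then show "d_power (\<beta> + unit_exponent i) (monomial \<gamma>) = (d_power \<beta> \<circ> d_op i) (monomial \<gamma>)"
    by (simp add: d_power_monomial d_op_monomial lin_app_scale[OF lin_d_power] falling_unit)
qed

lemma d_power_unit: "d_power (unit_exponent i) = d_op i"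
  using d_power_add_unit[of 0 i] by (simp add: d_power_0)

lemma d_op_commute: "d_op i \<circ> d_op j = (d_op j \<circ> d_op i :: ('n::finite, 'k::field_char_0) operator)"
proof (rule linear_operator_eqI)
  fix \<gamma> :: "'n exponent"
  have "\<gamma> - unit_exponent j - unit_exponent i = \<gamma> - unit_exponent i - unit_exponent j"
    by (rule exponent_eqI) (simp add: lookup_minus)
  then show "(d_op i \<circ> d_op j) (monomial \<gamma>) = (d_op j \<circ> d_op i :: ('n, 'k) operator) (monomial \<gamma>)"
    by (cases "i = j") (simp_all add: d_op_monomial lin_app_scale[OF linear_d_op] lookup_minus
        lookup_unit mult.commute)
qed (intro lin_comp linear_d_op)+

lemma d_power_add:
  "d_power (\<beta> + \<delta>) = (d_power \<beta> \<circ> d_power \<delta> :: ('n::finite, 'k::field_char_0) operator)"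
proof (induction \<delta> rule: exponent_induct)
  case zero
  then show ?case by (simp add: d_power_0)
next
  case (add \<delta> i)
  have "d_power (\<beta> + (\<delta> + unit_exponent i)) = (d_power (\<beta> + \<delta>) \<circ> d_op i :: ('n, 'k) operator)"
    by (simp add: d_power_add_unit flip: add.assoc)
  also have "\<dots> = d_power \<beta> \<circ> (d_power \<delta> \<circ> d_op i)"
    by (simp only: add.IH comp_assoc)
  finally show ?case by (simp only: d_power_add_unit)
qed

lemma d_op_x_op:
  "d_op i \<circ> x_op j = ((x_op j \<circ> d_op i) + (if i = j then id else 0) :: ('n::finite, 'k::field_char_0) operator)"
proof (rule linear_operator_eqI)
  fix \<gamma> :: "'n exponent"
  have 1: "\<gamma> + unit_exponent j - unit_exponent i = \<gamma> - unit_exponent i + unit_exponent j" if "i \<noteq> j"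
    by (rule exponent_eqI) (use that in \<open>auto simp: lookup_minus lookup_add lookup_unit\<close>)
  have 2: "\<gamma> - unit_exponent i + unit_exponent i = \<gamma>" if "lookup \<gamma> i \<noteq> 0"
    by (rule exponent_eqI) (use that in \<open>auto simp: lookup_minus lookup_add lookup_unit\<close>)
  show "(d_op i \<circ> x_op j) (monomial \<gamma>) =
      ((x_op j \<circ> d_op i) + (if i = j then id else 0) :: ('n, 'k) operator) (monomial \<gamma>)"
  proof (cases "i = j")
    case True
    then show ?thesis
      using 2 by (cases "lookup \<gamma> i = 0") (simp_all add: d_op_monomial x_op_monomial lookup_add
          lookup_unit lin_app_scale[OF linear_x_op] lin_app_zero[OF linear_x_op] pol.scale_left_distrib
          add.commute)
  next
    case False
    then show ?thesis
      by (simp add: d_op_monomial x_op_monomial lookup_add lookup_unit lin_app_scale[OF linear_x_op] 1)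
  qed
qed (auto intro!: lin_comp linear_d_op linear_x_op lin_add lin_id lin_zero)

lemma comp_add_right: "lin f \<Longrightarrow> f \<circ> (g + h) = (f \<circ> g) + (f \<circ> h)"
  by (auto simp: fun_eq_iff lin_app_add)

lemma comp_add_left: "(f + g) \<circ> h = (f \<circ> h) + (g \<circ> h)"
  by (auto simp: fun_eq_iff)

lemma comp_scale_right: "lin f \<Longrightarrow> f \<circ> (\<lambda>p. scale c (g p)) = (\<lambda>p. scale c ((f \<circ> g) p))"
  by (auto simp: fun_eq_iff lin_app_scale)

lemma comp_scale_left: "(\<lambda>p. scale c (f p)) \<circ> g = (\<lambda>p. scale c ((f \<circ> g) p))"
  by auto

lemma comp_zero_right: "lin f \<Longrightarrow> f \<circ> 0 = 0"
  by (auto simp: fun_eq_iff lin_app_zero)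

lemma comp_zero_left: "0 \<circ> f = 0"
  by (auto simp: fun_eq_iff)

lemma comp_sum_right: "lin f \<Longrightarrow> f \<circ> sum g I = (\<Sum>i\<in>I. f \<circ> g i)"
  by (auto simp: fun_eq_iff sum_fun_app lin_app_sum)

lemma comp_sum_left: "sum g I \<circ> f = (\<Sum>i\<in>I. g i \<circ> f)"
  by (auto simp: fun_eq_iff sum_fun_app)

lemma d_power_x_op:
  "d_power \<beta> \<circ> x_op i = ((x_op i \<circ> d_power \<beta>) +
     (\<lambda>p. scale (of_nat (lookup \<beta> i)) (d_power (\<beta> - unit_exponent i) p))
     :: ('n::finite, 'k::field_char_0) operator)"
proof (induction \<beta> rule: exponent_induct)
  case zero
  then show ?case by (simp add: d_power_0 fun_eq_iff)
next
  case step: (add \<beta> j)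
  have IH: "d_power \<beta> (x_op i q) = x_op i (d_power \<beta> q) +
      scale (of_nat (lookup \<beta> i)) (d_power (\<beta> - unit_exponent i) q)" for q :: "('n, 'k) polynomial"
    using fun_cong[OF step, of q] by simp
  \<comment> \<open>The coefficient of the correction term grows to \<beta>_i + 1 exactly when j =
    i. If \<beta>_i = 0, the truncated exponent is harmless because its coefficient
    vanishes.\<close>
  have *: "scale (of_nat (lookup \<beta> i)) (d_power (\<beta> - unit_exponent i + unit_exponent j) p) +
      (if j = i then d_power \<beta> p else 0) = scale (of_nat (lookup (\<beta> + unit_exponent j) i))
        (d_power (\<beta> + unit_exponent j - unit_exponent i) p)" for p :: "('n, 'k) polynomial"
  proof (cases "j = i")
    case True
    have "\<beta> - unit_exponent i + unit_exponent i = \<beta>" if "lookup \<beta> i \<noteq> 0"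
      by (rule exponent_eqI) (use that in \<open>auto simp: lookup_minus lookup_add lookup_unit\<close>)
    then show ?thesis
      using True by (cases "lookup \<beta> i = 0")
        (simp_all add: lookup_add lookup_unit pol.scale_left_distrib add.commute)
  next
    case False
    have "\<beta> + unit_exponent j - unit_exponent i = \<beta> - unit_exponent i + unit_exponent j"
      by (rule exponent_eqI) (use False in \<open>auto simp: lookup_minus lookup_add lookup_unit\<close>)
    then show ?thesis using False by (simp add: lookup_add lookup_unit)
  qed
  have "d_power (\<beta> + unit_exponent j) \<circ> x_op i =
      (d_power \<beta> \<circ> (d_op j \<circ> x_op i) :: ('n, 'k) operator)"
    by (simp add: d_power_add_unit comp_assoc)
  also have "\<dots> = ((d_power \<beta> \<circ> x_op i) \<circ> d_op j) + (if j = i then d_power \<beta> else 0)"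
    unfolding d_op_x_op comp_add_right[OF lin_d_power] by (simp add: comp_zero_right[OF lin_d_power] comp_assoc)
  also have "\<dots> = (x_op i \<circ> d_power (\<beta> + unit_exponent j)) +
      ((\<lambda>p. scale (of_nat (lookup \<beta> i)) (d_power (\<beta> - unit_exponent i + unit_exponent j) p)) +
      (if j = i then d_power \<beta> else 0))"
    by (rule ext) (simp add: d_power_add_unit IH add.assoc)
  also have "(\<lambda>p :: ('n, 'k) polynomial. scale (of_nat (lookup \<beta> i))
        (d_power (\<beta> - unit_exponent i + unit_exponent j) p)) + (if j = i then d_power \<beta> else 0) =
      (\<lambda>p. scale (of_nat (lookup (\<beta> + unit_exponent j) i))
        (d_power (\<beta> + unit_exponent j - unit_exponent i) p))"
    by (rule ext) (simp add: * if_distrib if_distribR cong: if_cong flip: *)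
  finally show ?case .
qed

definition weyl_monomial :: "'n::finite exponent \<times> 'n exponent \<Rightarrow> ('n, 'k::field_char_0) operator" where
  "weyl_monomial m = x_power (fst m) \<circ> d_power (snd m)"

lemma lin_weyl_monomial: "lin (weyl_monomial m)"
  unfolding weyl_monomial_def by (intro lin_comp lin_x_power lin_d_power)

lemma weyl_monomial_app:
  "weyl_monomial m (monomial \<gamma>) = scale (falling (snd m) \<gamma>) (monomial (fst m + (\<gamma> - snd m)))"
  by (simp add: weyl_monomial_def d_power_monomial lin_app_scale[OF lin_x_power] x_power_monomial)

text \<open>Evaluate at x^\<beta>, where \<beta> is a derivative exponent of least total degree
  among the terms with nonzero coefficient. Any other derivative exponent that occurs exceeds
  \<beta> in some variable and kills x^\<beta>, while terms with the same \<beta> differ in their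
  powers of x. What remains is one coefficient times \<beta>!, which is nonzero in characteristic
  zero.\<close>

lemma weyl_monomials_independent_family:
  fixes u :: "'n::finite exponent \<times> 'n exponent \<Rightarrow> 'k::field_char_0"
  assumes I: "finite I" and zero: "(\<Sum>m\<in>I. (\<lambda>p. scale (u m) (weyl_monomial m p))) = 0"
  shows "\<forall>m\<in>I. u m = 0"
proof (rule ccontr)
  assume "\<not> ?thesis"
  then have ne: "{m\<in>I. u m \<noteq> 0} \<noteq> {}" by auto
  let ?d = "\<lambda>m :: 'n exponent \<times> 'n exponent. \<Sum>i\<in>UNIV. lookup (snd m) i"
  obtain m0 where m0: "m0 \<in> I" "u m0 \<noteq> 0" and
    min: "\<And>m. \<lbrakk>m \<in> I; u m \<noteq> 0\<rbrakk> \<Longrightarrow> ?d m0 \<le> ?d m"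
    using ex_is_arg_min_if_finite[OF _ ne, of ?d] I unfolding is_arg_min_linorder by auto
  let ?\<beta> = "snd m0"
  have term_zero: "u m * (falling (snd m) ?\<beta> * lookup (monomial (fst m + (?\<beta> - snd m))) (fst m0)) = 0"
    if m: "m \<in> I - {m0}" for m
  proof (cases "u m = 0")
    case False
    show ?thesis
    proof (cases "snd m = ?\<beta>")
      case True
      then have "fst m \<noteq> fst m0" using m by (auto simp: prod_eq_iff)
      then show ?thesis using True by (simp add: lookup_monomial)
    next
      case neq: False
      have "\<exists>i. lookup ?\<beta> i < lookup (snd m) i"
      proof (rule ccontr)
        assume "\<not> ?thesis"
        then have le: "\<And>i. lookup (snd m) i \<le> lookup ?\<beta> i" by (simp add: not_less)
        obtain j where "lookup (snd m) j \<noteq> lookup ?\<beta> j" using neq exponent_eqI[of "snd m" ?\<beta>] by blast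
        with le have "lookup (snd m) j < lookup ?\<beta> j" by (simp add: le_neq_implies_less)
        then have "?d m < ?d m0" by (intro sum_strict_mono_ex1) (use le in auto)
        then show False using min[of m] m False by auto
      qed
      then have "falling (snd m) ?\<beta> = (0 :: 'k)" by (simp add: falling_eq_0_iff)
      then show ?thesis by simp
    qed
  qed simp
  have "0 = lookup ((\<Sum>m\<in>I. (\<lambda>p. scale (u m) (weyl_monomial m p))) (monomial ?\<beta>)) (fst m0)"
    unfolding zero by simp
  also have "\<dots> = (\<Sum>m\<in>I. u m * (falling (snd m) ?\<beta> *
      lookup (monomial (fst m + (?\<beta> - snd m))) (fst m0)))"
    unfolding sum_fun_app lookup_sum lookup_scale weyl_monomial_app ..
  also have "\<dots> = u m0 * (falling ?\<beta> ?\<beta> * lookup (monomial (fst m0 + (?\<beta> - ?\<beta>))) (fst m0))"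
    by (subst sum.remove[OF I m0(1)]) (simp add: sum.neutral term_zero)
  also have "\<dots> = u m0 * falling ?\<beta> ?\<beta>" by (simp add: lookup_monomial)
  finally have "falling ?\<beta> ?\<beta> = (0 :: 'k)" using m0(2) by simp
  then show False by (simp add: falling_eq_0_iff)
qed

lemma inj_weyl_monomial:
  "inj (weyl_monomial :: 'n::finite exponent \<times> 'n exponent \<Rightarrow> ('n, 'k::field_char_0) operator)"
proof (rule injI, rule ccontr)
  fix m m' :: "'n exponent \<times> 'n exponent"
  assume eq: "weyl_monomial m = (weyl_monomial m' :: ('n, 'k) operator)" and neq: "m \<noteq> m'"
  define u where "u = (\<lambda>k. if k = m then 1 else - 1 :: 'k)"
  have "(\<Sum>k\<in>{m, m'}. (\<lambda>p. scale (u k) (weyl_monomial k p))) = (0 :: ('n, 'k) operator)"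
    using neq eq by (simp add: u_def fun_eq_iff)
  from weyl_monomials_independent_family[OF _ this] show False by (simp add: u_def)
qed

lemma weyl_monomials_independent: "op.independent (range weyl_monomial :: ('n::finite, 'k::field_char_0) operator set)"
  unfolding op.independent_explicit_module
proof (intro allI impI)
  fix t :: "('n, 'k) operator set" and u v
  assume t: "finite t" "t \<subseteq> range weyl_monomial" "(\<Sum>v\<in>t. (\<lambda>p. scale (u v) (v p))) = 0" "v \<in> t"
  obtain I where I: "finite I" "t = weyl_monomial ` I"
    using finite_subset_image[OF t(1,2)] by blast
  have inj: "inj_on weyl_monomial I" using inj_weyl_monomial by (rule inj_on_subset) simp
  have "(\<Sum>m\<in>I. (\<lambda>p. scale (u (weyl_monomial m)) (weyl_monomial m p))) = 0"
    using t(3) sum.reindex[OF inj, of "\<lambda>v p. scale (u v) (v p)"] by (simp add: I(2) comp_def)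
  from weyl_monomials_independent_family[OF I(1) this] show "u v = 0" using t(4) I(2) by auto
qed

section \<open>The Weyl algebra is a left Ore domain\<close>

lemma op_span_image:
  fixes T :: "('n, 'k::field_char_0) operator \<Rightarrow> ('n, 'k) operator"
  assumes "f \<in> op.span B" "T 0 = 0" "\<And>f g. T (f + g) = T f + T g"
    "\<And>c f. T (\<lambda>p. scale c (f p)) = (\<lambda>p. scale c (T f p))"
    "\<And>b. b \<in> B \<Longrightarrow> T b \<in> op.span C"
  shows "T f \<in> op.span C"
  using assms(1)
proof (induction rule: op.span_induct_alt)
  case base
  then show ?case by (simp only: assms(2) op.span_zero)
next
  case (step c x y)
  show ?case
    unfolding assms(3,4) by (intro op.span_add op.span_scale assms(5) step)
qed

lemma comp_span_left:
  assumes "f \<in> op.span B" "\<And>b. b \<in> B \<Longrightarrow> b \<circ> g \<in> op.span C"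
  shows "f \<circ> g \<in> op.span C"
  by (rule op_span_image[where T = "\<lambda>f. f \<circ> g",
        OF assms(1) comp_zero_left comp_add_left comp_scale_left assms(2)])

lemma comp_span_right:
  assumes "f \<in> op.span B" "\<And>b. b \<in> B \<Longrightarrow> g \<circ> b \<in> op.span C" "lin g"
  shows "g \<circ> f \<in> op.span C"
  by (rule op_span_image[where T = "\<lambda>f. g \<circ> f", OF assms(1) comp_zero_right[OF assms(3)]
        comp_add_right[OF assms(3)] comp_scale_right[OF assms(3)] assms(2)])

lemma span_monoD: "f \<in> op.span B \<Longrightarrow> B \<subseteq> C \<Longrightarrow> f \<in> op.span C"
  using op.span_mono by blast

type_synonym 'n exponents = "'n exponent \<times> 'n exponent"

definition madd :: "'n exponents \<Rightarrow> 'n exponents \<Rightarrow> 'n exponents" where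
  "madd m m' = (fst m + fst m', snd m + snd m')"

definition mle :: "'n exponents \<Rightarrow> 'n exponents \<Rightarrow> bool" where
  "mle m m' \<longleftrightarrow> (\<forall>i. lookup (fst m) i \<le> lookup (fst m') i \<and> lookup (snd m) i \<le> lookup (snd m') i)"

lemma mle_trans: "mle a b \<Longrightarrow> mle b c \<Longrightarrow> mle a c"
  unfolding mle_def using order_trans by blast

lemma mle_refl: "mle a a"
  by (simp add: mle_def)

lemma mle_antisym: "mle a b \<Longrightarrow> mle b a \<Longrightarrow> a = b"
  unfolding mle_def by (intro prod_eqI exponent_eqI) (auto intro: antisym)

lemma mle_madd: "mle a b \<Longrightarrow> mle (madd a c) (madd b c)"
  by (simp add: mle_def madd_def lookup_add)

lemma madd_cancel: "madd a c = madd b c \<longleftrightarrow> a = b"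
  by (auto simp: madd_def prod_eq_iff)

definition lower :: "'n::finite exponents \<Rightarrow> ('n, 'k::field_char_0) operator set" where
  "lower m = weyl_monomial ` {m'. mle m' m \<and> m' \<noteq> m}"

lemma lower_mono: "mle m' m \<Longrightarrow> lower m' \<subseteq> lower m"
  unfolding lower_def using mle_trans mle_antisym by blast

text \<open>Quantifying over all left factors \<open>m\<close> makes this compatible with composition.\<close>

definition leading :: "('n::finite, 'k::field_char_0) operator \<Rightarrow> 'n exponents \<Rightarrow> bool" where
  "leading g s \<longleftrightarrow> (\<forall>m. (weyl_monomial m \<circ> g) - weyl_monomial (madd m s) \<in> op.span (lower (madd m s)))"

lemma leading_lower:
  assumes "leading g s" "f \<in> op.span (lower m)"
  shows "f \<circ> g \<in> op.span (lower (madd m s))"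
  using assms(2)
proof (rule comp_span_left)
  fix b :: "('a, 'b) operator" assume "b \<in> lower m"
  then obtain m' where m': "mle m' m" "m' \<noteq> m" "b = weyl_monomial m'" unfolding lower_def by blast
  have le: "mle (madd m' s) (madd m s)" using mle_madd m' by blast
  have "(b \<circ> g) - weyl_monomial (madd m' s) \<in> op.span (lower (madd m' s))"
    using assms(1) m' unfolding leading_def by blast
  then have 1: "(b \<circ> g) - weyl_monomial (madd m' s) \<in> op.span (lower (madd m s))"
    by (rule span_monoD) (rule lower_mono[OF le])
  have "weyl_monomial (madd m' s) \<in> lower (madd m s)"
    unfolding lower_def using le m' madd_cancel by blast
  then have 2: "weyl_monomial (madd m' s) \<in> op.span (lower (madd m s))" by (rule op.span_base)
  show "b \<circ> g \<in> op.span (lower (madd m s))"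
    using op.span_add[OF 1 2] by simp
qed

text \<open>The monomial m followed by g is m + s plus lower terms. Then h shifts the leading
  exponent by t, and \<open>leading_lower\<close> keeps the lower terms below it.\<close>

lemma leading_comp:
  assumes "leading g s" "leading h t"
  shows "leading (g \<circ> h) (madd s t)"
  unfolding leading_def
proof
  fix m
  have e: "madd m (madd s t) = madd (madd m s) t" by (simp add: madd_def add.assoc)
  let ?f = "(weyl_monomial m \<circ> g) - weyl_monomial (madd m s)"
  have "?f \<circ> h \<in> op.span (lower (madd (madd m s) t))"
    by (rule leading_lower[OF assms(2)]) (use assms(1) in \<open>unfold leading_def, blast\<close>)
  moreover have "(weyl_monomial (madd m s) \<circ> h) - weyl_monomial (madd (madd m s) t)
      \<in> op.span (lower (madd (madd m s) t))"
    using assms(2) unfolding leading_def by blast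
  ultimately have "(?f \<circ> h) + ((weyl_monomial (madd m s) \<circ> h) - weyl_monomial (madd (madd m s) t))
      \<in> op.span (lower (madd (madd m s) t))" by (rule op.span_add)
  also have "(?f \<circ> h) + ((weyl_monomial (madd m s) \<circ> h) - weyl_monomial (madd (madd m s) t)) =
      (weyl_monomial m \<circ> (g \<circ> h)) - weyl_monomial (madd (madd m s) t)"
    by (auto simp: fun_eq_iff)
  finally show "(weyl_monomial m \<circ> (g \<circ> h)) - weyl_monomial (madd m (madd s t))
      \<in> op.span (lower (madd m (madd s t)))" unfolding e .
qed

lemma leading_id: "leading id (0, 0)"
  unfolding leading_def by (simp add: madd_def op.span_zero)

lemma leading_d_op: "leading (d_op i :: ('n::finite, 'k::field_char_0) operator) (0, unit_exponent i)"
  unfolding leading_def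
proof
  fix m :: "'n exponents"
  have "weyl_monomial m \<circ> d_op i = (weyl_monomial (madd m (0, unit_exponent i)) :: ('n, 'k) operator)"
    by (simp add: weyl_monomial_def madd_def d_power_add_unit comp_assoc)
  then show "(weyl_monomial m \<circ> d_op i) - weyl_monomial (madd m (0, unit_exponent i))
      \<in> op.span (lower (madd m (0, unit_exponent i)) :: ('n, 'k) operator set)"
    by (simp add: op.span_zero)
qed

lemma leading_x_op: "leading (x_op i :: ('n::finite, 'k::field_char_0) operator) (unit_exponent i, 0)"
  unfolding leading_def
proof
  fix m :: "'n exponents"
  let ?m = "madd m (unit_exponent i, 0)"
  let ?m' = "(fst m, snd m - unit_exponent i)"
  have "weyl_monomial m \<circ> x_op i = (x_power (fst m) \<circ> (d_power (snd m) \<circ> x_op i) :: ('n, 'k) operator)"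
    by (simp add: weyl_monomial_def comp_assoc)
  also have "\<dots> = weyl_monomial ?m + (\<lambda>p. scale (of_nat (lookup (snd m) i)) (weyl_monomial ?m' p))"
    unfolding d_power_x_op comp_add_right[OF lin_x_power] comp_scale_right[OF lin_x_power]
    by (simp add: weyl_monomial_def madd_def x_power_add x_power_unit comp_assoc)
  finally have "(weyl_monomial m \<circ> x_op i) - weyl_monomial ?m =
      ((\<lambda>p. scale (of_nat (lookup (snd m) i)) (weyl_monomial ?m' p)) :: ('n, 'k) operator)"
    by simp
  moreover have "weyl_monomial ?m' \<in> (lower ?m :: ('n, 'k) operator set)"
  proof -
    have "mle ?m' ?m" by (simp add: mle_def madd_def lookup_add lookup_minus)
    \<comment> \<open>Strictness shows in the x-exponent, which is smaller than in \<open>?m\<close>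
      even when the truncated difference leaves the derivative exponent unchanged.\<close>
    moreover have "lookup (fst ?m') i \<noteq> lookup (fst ?m) i"
      by (simp add: madd_def lookup_add lookup_unit)
    then have "?m' \<noteq> ?m" by metis
    ultimately show ?thesis unfolding lower_def by blast
  qed
  ultimately show "(weyl_monomial m \<circ> x_op i) - weyl_monomial ?m
      \<in> op.span (lower ?m :: ('n, 'k) operator set)"
    using op.span_scale[OF op.span_base] by simp
qed

lemma leading_weyl_monomial: "leading (weyl_monomial m :: ('n::finite, 'k::field_char_0) operator) m"
proof -
  have x: "leading (x_power \<alpha> :: ('n, 'k) operator) (\<alpha>, 0)" for \<alpha>
  proof (induction \<alpha> rule: exponent_induct)
    case zero
    then show ?case unfolding x_power_0 by (rule leading_id)
  next
    case step: (add \<alpha> i)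
    have "madd (\<alpha>, 0) (unit_exponent i, 0) = (\<alpha> + unit_exponent i, 0)" by (simp add: madd_def)
    then show ?case
      using leading_comp[OF step leading_x_op[of i]] by (simp only: x_power_add x_power_unit)
  qed
  have d: "leading (d_power \<beta> :: ('n, 'k) operator) (0, \<beta>)" for \<beta>
  proof (induction \<beta> rule: exponent_induct)
    case zero
    then show ?case unfolding d_power_0 by (rule leading_id)
  next
    case step: (add \<beta> i)
    have "madd (0, \<beta>) (0, unit_exponent i) = (0, \<beta> + unit_exponent i)" by (simp add: madd_def)
    then show ?case
      using leading_comp[OF step leading_d_op[of i]] by (simp only: d_power_add_unit)
  qed
  have "madd (fst m, 0) (0, snd m) = m" by (simp add: madd_def)
  then show ?thesis using leading_comp[OF x d, of "fst m" "snd m"] by (simp only: weyl_monomial_def)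
qed

text \<open>This plays the part of the commutative associated graded ring; the domain property and
  the dimension count both rest on it.\<close>

lemma weyl_monomial_comp:
  "(weyl_monomial m \<circ> weyl_monomial m') - weyl_monomial (madd m m') \<in> op.span (lower (madd m m'))"
  using leading_weyl_monomial unfolding leading_def by blast

lemma weyl_monomial_comp_span:
  "weyl_monomial m \<circ> weyl_monomial m' \<in> op.span (weyl_monomial ` {k. mle k (madd m m')})"
proof -
  let ?S = "op.span (weyl_monomial ` {k. mle k (madd m m')})"
  have "(weyl_monomial m \<circ> weyl_monomial m') - weyl_monomial (madd m m') \<in> ?S"
    using weyl_monomial_comp by (rule span_monoD) (auto simp: lower_def)
  moreover have "weyl_monomial (madd m m') \<in> ?S"
    by (rule op.span_base) (auto simp: mle_refl)
  ultimately have "((weyl_monomial m \<circ> weyl_monomial m') - weyl_monomial (madd m m')) +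
    weyl_monomial (madd m m') \<in> ?S" by (rule op.span_add)
  then show ?thesis by simp
qed

definition weyl_span :: "('n::finite, 'k::field_char_0) operator set" where
  "weyl_span = op.span (range weyl_monomial)"

lemma lin_weyl_span: "a \<in> weyl_span \<Longrightarrow> lin a"
  unfolding weyl_span_def
proof (induction rule: op.span_induct_alt)
  case base
  then show ?case by (rule lin_zero)
next
  case (step c x y)
  then show ?case by (intro lin_add lin_scale_op) (auto intro: lin_weyl_monomial)
qed

lemma weyl_span_comp:
  assumes "a \<in> weyl_span" "b \<in> weyl_span"
  shows "a \<circ> b \<in> weyl_span"
  unfolding weyl_span_def
proof (rule comp_span_left[OF assms(1)[unfolded weyl_span_def]])
  fix f :: "('a, 'b) operator" assume "f \<in> range weyl_monomial"
  then obtain m where m: "f = weyl_monomial m" by blast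
  show "f \<circ> b \<in> op.span (range weyl_monomial)"
  proof (rule comp_span_right[OF assms(2)[unfolded weyl_span_def]])
    fix g :: "('a, 'b) operator" assume "g \<in> range weyl_monomial"
    then obtain m' where "g = weyl_monomial m'" by blast
    then show "f \<circ> g \<in> op.span (range weyl_monomial)"
      using weyl_monomial_comp_span[of m m'] m span_monoD by blast
  qed (simp add: m lin_weyl_monomial)
qed

definition combination ::
  "('n::finite exponents \<Rightarrow> 'k::field_char_0) \<Rightarrow> 'n exponents set \<Rightarrow> ('n, 'k) operator" where
  "combination u I = (\<Sum>m\<in>I. (\<lambda>p. scale (u m) (weyl_monomial m p)))"

lemma combination_span: "combination u I \<in> op.span (weyl_monomial ` I)"
  unfolding combination_def by (intro op.span_sum op.span_scale op.span_base imageI)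

lemma combination_weyl: "combination u I \<in> weyl_span"
  unfolding weyl_span_def using combination_span by (rule span_monoD) auto

lemma weyl_spanE:
  assumes "a \<in> weyl_span"
  obtains I u where "finite I" "a = combination u I" "\<forall>m\<in>I. u m \<noteq> 0"
proof -
  obtain t r where t: "finite t" "t \<subseteq> range weyl_monomial" "a = (\<Sum>v\<in>t. (\<lambda>p. scale (r v) (v p)))"
    using assms unfolding weyl_span_def op.span_explicit by blast
  obtain I where I: "finite I" "t = weyl_monomial ` I"
    using finite_subset_image[OF t(1,2)] by blast
  have inj: "inj_on weyl_monomial I" using inj_weyl_monomial by (rule inj_on_subset) simp
  have "a = combination (\<lambda>m. r (weyl_monomial m)) I"
    using t(3) sum.reindex[OF inj, of "\<lambda>v p. scale (r v) (v p)"]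
    by (simp add: I(2) comp_def combination_def)
  also have "\<dots> = combination (\<lambda>m. r (weyl_monomial m)) {m\<in>I. r (weyl_monomial m) \<noteq> 0}"
    unfolding combination_def by (rule sum.mono_neutral_right) (auto simp: I fun_eq_iff)
  finally show thesis
    using that[of "{m\<in>I. r (weyl_monomial m) \<noteq> 0}"] I by auto
qed

section \<open>Weights on exponents and the absence of zero divisors\<close>

definition weight :: "('n \<Rightarrow> nat) \<Rightarrow> ('n \<Rightarrow> nat) \<Rightarrow> 'n::finite exponents \<Rightarrow> nat" where
  "weight w w' m = (\<Sum>i\<in>UNIV. w i * lookup (fst m) i + w' i * lookup (snd m) i)"

lemma weight_madd: "weight w w' (madd m m') = weight w w' m + weight w w' m'"
  by (simp add: weight_def madd_def lookup_add algebra_simps sum.distrib)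

lemma weight_less:
  assumes "\<And>i. 0 < w i" "\<And>i. 0 < w' i" "mle m m'" "m \<noteq> m'"
  shows "weight w w' m < weight w w' m'"
proof -
  obtain i where i: "lookup (fst m) i \<noteq> lookup (fst m') i \<or> lookup (snd m) i \<noteq> lookup (snd m') i"
    using assms(4) exponent_eqI[of "fst m" "fst m'"] exponent_eqI[of "snd m" "snd m'"]
    by (auto simp: prod_eq_iff)
  have "w i * lookup (fst m) i + w' i * lookup (snd m) i <
      w i * lookup (fst m') i + w' i * lookup (snd m') i"
  proof -
    have le: "lookup (fst m) i \<le> lookup (fst m') i" "lookup (snd m) i \<le> lookup (snd m') i"
      using assms(3) unfolding mle_def by auto
    then have "w i * lookup (fst m) i \<le> w i * lookup (fst m') i"
      "w' i * lookup (snd m) i \<le> w' i * lookup (snd m') i" by simp_all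
    moreover have "w i * lookup (fst m) i \<noteq> w i * lookup (fst m') i \<or>
        w' i * lookup (snd m) i \<noteq> w' i * lookup (snd m') i"
      using i assms(1)[of i] assms(2)[of i] by auto
    ultimately show ?thesis by linarith
  qed
  then show ?thesis
    unfolding weight_def using assms(3)
    by (intro sum_strict_mono_ex1) (auto simp: mle_def intro!: add_mono mult_le_mono2)
qed

text \<open>Two different monomials have the same weight for only finitely many values of the
  parameter \<open>t\<close> in the weights \<open>t\<^sup>e\<close>.\<close>

lemma separating_weights:
  fixes S :: "'n::finite exponents set"
  assumes "finite S"
  obtains w w' where "\<And>i. 0 < w i" "\<And>i. 0 < w' i" "inj_on (weight w w') S"
proof -
  obtain e :: "'n \<Rightarrow> nat" and N where e: "inj e" "range e = {..<N}"
    using finite_imp_inj_to_nat_seg[of "UNIV :: 'n set"] by (auto simp: lessThan_def)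
  \<comment> \<open>\<open>P m\<close> stores the exponents of m as coefficients, those of x in
    degrees below N and those of the derivations from N on. So it determines m, and its value at t
    is the weight of m for the weights t^e.\<close>
  define P where "P m = (\<Sum>i\<in>UNIV. monom (int (lookup (fst m) i)) (e i) +
      monom (int (lookup (snd m) i)) (N + e i))" for m :: "'n exponents"
  have eN: "e i < N" for i using e(2) by auto
  have coeff1: "coeff (P m) (e i) = int (lookup (fst m) i)" for m i
  proof -
    have "coeff (P m) (e i) = (\<Sum>j\<in>UNIV. if j = i then int (lookup (fst m) j) else 0)"
      unfolding P_def coeff_sum coeff_add coeff_monom using e(1) eN[of i]
      by (intro sum.cong) (auto dest: injD)
    then show ?thesis by simp
  qed
  have coeff2: "coeff (P m) (N + e i) = int (lookup (snd m) i)" for m i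
  proof -
    have "e j \<noteq> N + e i" for j using eN[of j] by simp
    then have "coeff (P m) (N + e i) = (\<Sum>j\<in>UNIV. if j = i then int (lookup (snd m) j) else 0)"
      unfolding P_def coeff_sum coeff_add coeff_monom using e(1)
      by (intro sum.cong) (auto dest: injD)
    then show ?thesis by simp
  qed
  have inj: "m = m'" if "P m = P m'" for m m'
    using coeff1[of m] coeff1[of m'] coeff2[of m] coeff2[of m'] that
    by (intro prod_eqI exponent_eqI) (metis of_nat_eq_iff)+
  define Z where "Z = (\<Union>(m, m') \<in> S \<times> S - Id. {z. poly (P m - P m') z = 0})"
  have "finite Z"
    unfolding Z_def
  proof (rule finite_UN_I)
    fix q assume q: "q \<in> S \<times> S - Id"
    then have "P (fst q) - P (snd q) \<noteq> 0" using inj[of "fst q" "snd q"] by auto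
    from poly_roots_finite[OF this]
    show "finite (case q of (m, m') \<Rightarrow> {z. poly (P m - P m') z = 0})"
      by (simp add: case_prod_beta)
  qed (use assms in simp)
  moreover have "infinite (int ` {1..})"
    by (simp add: finite_image_iff infinite_Ici)
  ultimately have "\<not> int ` {1..} \<subseteq> Z" using finite_subset by blast
  \<comment> \<open>Finitely many roots are to be avoided among infinitely many candidates; t \<ge>
    1 makes the weights positive.\<close>
  then obtain t where t: "1 \<le> t" "int t \<notin> Z" by auto
  define w where "w i = t ^ e i" for i
  define w' where "w' i = t ^ (N + e i)" for i
  have poly: "poly (P m) (int t) = int (weight w w' m)" for m
    by (simp add: P_def poly_sum poly_monom weight_def w_def w'_def mult.commute)
  have "inj_on (weight w w') S"
  proof (rule inj_onI)
    fix m m' assume m: "m \<in> S" "m' \<in> S" "weight w w' m = weight w w' m'"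
    then have "poly (P m - P m') (int t) = 0" by (simp add: poly)
    then show "m = m'" using t(2) m unfolding Z_def by auto
  qed
  moreover have "0 < w i" "0 < w' i" for i using t(1) by (auto simp: w_def w'_def)
  ultimately show thesis using that by blast
qed

lemma weyl_monomial_notin_span:
  assumes "m \<notin> I"
  shows "weyl_monomial m \<notin> op.span (weyl_monomial ` I :: ('n::finite, 'k::field_char_0) operator set)"
proof
  assume "weyl_monomial m \<in> op.span (weyl_monomial ` I :: ('n, 'k) operator set)"
  moreover have "weyl_monomial ` I \<subseteq> range weyl_monomial - {weyl_monomial m :: ('n, 'k) operator}"
    using assms inj_weyl_monomial[where ?'n = 'n and ?'k = 'k] by (auto dest: injD)
  ultimately have "weyl_monomial m \<in> op.span (range weyl_monomial - {weyl_monomial m :: ('n, 'k) operator})"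
    by (rule span_monoD)
  then show False
    using weyl_monomials_independent[where ?'n = 'n and ?'k = 'k] unfolding op.dependent_def by blast
qed

text \<open>A weight without ties gives each factor a single heaviest monomial, and (m, l) is the
  only pair whose product reaches weight \<open>?N\<close>. All other contributions are lighter, so
  a vanishing product would put the monomial m + l into the span of lighter ones, against
  independence.\<close>

theorem weyl_span_domain:
  fixes a b :: "('n::finite, 'k::field_char_0) operator"
  assumes a: "a \<in> weyl_span" and b: "b \<in> weyl_span" and ab: "a \<circ> b = 0"
  shows "a = 0 \<or> b = 0"
proof (rule ccontr)
  assume neg: "\<not> ?thesis"
  obtain I u where I: "finite I" "a = combination u I" "\<forall>m\<in>I. u m \<noteq> 0"
    by (rule weyl_spanE[OF a])
  obtain J v where J: "finite J" "b = combination v J" "\<forall>m\<in>J. v m \<noteq> 0"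
    by (rule weyl_spanE[OF b])
  have ne: "I \<noteq> {}" "J \<noteq> {}" using neg I J by (auto simp: combination_def)
  \<comment> \<open>A single weight has to separate the monomials of both factors.\<close>
  obtain w w' where w: "\<And>i. 0 < w i" "\<And>i. 0 < w' i" "inj_on (weight w w') (I \<union> J)"
    using separating_weights[of "I \<union> J"] I J by auto
  let ?W = "weight w w'"
  have max: "\<exists>m\<in>I. \<forall>k\<in>I. ?W k \<le> ?W m" if "finite I" "I \<noteq> {}" for I
    using obtains_MAX[OF that, of ?W] that(1) by (metis Max_ge finite_imageI imageI)
  obtain m where m: "m \<in> I" "\<And>k. k \<in> I \<Longrightarrow> ?W k \<le> ?W m" using max[OF I(1) ne(1)] by blast
  obtain l where l: "l \<in> J" "\<And>k. k \<in> J \<Longrightarrow> ?W k \<le> ?W l"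
    using max[OF J(1) ne(2)] by blast
  have mI: "?W k < ?W m" if "k \<in> I" "k \<noteq> m" for k
    using m that w(3) by (metis UnI1 inj_onD le_neq_implies_less)
  have lJ: "?W k < ?W l" if "k \<in> J" "k \<noteq> l" for k
    using l that w(3) by (metis UnI2 inj_onD le_neq_implies_less)
  let ?N = "?W m + ?W l"
  let ?S = "op.span (weyl_monomial ` {k. ?W k < ?N}) :: ('n, 'k) operator set"
  have lower_S: "op.span (lower k) \<subseteq> ?S" if "?W k \<le> ?N" for k
  proof (rule op.span_mono)
    show "lower k \<subseteq> weyl_monomial ` {k. ?W k < ?N}"
      unfolding lower_def using weight_less[of w w', OF w(1,2)] that by fastforce
  qed
  have top: "(weyl_monomial m \<circ> weyl_monomial l) - weyl_monomial (madd m l) \<in> ?S"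
    by (rule subsetD[OF lower_S weyl_monomial_comp]) (simp add: weight_madd)
  have rest: "weyl_monomial k \<circ> weyl_monomial k' \<in> ?S"
    if "(k, k') \<in> I \<times> J - {(m, l)}" for k k'
  proof -
    have less: "?W (madd k k') < ?N"
    proof (cases "k = m")
      case True
      then show ?thesis using that lJ by (auto simp: weight_madd)
    next
      case False
      then show ?thesis using that mI[of k] l(2)[of k'] by (auto simp: weight_madd)
    qed
    have "?W j < ?N" if "mle j (madd k k')" for j
      using that less weight_less[of w w', OF w(1,2)] by (cases "j = madd k k'") fastforce+
    then show ?thesis
      by (intro span_monoD[OF weyl_monomial_comp_span]) auto
  qed
  have "a \<circ> b = (\<Sum>k\<in>I. \<Sum>k'\<in>J. (\<lambda>p. scale (u k * v k') ((weyl_monomial k \<circ> weyl_monomial k') p)))"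
    unfolding I(2) J(2) combination_def comp_sum_left comp_scale_left
    by (simp add: comp_sum_right lin_weyl_monomial fun_eq_iff sum_fun_app pol.scale_sum_right
        lin_app_sum[OF lin_weyl_monomial] lin_app_scale[OF lin_weyl_monomial])
  also have "\<dots> = (\<Sum>(k, k')\<in>I \<times> J. (\<lambda>p. scale (u k * v k') ((weyl_monomial k \<circ> weyl_monomial k') p)))"
    by (rule sum.cartesian_product)
  also have "\<dots> = (\<lambda>p. scale (u m * v l) ((weyl_monomial m \<circ> weyl_monomial l) p)) +
      (\<Sum>(k, k')\<in>I \<times> J - {(m, l)}. (\<lambda>p. scale (u k * v k') ((weyl_monomial k \<circ> weyl_monomial k') p)))"
    (is "_ = ?top + ?rest")
    by (subst sum.remove[of _ "(m, l)"]) (use I J m l in auto)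
  finally have "?top = - ?rest" using ab by (simp add: eq_neg_iff_add_eq_0)
  moreover have "?rest \<in> ?S"
  proof (rule op.span_sum)
    fix q assume q: "q \<in> I \<times> J - {(m, l)}"
    obtain k k' where kk: "q = (k, k')" using prod.exhaust by blast
    show "(case q of (k, k') \<Rightarrow>
        (\<lambda>p. scale (u k * v k') ((weyl_monomial k \<circ> weyl_monomial k') p))) \<in> ?S"
      unfolding kk prod.case by (rule op.span_scale[OF rest[OF q[unfolded kk]]])
  qed
  ultimately have "?top \<in> ?S" using op.span_neg by simp
  then have "(\<lambda>p. scale (inverse (u m * v l)) (?top p)) \<in> ?S" by (rule op.span_scale)
  moreover have "inverse (u m * v l) * (u m * v l) = 1"
    by (rule left_inverse) (use I(3) m(1) J(3) l(1) in simp)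
  then have "(\<lambda>p. scale (inverse (u m * v l)) (?top p)) = weyl_monomial m \<circ> weyl_monomial l"
    by (simp only: pol.scale_scale pol.scale_one)
  ultimately have "weyl_monomial m \<circ> weyl_monomial l \<in> ?S" by (simp only:)
  from op.span_diff[OF this top] have "weyl_monomial (madd m l) \<in> ?S" by simp
  then show False using weyl_monomial_notin_span[of "madd m l" "{k. ?W k < ?N}", where ?'k = 'k] by (simp add: weight_madd)
qed

text \<open>The relation is indexed by \<open>I\<close> and not by the set of values, because
  multiples of a may coincide with multiples of b; a repeated value gives the relation with
  coefficients 1 and -1.\<close>

lemma linear_relation:
  fixes v :: "'i \<Rightarrow> ('n, 'k::field_char_0) operator"
  assumes "finite I" "finite B" "card B < card I" "\<And>i. i \<in> I \<Longrightarrow> v i \<in> op.span B"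
  obtains u where "(\<Sum>i\<in>I. (\<lambda>p. scale (u i) (v i p))) = 0" "\<exists>i\<in>I. u i \<noteq> 0"
proof (cases "inj_on v I")
  case True
  have "op.dependent (v ` I)"
  proof (rule ccontr)
    assume "op.independent (v ` I)"
    moreover have "v ` I \<subseteq> op.span B" using assms(4) by blast
    ultimately have "card (v ` I) \<le> card B"
      using op.independent_span_bound[OF assms(2)] by blast
    then show False using assms(3) True by (simp add: card_image)
  qed
  then obtain r where r: "\<exists>w\<in>v ` I. r w \<noteq> 0" "(\<Sum>w\<in>v ` I. (\<lambda>p. scale (r w) (w p))) = 0"
    using op.dependent_finite[of "v ` I"] assms(1) by blast
  then have "(\<Sum>i\<in>I. (\<lambda>p. scale (r (v i)) (v i p))) = 0"
    using sum.reindex[OF True, of "\<lambda>w p. scale (r w) (w p)"] by (simp add: comp_def)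
  then show thesis using r(1) that[of "\<lambda>i. r (v i)"] by blast
next
  case False
  then obtain i j where ij: "i \<in> I" "j \<in> I" "i \<noteq> j" "v i = v j" by (auto simp: inj_on_def)
  define u where "u k = (if k = i then 1 else if k = j then - 1 else 0 :: 'k)" for k
  have "(\<Sum>k\<in>I. (\<lambda>p. scale (u k) (v k p))) = (\<Sum>k\<in>{i, j}. (\<lambda>p. scale (u k) (v k p)))"
    using assms(1) ij by (intro sum.mono_neutral_right) (auto simp: u_def fun_eq_iff)
  also have "\<dots> = 0" using ij by (simp add: u_def fun_eq_iff)
  finally have "(\<Sum>k\<in>I. (\<lambda>p. scale (u k) (v k p))) = 0" .
  moreover have "u i \<noteq> 0" by (simp add: u_def)
  ultimately show thesis using ij(1) that by blast
qed

section \<open>Dimension count for the Ore condition\<close>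

definition box :: "nat \<Rightarrow> 'n::finite exponents set" where
  "box N = {m. \<forall>i. lookup (fst m) i \<le> N \<and> lookup (snd m) i \<le> N}"

lemma finite_card_box:
  "finite (box N :: 'n::finite exponents set) \<and> card (box N :: 'n exponents set) = (N + 1) ^ (2 * card (UNIV :: 'n set))"
proof -
  let ?E = "{\<alpha> :: 'n exponent. \<forall>i. lookup \<alpha> i \<le> N}"
  have "bij_betw lookup ?E (PiE UNIV (\<lambda>_. {..N}))"
  proof (rule bij_betw_byWitness[where f' = Poly_Mapping.Abs_poly_mapping])
    show "\<forall>f\<in>PiE UNIV (\<lambda>_. {..N}). lookup (Poly_Mapping.Abs_poly_mapping f :: 'n exponent) = f"
      by (simp add: Abs_poly_mapping_inverse)
  qed (auto simp: Poly_Mapping.lookup_inverse PiE_iff Abs_poly_mapping_inverse)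
  from bij_betw_finite[OF this] bij_betw_same_card[OF this]
  have E: "finite ?E" "card ?E = (N + 1) ^ card (UNIV :: 'n set)"
    by (simp_all add: finite_PiE card_PiE Suc_eq_plus1)
  have "box N = ?E \<times> ?E" by (auto simp: box_def)
  then show ?thesis using E by (simp add: mult_2 power_add)
qed

text \<open>The quotient ((N + k + 1) / (N + 1))^d tends to 1 and so falls below 2, the number of
  families of multiples in the dimension count.\<close>

lemma power_quotient_small:
  fixes d k :: nat
  obtains N where "(N + k + 1) ^ d < 2 * (N + 1) ^ d"
proof -
  have "(\<lambda>N. (1 + real k / real (Suc N)) ^ d) \<longlonglongrightarrow> (1 + 0) ^ d"
    by (intro tendsto_intros LIMSEQ_Suc lim_const_over_n)
  then have "eventually (\<lambda>N. (1 + real k / real (Suc N)) ^ d < 2) sequentially"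
    by (intro order_tendstoD(2)) auto
  then obtain N where N: "(1 + real k / real (Suc N)) ^ d < 2"
    by (meson eventually_happens' sequentially_bot)
  have "real ((N + k + 1) ^ d) = (real (Suc N) * (1 + real k / real (Suc N))) ^ d"
    by (simp add: distrib_left add_ac)
  also have "\<dots> < real (Suc N) ^ d * 2"
    unfolding power_mult_distrib by (rule mult_strict_left_mono[OF N]) simp
  also have "\<dots> = real (2 * (N + 1) ^ d)" by (simp add: add.commute)
  finally have "(N + k + 1) ^ d < 2 * (N + 1) ^ d" by (simp only: of_nat_less_iff)
  then show thesis using that by blast
qed

lemma weyl_span_box:
  assumes "a \<in> weyl_span" obtains N where "a \<in> op.span (weyl_monomial ` box N)"
proof -
  obtain I u where I: "finite I" "a = combination u I" "\<forall>m\<in>I. u m \<noteq> 0" by (rule weyl_spanE[OF assms])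
  define c where "c m = Max (range (lookup (fst m)) \<union> range (lookup (snd m)))" for m :: "'a exponents"
  have c: "lookup (fst m) i \<le> c m \<and> lookup (snd m) i \<le> c m" for m i
    unfolding c_def by (auto intro!: Max_ge)
  \<comment> \<open>The sum of the bounds, in place of their maximum, also covers an empty set of
    monomials.\<close>
  have "c m \<le> sum c I" if "m \<in> I" for m using I(1) that by (simp add: member_le_sum)
  then have "I \<subseteq> box (sum c I)" unfolding box_def using c order_trans by blast
  then have "a \<in> op.span (weyl_monomial ` box (sum c I))"
    unfolding I(2) by (intro span_monoD[OF combination_span] image_mono)
  then show thesis by (rule that)
qed

lemma box_mono: "N \<le> N' \<Longrightarrow> box N \<subseteq> box N'"
  unfolding box_def using order_trans by blast

text \<open>For large \<open>N\<close> there are more products \<open>m a\<close>, \<open>m b\<close> with \<open>m\<close> in a box of side \<open>N\<close> than the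
  dimension of the span of the somewhat larger box that contains them.\<close>

theorem weyl_span_ore:
  fixes a b :: "('n::finite, 'k::field_char_0) operator"
  assumes a: "a \<in> weyl_span" "a \<noteq> 0" and b: "b \<in> weyl_span" "b \<noteq> 0"
  obtains u v where "u \<in> weyl_span" "v \<in> weyl_span" "u \<circ> a = v \<circ> b" "u \<circ> a \<noteq> 0"
proof -
  obtain k1 where "a \<in> op.span (weyl_monomial ` box k1)" using weyl_span_box[OF a(1)] .
  moreover obtain k2 where "b \<in> op.span (weyl_monomial ` box k2)" using weyl_span_box[OF b(1)] .
  ultimately have ab: "a \<in> op.span (weyl_monomial ` box (max k1 k2))"
      "b \<in> op.span (weyl_monomial ` box (max k1 k2))"
    by (auto elim!: span_monoD intro!: image_mono box_mono)
  define k where "k = max k1 k2"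
  obtain N where N: "(N + k + 1) ^ (2 * card (UNIV :: 'n set)) < 2 * (N + 1) ^ (2 * card (UNIV :: 'n set))"
    by (rule power_quotient_small)
  \<comment> \<open>One copy of the box indexes the multiples of a, the other those of b.\<close>
  let ?I = "(box N :: 'n exponents set) <+> (box N :: 'n exponents set)"
  let ?B = "weyl_monomial ` box (N + k) :: ('n, 'k) operator set"
  define v where "v i = (case i of Inl m \<Rightarrow> weyl_monomial m \<circ> a | Inr m \<Rightarrow> weyl_monomial m \<circ> b)" for i
  have fin: "finite (box N :: 'n exponents set)" and card: "card (box N :: 'n exponents set) = (N + 1) ^ (2 * card (UNIV :: 'n set))"
    for N using finite_card_box by blast+
  have box: "weyl_monomial m \<circ> f \<in> op.span ?B"
    if "m \<in> box N" "f \<in> op.span (weyl_monomial ` box k)" for m f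
    using that(2)
  proof (rule comp_span_right[OF _ _ lin_weyl_monomial])
    fix g :: "('n, 'k) operator" assume "g \<in> weyl_monomial ` box k"
    then obtain m' where m': "g = weyl_monomial m'" "m' \<in> box k" by blast
    have "{j. mle j (madd m m')} \<subseteq> box (N + k)"
    proof
      fix j assume "j \<in> {j. mle j (madd m m')}"
      then show "j \<in> box (N + k)"
        using that(1) m'(2) unfolding box_def mle_def madd_def
        by (auto simp: lookup_add) (meson add_mono order_trans)+
    qed
    then show "weyl_monomial m \<circ> g \<in> op.span ?B"
      unfolding m'(1) by (intro span_monoD[OF weyl_monomial_comp_span] image_mono)
  qed
  have "card ?B \<le> (N + k + 1) ^ (2 * card (UNIV :: 'n set))"
    using card_image_le[OF fin[of "N + k"], of weyl_monomial] unfolding card by simp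
  also have "\<dots> < card ?I" using N unfolding card_Plus[OF fin fin] card by simp
  finally have "card ?B < card ?I" .
  moreover have "v i \<in> op.span ?B" if "i \<in> ?I" for i
    using that box ab unfolding v_def k_def by (cases i) auto
  ultimately obtain r where r: "(\<Sum>i\<in>?I. (\<lambda>p. scale (r i) (v i p))) = 0" "\<exists>i\<in>?I. r i \<noteq> 0"
    using linear_relation[of ?I ?B v] fin by auto
  define c where "c = combination (\<lambda>m. r (Inl m)) (box N)"
  define d where "d = combination (\<lambda>m. r (Inr m)) (box N)"
  have cd: "c \<in> weyl_span" "d \<in> weyl_span" unfolding c_def d_def by (rule combination_weyl)+
  have "(\<Sum>i\<in>?I. (\<lambda>p. scale (r i) (v i p))) = (c \<circ> a) + (d \<circ> b)"
    unfolding c_def d_def combination_def comp_sum_left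
    by (simp add: sum.Plus fin v_def comp_def)
  then have sum0: "(c \<circ> a) + (d \<circ> b) = 0" using r(1) by simp
  \<comment> \<open>If c a = 0, then d b = 0 as well, and the domain property gives c = d = 0;
    independence of the monomials then contradicts the nontriviality of the relation.\<close>
  have "c \<circ> a \<noteq> 0"
  proof
    assume ca: "c \<circ> a = 0"
    then have "d \<circ> b = 0" using sum0 by simp
    then have "c = 0" "d = 0"
      using weyl_span_domain[OF cd(1) a(1) ca] weyl_span_domain[OF cd(2) b(1)] a(2) b(2) by auto
    then have "\<forall>m\<in>box N. r (Inl m) = 0" "\<forall>m\<in>box N. r (Inr m) = 0"
      using weyl_monomials_independent_family[OF fin[of N], of "\<lambda>m. r (Inl m)"]
        weyl_monomials_independent_family[OF fin[of N], of "\<lambda>m. r (Inr m)"]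
      unfolding c_def d_def combination_def by simp_all
    then show False using r(2) by auto
  qed
  moreover have "c \<circ> a = (\<lambda>p. scale (- 1) (d p)) \<circ> b"
    using sum0 by (simp add: comp_scale_left fun_eq_iff add_eq_0_iff)
  moreover have "(\<lambda>p. scale (- 1) (d p)) \<in> weyl_span"
    using cd(2) unfolding weyl_span_def by (rule op.span_scale)
  ultimately show thesis using that cd(1) by blast
qed

section \<open>Algebras generated by operators\<close>

lemma End_simps:
  "carrier End_polynomials = Collect lin" "\<one>\<^bsub>End_polynomials\<^esub> = id"
  "\<zero>\<^bsub>End_polynomials\<^esub> = 0" "f \<otimes>\<^bsub>End_polynomials\<^esub> g = f \<circ> g"
  "f \<oplus>\<^bsub>End_polynomials\<^esub> g = f + g" "c \<odot>\<^bsub>End_polynomials\<^esub> f = (\<lambda>p. scale c (f p))"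
  by (simp_all add: End_polynomials_def)

lemma generated_algebra_simps:
  "\<one>\<^bsub>generated_algebra X\<^esub> = id" "\<zero>\<^bsub>generated_algebra X\<^esub> = 0"
  "f \<otimes>\<^bsub>generated_algebra X\<^esub> g = f \<circ> g" "f \<oplus>\<^bsub>generated_algebra X\<^esub> g = f + g"
  "c \<odot>\<^bsub>generated_algebra X\<^esub> f = (\<lambda>p. scale c (f p))"
  by (simp_all add: generated_algebra_def End_simps)

lemma carrier_generated_algebra:
  "carrier (generated_algebra X) = generate_ring End_polynomials (range scale \<union> X)"
  by (simp add: generated_algebra_def End_simps)

lemma generated_algebra_restrict:
  "generated_algebra Y = (generated_algebra X)\<lparr>carrier := carrier (generated_algebra Y)\<rparr>"
  by (simp add: generated_algebra_def)

text \<open>The generators are a parameter because the same closure and induction facts serve the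
  Weyl algebra, the Jacobian algebra, \<open>Delta\<close> and the Jacobian algebra in all variables
  but one.\<close>

locale operator_generators =
  fixes X :: "('n, 'k::field_char_0) operator set"
  assumes lin_generators: "X \<subseteq> Collect lin"
begin

abbreviation "alg \<equiv> carrier (generated_algebra X)"

lemma subring_alg: "subring alg End_polynomials"
  unfolding carrier_generated_algebra
  by (rule ring.generate_ring_is_subring[OF ring_End_polynomials])
    (use lin_generators lin_scale in \<open>auto simp: End_simps\<close>)

lemma lin_alg: "r \<in> alg \<Longrightarrow> lin r"
  using subringE(1)[OF subring_alg] by (auto simp: End_simps)

lemma gen_alg: "x \<in> X \<Longrightarrow> x \<in> alg"
  and scale_alg: "scale c \<in> alg"
  unfolding carrier_generated_algebra by (auto intro: generate_ring.incl)

lemma add_alg: "r \<in> alg \<Longrightarrow> s \<in> alg \<Longrightarrow> r + s \<in> alg"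
  and comp_alg: "r \<in> alg \<Longrightarrow> s \<in> alg \<Longrightarrow> r \<circ> s \<in> alg"
  and zero_alg: "0 \<in> alg" and id_alg: "id \<in> alg"
  using subringE(2,3,6,7)[OF subring_alg] by (auto simp: End_simps)

lemma smult_alg: "r \<in> alg \<Longrightarrow> (\<lambda>p. scale c (r p)) \<in> alg"
  using comp_alg[OF scale_alg, of r c] by (simp add: comp_def)

lemma diff_alg: "r \<in> alg \<Longrightarrow> s \<in> alg \<Longrightarrow> r - s \<in> alg"
proof -
  assume "r \<in> alg" "s \<in> alg"
  then have "r + (\<lambda>p. scale (- 1) (s p)) \<in> alg" by (intro add_alg smult_alg)
  moreover have "r + (\<lambda>p. scale (- 1) (s p)) = r - s" by (simp add: fun_eq_iff)
  ultimately show ?thesis by simp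
qed

lemma span_alg: "Y \<subseteq> alg \<Longrightarrow> op.span Y \<subseteq> alg"
  by (rule op.span_minimal)
    (auto intro!: op.subspaceI zero_alg add_alg smult_alg)

lemma alg_induct [consumes 1, case_names scalar gen add comp]:
  assumes "r \<in> alg" "\<And>c. P (scale c)" "\<And>x. x \<in> X \<Longrightarrow> P x"
    and add: "\<And>r s. \<lbrakk>r \<in> alg; s \<in> alg; P r; P s\<rbrakk> \<Longrightarrow> P (r + s)"
    and comp: "\<And>r s. \<lbrakk>r \<in> alg; s \<in> alg; P r; P s\<rbrakk> \<Longrightarrow> P (r \<circ> s)"
  shows "P r"
  using assms(1) unfolding carrier_generated_algebra
proof induction
  case one
  have "id = (scale 1 :: ('n, 'k) operator)" by (simp add: fun_eq_iff)
  then show ?case unfolding End_simps by (metis assms(2))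
next
  case (incl h)
  then show ?case using assms(2,3) by blast
next
  \<comment> \<open>Negation is composition with the scalar -1, so the induction rule offers no
    separate case for it.\<close>
  case (a_inv h)
  then have h: "h \<in> alg" unfolding carrier_generated_algebra by blast
  have "\<ominus>\<^bsub>End_polynomials\<^esub> h = scale (- 1) \<circ> h"
    using lin_alg[OF h] by (simp add: a_inv_End_polynomials fun_eq_iff)
  then show ?case using comp[OF scale_alg h assms(2) a_inv.IH] by (simp only:)
next
  case (eng_add h1 h2)
  then show ?case using add unfolding End_simps carrier_generated_algebra by blast
next
  case (eng_mult h1 h2)
  then show ?case using comp unfolding End_simps carrier_generated_algebra by blast
qed

text \<open>The relation g r = b h spreads from generators to the whole algebra. For a sum,
  commutativity of \<open>H\<close> makes g' g a common left factor; for a product r s, first h is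
  moved past s and then the resulting element of \<open>H\<close> past r. It is used for powers of
  derivations over \<open>Delta\<close> and for diagonal denominators over the Weyl algebra.\<close>

lemma ore_from_generators:
  assumes H: "\<And>g h. \<lbrakk>g \<in> H; h \<in> H\<rbrakk> \<Longrightarrow> g \<circ> h \<in> H" "\<And>g h. \<lbrakk>g \<in> H; h \<in> H\<rbrakk> \<Longrightarrow> g \<circ> h = h \<circ> g"
    and B: "H \<subseteq> B" "\<And>a b. \<lbrakk>a \<in> B; b \<in> B\<rbrakk> \<Longrightarrow> a + b \<in> B" "\<And>a b. \<lbrakk>a \<in> B; b \<in> B\<rbrakk> \<Longrightarrow> a \<circ> b \<in> B"
      "\<And>c. scale c \<in> B" "\<And>b. b \<in> B \<Longrightarrow> lin b"
    and gen: "\<And>x h. \<lbrakk>x \<in> X; h \<in> H\<rbrakk> \<Longrightarrow> \<exists>g\<in>H. \<exists>b\<in>B. g \<circ> x = b \<circ> h"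
    and r: "r \<in> alg" and h: "h \<in> H"
  shows "\<exists>g\<in>H. \<exists>b\<in>B. g \<circ> r = b \<circ> h"
  using r h
proof (induction r arbitrary: h rule: alg_induct)
  case (scalar c)
  then have "lin h" using B(1,5) by blast
  then have "h \<circ> scale c = scale c \<circ> h" by (simp add: fun_eq_iff lin_app_scale)
  then show ?case using scalar B(4) by blast
next
  case (gen x)
  then show ?case using assms(8) by blast
next
  case (add r s)
  obtain g b where g: "g \<in> H" "b \<in> B" "g \<circ> r = b \<circ> h" using add by blast
  obtain g' b' where g': "g' \<in> H" "b' \<in> B" "g' \<circ> s = b' \<circ> h" using add by blast
  have lin: "lin g" "lin g'" using g g' B(1,5) by auto
  have s: "(g' \<circ> g) \<circ> s = g \<circ> (g' \<circ> s)"
    unfolding H(2)[OF g'(1) g(1)] by (rule comp_assoc)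
  have r: "(g' \<circ> g) \<circ> r = g' \<circ> (g \<circ> r)" by (rule comp_assoc)
  have "(g' \<circ> g) \<circ> (r + s) = (g' \<circ> (g \<circ> r)) + (g \<circ> (g' \<circ> s))"
    unfolding comp_add_right[OF lin_comp[OF lin(2,1)]] r s ..
  also have "\<dots> = ((g' \<circ> b) + (g \<circ> b')) \<circ> h"
    unfolding g(3) g'(3) by (simp only: comp_add_left comp_assoc)
  finally have "(g' \<circ> g) \<circ> (r + s) = ((g' \<circ> b) + (g \<circ> b')) \<circ> h" .
  moreover have "(g' \<circ> b) + (g \<circ> b') \<in> B"
    by (intro B(2,3)) (use g g' B(1) in auto)
  ultimately show ?case using H(1)[OF g'(1) g(1)] by (intro bexI)
next
  case (comp r s)
  obtain g b where g: "g \<in> H" "b \<in> B" "g \<circ> s = b \<circ> h" using comp by blast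
  obtain g' b' where g': "g' \<in> H" "b' \<in> B" "g' \<circ> r = b' \<circ> g" using comp g(1) by blast
  have "g' \<circ> (r \<circ> s) = (b' \<circ> b) \<circ> h"
    using g(3) g'(3) by (metis comp_assoc)
  then show ?case using g'(1) B(3)[OF g'(2) g(2)] by (intro bexI)
qed

end

section \<open>Diagonal operators\<close>

definition diagonal :: "('n exponent \<Rightarrow> 'k) \<Rightarrow> ('n, 'k::field_char_0) operator" where
  "diagonal \<phi> = linear_extension (\<lambda>\<gamma>. scale (\<phi> \<gamma>) (monomial \<gamma>))"

lemma lin_diagonal: "lin (diagonal \<phi>)"
  unfolding diagonal_def by (rule linear_linear_extension)

lemma diagonal_monomial: "diagonal \<phi> (monomial \<gamma>) = scale (\<phi> \<gamma>) (monomial \<gamma>)"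
  by (simp add: diagonal_def)

lemma diagonal_comp: "diagonal \<phi> \<circ> diagonal \<psi> = diagonal (\<lambda>\<gamma>. \<phi> \<gamma> * \<psi> \<gamma>)"
  by (rule linear_operator_eqI[OF lin_comp[OF lin_diagonal lin_diagonal] lin_diagonal])
    (simp add: diagonal_monomial lin_app_scale[OF lin_diagonal] mult.commute)

lemma H_op_diagonal: "H_op i = diagonal (\<lambda>\<gamma>. of_nat (lookup \<gamma> i + 1))"
  by (rule linear_operator_eqI[OF linear_H_op lin_diagonal])
    (simp only: H_op_monomial diagonal_monomial)

lemma H_shift_inv_diagonal:
  "H_shift_inv i k = diagonal (\<lambda>\<gamma>. inverse (of_nat (lookup \<gamma> i + 1 + k)))"
  unfolding H_shift_inv_eq diagonal_def ..

lemma H_inv_diagonal: "H_inv i = diagonal (\<lambda>\<gamma>. inverse (of_nat (lookup \<gamma> i + 1)))"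
  unfolding H_inv_eq_shift H_shift_inv_diagonal by simp

lemma linear_H_shift_inv: "lin (H_shift_inv i k)"
  unfolding H_shift_inv_diagonal by (rule lin_diagonal)

lemma diagonal_1: "diagonal (\<lambda>_. 1) = id"
  by (rule linear_operator_eqI[OF lin_diagonal lin_id]) (simp add: diagonal_monomial)

lemma lookup_diagonal: "lookup (diagonal \<phi> p) \<gamma> = \<phi> \<gamma> * lookup p \<gamma>"
proof -
  have "lookup (diagonal \<phi> p) \<gamma> =
      (\<Sum>\<alpha>\<in>Poly_Mapping.keys p. if \<alpha> = \<gamma> then \<phi> \<alpha> * lookup p \<alpha> else 0)"
    unfolding diagonal_def linear_extension_def lookup_sum lookup_scale lookup_monomial
    by (rule sum.cong) auto
  then show ?thesis by (auto simp: in_keys_iff)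
qed

lemma diagonal_comp_eq_0: "(\<And>\<gamma>. \<phi> \<gamma> \<noteq> 0) \<Longrightarrow> diagonal \<phi> \<circ> f = 0 \<Longrightarrow> f = 0"
proof (rule ext, rule poly_mapping_eqI)
  fix p \<gamma> assume \<phi>: "\<And>\<gamma>. \<phi> \<gamma> \<noteq> 0" and "diagonal \<phi> \<circ> f = 0"
  then have "lookup (diagonal \<phi> (f p)) \<gamma> = 0" by (metis comp_apply lookup_zero zero_fun_apply)
  then show "lookup (f p) \<gamma> = lookup (0 p) \<gamma>" using \<phi> by (simp add: lookup_diagonal)
qed

text \<open>Only exponents \<gamma> above \<beta> impose a condition, because both sides kill every
  other x^\<gamma>. Moving a diagonal operator past the derivations shifts its eigenvalues by
  \<beta>.\<close>

lemma d_power_diagonal: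
  assumes "\<And>\<gamma>. (\<And>i. lookup \<beta> i \<le> lookup \<gamma> i) \<Longrightarrow> \<psi> (\<gamma> - \<beta>) = \<phi> \<gamma>"
  shows "d_power \<beta> \<circ> diagonal \<phi> = diagonal \<psi> \<circ> d_power \<beta>"
proof (rule linear_operator_eqI)
  fix \<gamma>
  show "(d_power \<beta> \<circ> diagonal \<phi>) (monomial \<gamma>) = (diagonal \<psi> \<circ> d_power \<beta>) (monomial \<gamma>)"
  proof (cases "\<exists>i. lookup \<gamma> i < lookup \<beta> i")
    case True
    then have "falling \<beta> \<gamma> = (0 :: 'b)" by (simp add: falling_eq_0_iff)
    then show ?thesis
      by (simp add: diagonal_monomial d_power_monomial lin_app_scale[OF lin_d_power] lin_app_zero[OF lin_diagonal])
  next
    case False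
    then have "\<psi> (\<gamma> - \<beta>) = \<phi> \<gamma>" using assms by (simp add: not_less)
    then show ?thesis
      by (simp add: diagonal_monomial d_power_monomial lin_app_scale[OF lin_d_power]
          lin_app_scale[OF lin_diagonal] mult.commute)
  qed
qed (intro lin_comp lin_d_power lin_diagonal)+

section \<open>The three algebras and their inclusions\<close>

interpretation weyl: operator_generators
  "range x_op \<union> range d_op :: ('n::finite, 'k::field_char_0) operator set"
  by unfold_locales (auto intro: linear_x_op linear_d_op)

interpretation jac: operator_generators
  "range x_op \<union> range d_op \<union> range H_inv :: ('n::finite, 'k::field_char_0) operator set"
  by unfold_locales (auto intro: linear_x_op linear_d_op linear_H_inv)

interpretation delta: operator_generators
  "range H_op \<union> range H_inv \<union> {H_shift_inv i k | i k. k \<ge> 1} \<union> range d_op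
    :: ('n::finite, 'k::field_char_0) operator set"
  by unfold_locales (auto intro: linear_H_op linear_d_op linear_H_inv linear_H_shift_inv)

lemma algebra_eqs:
  "weyl_algebra = generated_algebra (range x_op \<union> range d_op)"
  "jacobian_algebra = generated_algebra (range x_op \<union> range d_op \<union> range H_inv)"
  "Delta = generated_algebra
    (range H_op \<union> range H_inv \<union> {H_shift_inv i k | i k. k \<ge> 1} \<union> range d_op)"
  by (simp_all add: weyl_algebra_def jacobian_algebra_def jacobian_algebra_on_def Delta_def)

lemma x_weyl: "x_op i \<in> weyl.alg" and d_weyl: "d_op i \<in> weyl.alg"
  by (rule weyl.gen_alg, simp)+

lemma x_jac: "x_op i \<in> jac.alg" and d_jac: "d_op i \<in> jac.alg" and H_inv_jac: "H_inv i \<in> jac.alg"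
  by (rule jac.gen_alg, simp)+

lemma d_delta: "d_op i \<in> delta.alg" and H_delta: "H_op i \<in> delta.alg"
  by (rule delta.gen_alg, simp)+

text \<open>The shifted inverses among the generators of \<open>Delta\<close> start at k = 1; for k
  = 0 the generator is \<open>H_inv\<close>.\<close>

lemma H_shift_inv_delta: "H_shift_inv i k \<in> delta.alg"
proof (cases "k = 0")
  case True
  then have "H_shift_inv i k = (H_inv i :: ('a, 'b) operator)" by (simp add: H_inv_eq_shift)
  then show ?thesis by (intro delta.gen_alg) auto
next
  case False
  then have "H_shift_inv i k \<in> {H_shift_inv i k :: ('a, 'b) operator | i k. k \<ge> 1}" by force
  then show ?thesis by (intro delta.gen_alg) blast
qed

text \<open>Between x_i and d_i the inverse of H_i + k is evaluated one degree higher, and the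
  factor d_i x_i = H_i that this produces is undone by H_i^-1. So the Jacobian algebra contains all
  shifted inverses although only H_i^-1 is a generator.\<close>

lemma H_shift_inv_Suc:
  "H_shift_inv i (Suc k) = (d_op i \<circ> H_shift_inv i k \<circ> x_op i \<circ> H_inv i :: ('n::finite, 'k::field_char_0) operator)"
proof (rule linear_operator_eqI)
  fix \<gamma> :: "'n exponent"
  have nz: "of_nat (lookup \<gamma> i + 1) \<noteq> (0 :: 'k)" unfolding of_nat_eq_0_iff by simp
  have "(d_op i \<circ> H_shift_inv i k \<circ> x_op i \<circ> H_inv i) (monomial \<gamma>) =
      scale (inverse (of_nat (lookup \<gamma> i + 1)) * (inverse (of_nat (lookup \<gamma> i + 1 + 1 + k)) *
        of_nat (lookup \<gamma> i + 1))) (monomial \<gamma> :: ('n, 'k) polynomial)"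
    by (simp only: comp_apply H_inv_monomial lin_app_scale[OF linear_x_op]
        lin_app_scale[OF linear_H_shift_inv] lin_app_scale[OF linear_d_op] x_op_monomial
        H_shift_inv_diagonal diagonal_monomial lin_app_scale[OF lin_diagonal] d_op_monomial
        pol.scale_scale lookup_add lookup_unit if_True refl add_diff_cancel_right' mult.assoc)
  also have "inverse (of_nat (lookup \<gamma> i + 1)) * (inverse (of_nat (lookup \<gamma> i + 1 + 1 + k)) *
        of_nat (lookup \<gamma> i + 1)) = (inverse (of_nat (lookup \<gamma> i + 1 + Suc k)) :: 'k)"
    using nz by (simp add: add_ac)
  finally show "H_shift_inv i (Suc k) (monomial \<gamma>) =
      (d_op i \<circ> H_shift_inv i k \<circ> x_op i \<circ> H_inv i :: ('n, 'k) operator) (monomial \<gamma>)"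
    unfolding H_shift_inv_diagonal diagonal_monomial ..
qed (intro lin_comp linear_H_shift_inv linear_d_op linear_x_op linear_H_inv)+

lemma H_shift_inv_jac: "H_shift_inv i k \<in> jac.alg"
proof (induction k)
  case 0
  then show ?case using H_inv_jac H_inv_eq_shift by metis
next
  case (Suc k)
  then show ?case unfolding H_shift_inv_Suc by (intro jac.comp_alg d_jac x_jac H_inv_jac)
qed

lemma weyl_subset_jac: "weyl.alg \<subseteq> jac.alg"
proof
  show "r \<in> jac.alg" if "r \<in> weyl.alg" for r :: "('a, 'b) operator"
    using that
  proof (induction rule: weyl.alg_induct)
    case (gen x)
    then show ?case using d_jac x_jac by blast
  qed (intro jac.scale_alg jac.add_alg jac.comp_alg; assumption)+
qed

lemma delta_subset_jac: "delta.alg \<subseteq> jac.alg"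
proof
  show "r \<in> jac.alg" if "r \<in> delta.alg" for r :: "('a, 'b) operator"
    using that
  proof (induction rule: delta.alg_induct)
    case (gen x)
    moreover have "H_op i \<in> jac.alg" for i
      unfolding H_op_def by (intro jac.comp_alg d_jac x_jac)
    ultimately show ?case using d_jac H_inv_jac H_shift_inv_jac by blast
  qed (intro jac.scale_alg jac.add_alg jac.comp_alg; assumption)+
qed

lemma x_power_weyl: "x_power \<alpha> \<in> weyl.alg"
  by (induction \<alpha> rule: exponent_induct)
    (simp_all only: x_power_0 x_power_add x_power_unit weyl.id_alg weyl.comp_alg x_weyl)

lemma d_power_weyl: "d_power \<beta> \<in> weyl.alg"
  by (induction \<beta> rule: exponent_induct)
    (simp_all only: d_power_0 d_power_add_unit weyl.id_alg weyl.comp_alg d_weyl)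

lemma d_power_delta: "d_power \<beta> \<in> delta.alg"
  by (induction \<beta> rule: exponent_induct)
    (simp_all only: d_power_0 d_power_add_unit delta.id_alg delta.comp_alg d_delta)

lemma d_power_jac: "d_power \<beta> \<in> jac.alg"
  using d_power_weyl weyl_subset_jac by blast

lemma weyl_alg_eq: "weyl.alg = weyl_span"
proof (intro subset_antisym subsetI)
  show "r \<in> weyl_span" if "r \<in> weyl.alg" for r :: "('a, 'b) operator"
    using that
  proof (induction rule: weyl.alg_induct)
    have mono: "weyl_monomial m \<in> weyl_span" for m
      unfolding weyl_span_def by (rule op.span_base) simp
    case (scalar c)
    have "scale c = (\<lambda>p. scale c (weyl_monomial (0, 0) p :: ('a, 'b) polynomial))"
      by (simp add: weyl_monomial_def x_power_0 d_power_0)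
    moreover have "(\<lambda>p. scale c (weyl_monomial (0, 0) p :: ('a, 'b) polynomial)) \<in> weyl_span"
      using mono unfolding weyl_span_def by (rule op.span_scale)
    ultimately show ?case by (simp only:)
  next
    have mono: "weyl_monomial m \<in> weyl_span" for m
      unfolding weyl_span_def by (rule op.span_base) simp
    case (gen x)
    then consider i where "x = x_op i" | i where "x = d_op i" by blast
    then show ?case
    proof cases
      case 1
      then have "x = weyl_monomial (unit_exponent i, 0)"
        by (simp only: weyl_monomial_def fst_conv snd_conv x_power_unit d_power_0 comp_id)
      then show ?thesis using mono by (simp only:)
    next
      case 2
      then have "x = weyl_monomial (0, unit_exponent i)"
        by (simp only: weyl_monomial_def fst_conv snd_conv d_power_unit x_power_0 id_comp)
      then show ?thesis using mono by (simp only:)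
    qed
  next
    case (add r s)
    then show ?case unfolding weyl_span_def by (intro op.span_add)
  next
    case (comp r s)
    then show ?case by (intro weyl_span_comp)
  qed
  have "range weyl_monomial \<subseteq> weyl.alg"
    unfolding weyl_monomial_def using weyl.comp_alg[OF x_power_weyl d_power_weyl] by blast
  then show "r \<in> weyl.alg" if "r \<in> weyl_span" for r :: "('a, 'b) operator"
    using that weyl.span_alg unfolding weyl_span_def by blast
qed

section \<open>The Ore set of the powers of the derivations\<close>

lemma d_power_H_shift_inv:
  "d_power \<beta> \<circ> H_shift_inv i k = H_shift_inv i (k + lookup \<beta> i) \<circ> d_power \<beta>"
  unfolding H_shift_inv_diagonal
proof (rule d_power_diagonal)
  fix \<gamma> assume "\<And>i. lookup \<beta> i \<le> lookup \<gamma> i"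
  from this[of i] have "lookup (\<gamma> - \<beta>) i + 1 + (k + lookup \<beta> i) = lookup \<gamma> i + 1 + k"
    by (simp add: lookup_minus)
  then show "inverse (of_nat (lookup (\<gamma> - \<beta>) i + 1 + (k + lookup \<beta> i))) =
      inverse (of_nat (lookup \<gamma> i + 1 + k))" by (simp only:)
qed

text \<open>One additional derivative absorbs x_i, since d_i x_i = H_i, and H_i passes d^\<beta> as
  H_i + \<beta>_i, an element of \<open>Delta\<close>.\<close>

lemma d_power_x_op_delta: "\<exists>d\<in>delta.alg. d_power (\<beta> + unit_exponent i) \<circ> x_op i = d \<circ> d_power \<beta>"
proof -
  have "d_power (\<beta> + unit_exponent i) \<circ> x_op i = (d_power \<beta> \<circ> H_op i :: ('a, 'b) operator)"
    by (simp only: d_power_add_unit H_op_def comp_assoc)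
  also have "\<dots> = diagonal (\<lambda>\<gamma>. of_nat (lookup \<gamma> i + 1) + of_nat (lookup \<beta> i)) \<circ> d_power \<beta>"
    unfolding H_op_diagonal
  proof (rule d_power_diagonal)
    fix \<gamma> assume "\<And>i. lookup \<beta> i \<le> lookup \<gamma> i"
    from this[of i] have "lookup (\<gamma> - \<beta>) i + 1 + lookup \<beta> i = lookup \<gamma> i + 1"
      by (simp add: lookup_minus)
    then show "of_nat (lookup (\<gamma> - \<beta>) i + 1) + of_nat (lookup \<beta> i) = of_nat (lookup \<gamma> i + 1)"
      unfolding of_nat_add[symmetric] by (simp only:)
  qed
  also have "diagonal (\<lambda>\<gamma>. of_nat (lookup \<gamma> i + 1) + of_nat (lookup \<beta> i)) =
      H_op i + (scale (of_nat (lookup \<beta> i)) :: ('a, 'b) operator)"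
    by (rule linear_operator_eqI[OF lin_diagonal lin_add[OF linear_H_op lin_scale]])
      (simp only: diagonal_monomial plus_fun_apply H_op_monomial pol.scale_left_distrib)
  finally show ?thesis using delta.add_alg[OF H_delta delta.scale_alg] by blast
qed

lemma d_power_ore:
  assumes "r \<in> jac.alg" "\<theta> \<in> range d_power"
  shows "\<exists>\<eta>\<in>range d_power. \<exists>d\<in>delta.alg. \<eta> \<circ> r = d \<circ> (\<theta> :: ('n::finite, 'k::field_char_0) operator)"
proof (rule jac.ore_from_generators[OF _ _ _ _ _ _ _ _ assms])
  fix g h :: "('n, 'k) operator" assume "g \<in> range d_power" "h \<in> range d_power"
  then obtain \<alpha> \<beta> where gh: "g = d_power \<alpha>" "h = d_power \<beta>" by blast
  show "g \<circ> h \<in> range d_power" unfolding gh d_power_add[symmetric] by blast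
  show "g \<circ> h = h \<circ> g" unfolding gh d_power_add[symmetric] by (simp only: add.commute)
next
  fix x h :: "('n, 'k) operator"
  assume x: "x \<in> range x_op \<union> range d_op \<union> range H_inv" and h: "h \<in> range d_power"
  obtain \<beta> where \<beta>: "h = d_power \<beta>" using h by blast
  from x consider i where "x = x_op i" | i where "x = d_op i" | i where "x = H_inv i" by blast
  then show "\<exists>g\<in>range d_power. \<exists>b\<in>delta.alg. g \<circ> x = b \<circ> h"
  proof cases
    case 1
    then show ?thesis using d_power_x_op_delta \<beta> by blast
  next
    case 2
    have "d_power \<beta> \<circ> d_op i = (d_op i \<circ> d_power \<beta> :: ('n, 'k) operator)"
      unfolding d_power_unit[symmetric] d_power_add[symmetric] by (simp only: add.commute)
    then show ?thesis using 2 \<beta> d_delta by blast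
  next
    case 3
    have "d_power \<beta> \<circ> H_inv i = (H_shift_inv i (0 + lookup \<beta> i) \<circ> d_power \<beta> :: ('n, 'k) operator)"
      unfolding H_inv_eq_shift by (rule d_power_H_shift_inv)
    then show ?thesis using 3 \<beta> H_shift_inv_delta by blast
  qed
qed (use d_power_delta delta.add_alg delta.comp_alg delta.scale_alg delta.lin_alg in blast)+

text \<open>In characteristic zero d^\<beta> is onto: x^\<gamma> is a nonzero multiple of the image
  of x^(\<beta> + \<gamma>).\<close>

lemma d_power_left_regular:
  assumes "lin r" "r \<circ> d_power \<beta> = 0" shows "r = (0 :: ('n::finite, 'k::field_char_0) operator)"
proof (rule linear_eq_zeroI[OF assms(1)])
  fix \<gamma> :: "'n exponent"
  have nz: "falling \<beta> (\<beta> + \<gamma>) \<noteq> (0 :: 'k)" by (simp add: falling_eq_0_iff lookup_add)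
  have "\<beta> + \<gamma> - \<beta> = \<gamma>" by (rule exponent_eqI) (simp add: lookup_add lookup_minus)
  then have "scale (falling \<beta> (\<beta> + \<gamma>)) (r (monomial \<gamma>)) = (r \<circ> d_power \<beta>) (monomial (\<beta> + \<gamma>))"
    by (simp add: d_power_monomial lin_app_scale[OF assms(1)])
  then show "r (monomial \<gamma>) = 0" using nz unfolding assms(2) by simp
qed

section \<open>Clearing denominators\<close>

text \<open>The eigenvalue functions of products of operators H_i + k with k \<ge> 0. They have no
  zeros, commute, and are stable under products and shifts, which makes them denominators for
  \<open>Delta\<close> over the Weyl algebra.\<close>

inductive_set denominators :: "('n exponent \<Rightarrow> 'k::field_char_0) set" where
  den_one: "(\<lambda>_. 1) \<in> denominators"
| den_mult: "\<phi> \<in> denominators \<Longrightarrow> (\<lambda>\<gamma>. \<phi> \<gamma> * of_nat (lookup \<gamma> i + 1 + k)) \<in> denominators"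

lemma denominators_mult:
  assumes "\<phi> \<in> denominators" "\<psi> \<in> denominators"
  shows "(\<lambda>\<gamma>. \<phi> \<gamma> * \<psi> \<gamma>) \<in> denominators"
  using assms(2)
proof induction
  case den_one
  then show ?case using assms(1) by simp
next
  case (den_mult \<psi> i k)
  from denominators.den_mult[OF den_mult.IH] show ?case by (simp only: mult.assoc)
qed

lemma denominators_nonzero: "\<phi> \<in> denominators \<Longrightarrow> \<phi> \<gamma> \<noteq> (0 :: 'k::field_char_0)"
proof (induction rule: denominators.induct)
  case (den_mult \<phi> i k)
  have "of_nat (lookup \<gamma> i + 1 + k) \<noteq> (0 :: 'k)" unfolding of_nat_eq_0_iff by simp
  then show ?case using den_mult by simp
qed simp

lemma denominators_shift:
  "\<phi> \<in> denominators \<Longrightarrow> (\<lambda>\<gamma>. \<phi> (\<gamma> + unit_exponent j)) \<in> denominators"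
proof (induction rule: denominators.induct)
  case den_one
  then show ?case by (rule denominators.den_one)
next
  case (den_mult \<phi> i k)
  have "lookup (\<gamma> + unit_exponent j) i + 1 + k = lookup \<gamma> i + 1 + (k + (if j = i then 1 else 0))" for \<gamma>
    by (simp add: lookup_add lookup_unit)
  with denominators.den_mult[OF den_mult.IH, of i "k + (if j = i then 1 else 0)"]
  show ?case by (simp only:)
qed

lemma denominators_weyl: "\<phi> \<in> denominators \<Longrightarrow> diagonal \<phi> \<in> weyl.alg"
proof (induction rule: denominators.induct)
  case den_one
  then show ?case by (simp only: diagonal_1 weyl.id_alg)
next
  case (den_mult \<phi> i k)
  have "diagonal (\<lambda>\<gamma>. of_nat (lookup \<gamma> i + 1 + k)) = H_op i + (scale (of_nat k) :: ('a, 'b) operator)"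
    by (rule linear_operator_eqI[OF lin_diagonal lin_add[OF linear_H_op lin_scale]])
      (simp only: diagonal_monomial plus_fun_apply H_op_monomial pol.scale_left_distrib of_nat_add)
  then have "diagonal (\<lambda>\<gamma>. of_nat (lookup \<gamma> i + 1 + k)) \<in> (weyl.alg :: ('a, 'b) operator set)"
    unfolding H_op_def using weyl.add_alg weyl.comp_alg d_weyl x_weyl weyl.scale_alg by metis
  then show ?case unfolding diagonal_comp[symmetric] using den_mult.IH weyl.comp_alg by blast
qed

lemma diagonal_d_op:
  "diagonal (\<lambda>\<gamma>. \<phi> (\<gamma> + unit_exponent i)) \<circ> d_op i =
    (d_op i \<circ> diagonal \<phi> :: ('n::finite, 'k::field_char_0) operator)"
proof (rule linear_operator_eqI)
  fix \<gamma> :: "'n exponent"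
  have "\<gamma> - unit_exponent i + unit_exponent i = \<gamma>" if "lookup \<gamma> i \<noteq> 0"
    by (rule exponent_eqI) (use that in \<open>auto simp: lookup_minus lookup_add lookup_unit\<close>)
  then show "(diagonal (\<lambda>\<gamma>. \<phi> (\<gamma> + unit_exponent i)) \<circ> d_op i) (monomial \<gamma>) =
      (d_op i \<circ> diagonal \<phi> :: ('n, 'k) operator) (monomial \<gamma>)"
    by (cases "lookup \<gamma> i = 0") (simp_all add: d_op_monomial diagonal_monomial lin_app_scale[OF lin_diagonal]
        lin_app_scale[OF linear_d_op] lin_app_zero[OF lin_diagonal] mult.commute)
qed (intro lin_comp lin_diagonal linear_d_op)+

text \<open>The Ore relation is used with h = 1, so its right factor disappears. On generators, H_i
  commutes with every denominator, an inverse is absorbed by enlarging the denominator, and d_i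
  merely shifts it.\<close>

lemma clear_denominators:
  assumes "d \<in> delta.alg"
  obtains \<phi> where "\<phi> \<in> denominators" "diagonal \<phi> \<circ> d \<in> (weyl.alg :: ('n::finite, 'k::field_char_0) operator set)"
proof -
  have "\<exists>g\<in>diagonal ` denominators. \<exists>b\<in>weyl.alg. g \<circ> d = b \<circ> (diagonal (\<lambda>_. 1) :: ('n, 'k) operator)"
  proof (rule delta.ore_from_generators[OF _ _ _ _ _ _ _ _ assms imageI[OF den_one]])
    fix g h :: "('n, 'k) operator" assume "g \<in> diagonal ` denominators" "h \<in> diagonal ` denominators"
    then obtain \<phi> \<psi> where gh: "g = diagonal \<phi>" "h = diagonal \<psi>" "\<phi> \<in> denominators" "\<psi> \<in> denominators"
      by blast
    show "g \<circ> h \<in> diagonal ` denominators"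
      unfolding gh diagonal_comp using denominators_mult gh by blast
    show "g \<circ> h = h \<circ> g" unfolding gh diagonal_comp by (simp only: mult.commute)
  next
    fix x h :: "('n, 'k) operator"
    assume x: "x \<in> range H_op \<union> range H_inv \<union> {H_shift_inv i k | i k. k \<ge> 1} \<union> range d_op"
      and h: "h \<in> diagonal ` denominators"
    obtain \<phi> where \<phi>: "h = diagonal \<phi>" "\<phi> \<in> denominators" using h by blast
    have "(\<exists>i. x = H_op i) \<or> (\<exists>i. x = H_inv i) \<or> (\<exists>i k. x = H_shift_inv i k) \<or> (\<exists>i. x = d_op i)"
      using x by blast
    then consider i where "x = H_op i" | i k where "x = H_shift_inv i k" | i where "x = d_op i" unfolding H_inv_eq_shift by blast
    then show "\<exists>g\<in>diagonal ` denominators. \<exists>b\<in>weyl.alg. g \<circ> x = b \<circ> h"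
    proof cases
      case 1
      have "h \<circ> x = x \<circ> h"
        unfolding 1 \<phi>(1) H_op_diagonal diagonal_comp by (simp only: mult.commute)
      moreover have "x \<in> weyl.alg"
        unfolding 1 H_op_def by (intro weyl.comp_alg d_weyl x_weyl)
      ultimately show ?thesis using h by blast
    next
      case 2
      let ?\<psi> = "\<lambda>\<gamma>. \<phi> \<gamma> * of_nat (lookup \<gamma> i + 1 + k)"
      have nz: "of_nat (lookup \<gamma> i + 1 + k) \<noteq> (0 :: 'k)" for \<gamma> :: "'n exponent"
        unfolding of_nat_eq_0_iff by simp
      have "diagonal ?\<psi> \<circ> x = id \<circ> h"
        unfolding 2 H_shift_inv_diagonal diagonal_comp \<phi>(1)
        by (simp only: mult.assoc right_inverse[OF nz] mult_1_right id_comp)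
      then show ?thesis using denominators.den_mult[OF \<phi>(2)] weyl.id_alg by blast
    next
      case 3
      then show ?thesis
        using diagonal_d_op[of \<phi> i] \<phi> denominators_shift[OF \<phi>(2)] d_weyl by blast
    qed
  qed (use denominators_weyl weyl.add_alg weyl.comp_alg weyl.scale_alg weyl.lin_alg in blast)+
  then obtain \<phi> b where "\<phi> \<in> denominators" "b \<in> weyl.alg" "diagonal \<phi> \<circ> d = b \<circ> diagonal (\<lambda>_. 1)" by blast
  then show thesis using that by (simp only: diagonal_1 comp_id)
qed

lemma jacobian_setting:
  "jacobian_setting (jacobian_algebra :: ('n::finite, 'k::field_char_0) operator_algebra)
     weyl.alg delta.alg (range d_power)"
proof -
  let ?J = "jacobian_algebra :: ('n, 'k) operator_algebra"
  have car: "carrier ?J = jac.alg" by (simp only: algebra_eqs)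
  have End: "?J = End_polynomials\<lparr>carrier := jac.alg\<rparr>"
    unfolding algebra_eqs by (simp add: generated_algebra_def)
  have ops: "\<one>\<^bsub>?J\<^esub> = id" "\<zero>\<^bsub>?J\<^esub> = 0" "f \<otimes>\<^bsub>?J\<^esub> g = f \<circ> g"
    "c \<odot>\<^bsub>?J\<^esub> f = (\<lambda>p. scale c (f p))" for f g c
    unfolding algebra_eqs by (rule generated_algebra_simps)+
  interpret End: ring "End_polynomials :: ('n, 'k) operator_algebra" by (rule ring_End_polynomials)
  interpret J: ring ?J
    unfolding End by (rule End.subring_is_ring[OF jac.subring_alg])
  have sub: "subring B ?J" if "subring B End_polynomials" "B \<subseteq> jac.alg" for B
  proof (rule J.subring_iff[THEN iffD2])
    show "B \<subseteq> carrier ?J" using that car by simp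
    show "ring (?J\<lparr>carrier := B\<rparr>)"
      unfolding End using End.subring_is_ring[OF that(1)] by simp
  qed
  have id0: "id \<noteq> (0 :: ('n, 'k) operator)"
  proof
    assume "id = (0 :: ('n, 'k) operator)"
    then have "monomial 0 = (0 :: ('n, 'k) polynomial)" by (metis id_apply zero_fun_apply)
    then have "lookup (monomial 0 :: ('n, 'k) polynomial) 0 = 0" by simp
    then show False by (simp add: lookup_monomial)
  qed
  have d_nonzero: "d_power \<beta> \<noteq> (0 :: ('n, 'k) operator)" for \<beta>
    using d_power_left_regular[OF lin_id, of \<beta>] id0 by auto
  have torsion_free: "d = 0"
    if w: "w \<in> weyl.alg" "w \<noteq> 0" and d: "d \<in> delta.alg" and wd: "w \<circ> d = 0" for w d :: "('n, 'k) operator"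
  proof -
    obtain \<phi> where \<phi>: "\<phi> \<in> denominators" "diagonal \<phi> \<circ> d \<in> weyl.alg"
      by (rule clear_denominators[OF d])
    have h: "diagonal \<phi> \<in> weyl_span" "diagonal \<phi> \<noteq> (0 :: ('n, 'k) operator)"
      using denominators_weyl[OF \<phi>(1)] weyl_alg_eq
        diagonal_comp_eq_0[of \<phi> id] denominators_nonzero[OF \<phi>(1)] id0 by auto
    \<comment> \<open>The annihilator w has no relation to the denominator of d, so a common left
      multiple of w and \<open>diagonal \<phi>\<close> is formed in the Weyl algebra; v then kills
      an element of that domain.\<close>
    obtain u v where uv: "u \<in> weyl_span" "v \<in> weyl_span" "u \<circ> w = v \<circ> diagonal \<phi>" "u \<circ> w \<noteq> 0"
      using weyl_span_ore[OF w(1)[unfolded weyl_alg_eq] w(2) h] .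
    have "v \<circ> (diagonal \<phi> \<circ> d) = u \<circ> (w \<circ> d)"
      using uv(3) by (metis comp_assoc)
    also have "\<dots> = 0" unfolding wd by (rule comp_zero_right[OF lin_weyl_span[OF uv(1)]])
    finally have "v = 0 \<or> diagonal \<phi> \<circ> d = 0"
      using weyl_span_domain[OF uv(2) \<phi>(2)[unfolded weyl_alg_eq]] by blast
    moreover have "v \<noteq> 0" using uv(3,4) comp_zero_left by metis
    ultimately have "diagonal \<phi> \<circ> d = 0" by blast
    then show "d = 0" using diagonal_comp_eq_0[of \<phi> d] denominators_nonzero[OF \<phi>(1)] by blast
  qed
  show ?thesis
  proof (rule jacobian_setting.intro[OF J.ring_axioms jacobian_setting_axioms.intro], unfold car ops)
    show "(\<lambda>p. scale c (r p)) \<in> jac.alg" if "r \<in> jac.alg" for r :: "('n, 'k) operator" and c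
      using that by (rule jac.smult_alg)
    show "(\<lambda>p. scale c (r p)) \<in> weyl.alg" if "r \<in> weyl.alg" for r :: "('n, 'k) operator" and c
      using that by (rule weyl.smult_alg)
    show "a \<circ> (\<lambda>p. scale c (r p)) = (\<lambda>p. scale c ((a \<circ> r) p))"
      if "a \<in> jac.alg" "r \<in> jac.alg" for a r :: "('n, 'k) operator" and c
      by (rule comp_scale_right[OF jac.lin_alg[OF that(1)]])
    show "id \<noteq> (0 :: ('n, 'k) operator)" by (rule id0)
    show "subring weyl.alg ?J" by (rule sub[OF weyl.subring_alg weyl_subset_jac])
    show "subring delta.alg ?J" by (rule sub[OF delta.subring_alg delta_subset_jac])
    show "\<theta> \<in> weyl.alg" if "\<theta> \<in> range d_power" for \<theta> :: "('n, 'k) operator"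
      using that d_power_weyl by blast
    show "\<theta> \<in> delta.alg" if "\<theta> \<in> range d_power" for \<theta> :: "('n, 'k) operator"
      using that d_power_delta by blast
    show "id \<in> range (d_power :: _ \<Rightarrow> ('n, 'k) operator)" by (metis d_power_0 rangeI)
    show "\<theta> \<circ> \<eta> \<in> range d_power" if "\<theta> \<in> range d_power" "\<eta> \<in> range d_power" for \<theta> \<eta> :: "('n, 'k) operator"
      using that d_power_add by (metis (no_types, lifting) imageE rangeI)
    show "r = 0" if "\<theta> \<in> range d_power" "r \<in> jac.alg" "r \<circ> \<theta> = 0" for \<theta> r :: "('n, 'k) operator"
      using that d_power_left_regular[OF jac.lin_alg[OF that(2)]] by blast
    show "\<exists>\<eta>\<in>range d_power. \<exists>d\<in>delta.alg. \<eta> \<circ> r = d \<circ> \<theta>"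
      if "r \<in> jac.alg" "\<theta> \<in> range d_power" for r \<theta> :: "('n, 'k) operator"
      by (rule d_power_ore[OF that])
    show "a = 0 \<or> b = 0" if "a \<in> weyl.alg" "b \<in> weyl.alg" "a \<circ> b = 0" for a b :: "('n, 'k) operator"
      using weyl_span_domain that unfolding weyl_alg_eq by blast
    show "\<exists>u\<in>weyl.alg. \<exists>v\<in>weyl.alg. u \<circ> a = v \<circ> b \<and> u \<circ> a \<noteq> 0"
      if ab: "a \<in> weyl.alg" "b \<in> weyl.alg" "a \<noteq> 0" "b \<noteq> 0" for a b :: "('n, 'k) operator"
      by (rule weyl_span_ore[OF ab(1)[unfolded weyl_alg_eq] ab(3) ab(2)[unfolded weyl_alg_eq] ab(4)])
        (unfold weyl_alg_eq, blast)
    show "\<exists>w\<in>weyl.alg. w \<noteq> 0 \<and> w \<circ> r \<in> weyl.alg" if r: "r \<in> jac.alg" for r :: "('n, 'k) operator"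
    proof -
      have "id \<in> range (d_power :: _ \<Rightarrow> ('n, 'k) operator)" by (metis d_power_0 rangeI)
      \<comment> \<open>A power of the derivations moves r into \<open>Delta\<close>, after which a
        diagonal denominator moves it into the Weyl algebra.\<close>
      from d_power_ore[OF r this] obtain \<beta> d where
        d: "d \<in> delta.alg" "d_power \<beta> \<circ> r = d \<circ> id" by blast
      obtain \<phi> where \<phi>: "\<phi> \<in> denominators" "diagonal \<phi> \<circ> d \<in> weyl.alg"
        by (rule clear_denominators[OF d(1)])
      have "(diagonal \<phi> \<circ> d_power \<beta>) \<circ> r = diagonal \<phi> \<circ> d"
        using d(2) by (simp only: comp_assoc comp_id)
      moreover have "diagonal \<phi> \<circ> d_power \<beta> \<in> (weyl.alg :: ('n, 'k) operator set)"
        by (rule weyl.comp_alg[OF denominators_weyl[OF \<phi>(1)] d_power_weyl])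
      moreover have "diagonal \<phi> \<circ> d_power \<beta> \<noteq> 0"
        using diagonal_comp_eq_0[of \<phi> "d_power \<beta>"] denominators_nonzero[OF \<phi>(1)] d_nonzero by blast
      ultimately show ?thesis using \<phi>(2) by (intro bexI[of _ "diagonal \<phi> \<circ> d_power \<beta>"]) simp_all
    qed
    show "d = 0" if "w \<in> weyl.alg" "w \<noteq> 0" "d \<in> delta.alg" "w \<circ> d = 0" for w d :: "('n, 'k) operator"
      by (rule torsion_free[OF that])
  qed
qed

section \<open>Matrix units and the ideals of the Jacobian algebra\<close>

lemma lin_matrix_unit_at: "lin (matrix_unit_at i k l)"
  unfolding matrix_unit_at_def by (rule linear_linear_extension)

lemma lin_matrix_unit: "lin (matrix_unit \<alpha> \<beta>)"
  unfolding matrix_unit_def by (rule linear_linear_extension)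

lemma matrix_unit_at_monomial:
  "matrix_unit_at i k l (monomial \<gamma>) =
    (if lookup \<gamma> i = l then monomial (Poly_Mapping.update i k \<gamma>) else 0)"
  by (simp add: matrix_unit_at_def)

lemma matrix_unit_monomial: "matrix_unit \<alpha> \<beta> (monomial \<gamma>) = (if \<gamma> = \<beta> then monomial \<alpha> else 0)"
  by (simp add: matrix_unit_def)

lemma update_self: "lookup \<gamma> i = k \<Longrightarrow> Poly_Mapping.update i k \<gamma> = \<gamma>"
  by (rule exponent_eqI) (auto simp: lookup_update)

definition support_projection :: "'n set \<Rightarrow> ('n, 'k::field_char_0) operator" where
  "support_projection I = diagonal (\<lambda>\<gamma>. if \<forall>i\<in>I. lookup \<gamma> i = 0 then 1 else 0)"

lemma lin_support_projection: "lin (support_projection I)"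
  unfolding support_projection_def by (rule lin_diagonal)

lemma support_projection_monomial:
  "support_projection I (monomial \<gamma>) = (if \<forall>i\<in>I. lookup \<gamma> i = 0 then monomial \<gamma> else 0)"
  by (simp add: support_projection_def diagonal_monomial)

text \<open>As x_i H_i^-1 integrates in x_i, integrating a derivative loses exactly the part
  constant in x_i. The identity puts the projection into the Jacobian algebra and later reconstructs
  torsion elements from their derivatives.\<close>

lemma x_H_inv_d:
  "x_op i \<circ> H_inv i \<circ> d_op i = id - (support_projection {i} :: ('n::finite, 'k::field_char_0) operator)"
proof (rule linear_operator_eqI)
  fix \<gamma> :: "'n exponent"
  have e: "\<gamma> - unit_exponent i + unit_exponent i = \<gamma>" if "lookup \<gamma> i \<noteq> 0"
    by (rule exponent_eqI) (use that in \<open>auto simp: lookup_minus lookup_add lookup_unit\<close>)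
  show "(x_op i \<circ> H_inv i \<circ> d_op i) (monomial \<gamma>) =
      (id - support_projection {i} :: ('n, 'k) operator) (monomial \<gamma>)"
  proof (cases "lookup \<gamma> i")
    case 0
    then show ?thesis
      by (simp add: d_op_monomial support_projection_monomial lin_app_zero[OF linear_H_inv]
          lin_app_zero[OF linear_x_op])
  next
    case (Suc m)
    have nz: "of_nat (Suc m) \<noteq> (0 :: 'k)" unfolding of_nat_eq_0_iff by simp
    have m: "lookup (\<gamma> - unit_exponent i) i + 1 = Suc m" using Suc by (simp add: lookup_minus lookup_unit)
    have "(x_op i \<circ> H_inv i \<circ> d_op i) (monomial \<gamma>) =
        scale (of_nat (Suc m) * inverse (of_nat (Suc m))) (monomial \<gamma> :: ('n, 'k) polynomial)"
      using e Suc
      by (simp only: comp_apply d_op_monomial lin_app_scale[OF linear_H_inv] lin_app_scale[OF linear_x_op]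
          H_inv_monomial m x_op_monomial pol.scale_scale nat.distinct not_False_eq_True)
    also have "\<dots> = monomial \<gamma>" unfolding right_inverse[OF nz] by simp
    finally show ?thesis using Suc by (simp add: support_projection_monomial)
  qed
next
  show "lin (id - support_projection {i} :: ('n, 'k) operator)"
    using pol_pair.linear_compose_sub[OF lin_id lin_diagonal]
    unfolding support_projection_def fun_diff_def by blast
qed (intro lin_comp linear_x_op linear_H_inv linear_d_op)+

lemma support_projection_jac: "support_projection I \<in> (jac.alg :: ('n::finite, 'k::field_char_0) operator set)"
proof -
  have "finite I" by simp
  then show ?thesis
  proof induction
    case empty
    have "support_projection {} = (id :: ('n, 'k) operator)"
      by (simp add: support_projection_def diagonal_1)
    then show ?case using jac.id_alg by (simp only:)
  next
    case (insert i I)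
    have "support_projection {i} = id - (x_op i \<circ> H_inv i \<circ> d_op i :: ('n, 'k) operator)"
      unfolding x_H_inv_d by simp
    also have "\<dots> \<in> jac.alg"
      by (intro jac.diff_alg jac.id_alg jac.comp_alg x_jac H_inv_jac d_jac)
    finally have "support_projection {i} \<in> (jac.alg :: ('n, 'k) operator set)" .
    moreover have "support_projection (insert i I) =
        (support_projection {i} \<circ> support_projection I :: ('n, 'k) operator)"
      unfolding support_projection_def diagonal_comp by (rule arg_cong[of _ _ diagonal]) auto
    ultimately show ?case using jac.comp_alg insert.IH by (simp only:)
  qed
qed

lemma x_power_jac: "x_power \<alpha> \<in> jac.alg"
  using x_power_weyl weyl_subset_jac by blast

text \<open>On powers of x_i, the derivative d_i^l kills those below l, the projection then kills
  those above l, and x_i^k raises what is left. The constant \<open>falling ?l ?l\<close> is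
  l!.\<close>

lemma matrix_unit_at_jac:
  "matrix_unit_at i k l \<in> (jac.alg :: ('n::finite, 'k::field_char_0) operator set)"
proof -
  let ?l = "Poly_Mapping.single i l :: 'n exponent" and ?k = "Poly_Mapping.single i k :: 'n exponent"
  let ?c = "inverse (falling ?l ?l) :: 'k"
  have falling: "falling ?l \<gamma> = (falling ?l ?l :: 'k)" if "lookup \<gamma> i = l" for \<gamma>
    unfolding falling_def by (rule prod.cong) (use that in \<open>auto simp: lookup_single when_def\<close>)
  have nz: "falling ?l ?l \<noteq> (0 :: 'k)" by (simp add: falling_eq_0_iff)
  have "matrix_unit_at i k l =
      (\<lambda>p. scale ?c ((x_power ?k \<circ> support_projection {i} \<circ> d_power ?l :: ('n, 'k) operator) p))"
  proof (rule linear_operator_eqI[OF lin_matrix_unit_at])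
    fix \<gamma> :: "'n exponent"
    have "(x_power ?k \<circ> support_projection {i} \<circ> d_power ?l) (monomial \<gamma>) =
        scale (falling ?l \<gamma>) (if lookup \<gamma> i \<le> l then monomial (?k + (\<gamma> - ?l)) else (0 :: ('n, 'k) polynomial))"
      by (simp add: d_power_monomial lin_app_scale[OF lin_x_power] lin_app_scale[OF lin_support_projection]
          support_projection_monomial
          lookup_minus x_power_monomial lin_app_zero[OF lin_x_power])
    also have "\<dots> = scale (falling ?l ?l) (matrix_unit_at i k l (monomial \<gamma>))"
    proof (cases "lookup \<gamma> i = l")
      case True
      have "?k + (\<gamma> - ?l) = Poly_Mapping.update i k \<gamma>"
        by (rule exponent_eqI)
          (use True in \<open>auto simp: lookup_add lookup_minus lookup_single lookup_update when_def\<close>)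
      then show ?thesis using True falling[OF True] by (simp add: matrix_unit_at_monomial)
    next
      case False
      then have "falling ?l \<gamma> = (0 :: 'k)" if "lookup \<gamma> i \<le> l"
        unfolding falling_eq_0_iff using that by (intro exI[of _ i]) simp
      then show ?thesis using False by (simp add: matrix_unit_at_monomial)
    qed
    finally show "matrix_unit_at i k l (monomial \<gamma>) =
        scale ?c ((x_power ?k \<circ> support_projection {i} \<circ> d_power ?l :: ('n, 'k) operator) (monomial \<gamma>))"
      using nz by simp
  qed (intro lin_scale_op lin_comp lin_x_power lin_d_power lin_support_projection)
  moreover have "x_power ?k \<circ> support_projection {i} \<circ> d_power ?l \<in> (jac.alg :: ('n, 'k) operator set)"
    by (intro jac.comp_alg x_power_jac support_projection_jac d_power_jac)
  ultimately show ?thesis using jac.smult_alg by (simp only:)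
qed

text \<open>Otherwise \<open>monomial 0\<close> would be rewritten to 1 and facts about monomials
  would no longer match.\<close>

declare Poly_Mapping.single_one [simp del]

lemma matrix_unit_jac:
  "matrix_unit \<alpha> \<beta> \<in> (jac.alg :: ('n::finite, 'k::field_char_0) operator set)"
proof -
  let ?c = "inverse (falling \<beta> \<beta>) :: 'k"
  have nz: "falling \<beta> \<beta> \<noteq> (0 :: 'k)" by (simp add: falling_eq_0_iff)
  have "matrix_unit \<alpha> \<beta> =
      (\<lambda>p. scale ?c ((x_power \<alpha> \<circ> support_projection UNIV \<circ> d_power \<beta> :: ('n, 'k) operator) p))"
  proof (rule linear_operator_eqI[OF lin_matrix_unit])
    fix \<gamma> :: "'n exponent"
    have z: "(\<forall>i. lookup (\<gamma> - \<beta>) i = 0) \<longleftrightarrow> \<gamma> - \<beta> = 0"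
      by (metis exponent_eqI lookup_zero)
    have "(x_power \<alpha> \<circ> support_projection UNIV \<circ> d_power \<beta>) (monomial \<gamma>) =
        scale (falling \<beta> \<gamma>) (if \<gamma> - \<beta> = 0 then monomial \<alpha> else (0 :: ('n, 'k) polynomial))"
      by (simp add: d_power_monomial lin_app_scale[OF lin_x_power] lin_app_scale[OF lin_support_projection]
          support_projection_monomial
          z x_power_monomial lin_app_zero[OF lin_x_power])
    also have "\<dots> = scale (falling \<beta> \<beta>) (matrix_unit \<alpha> \<beta> (monomial \<gamma>))"
    proof (cases "\<gamma> = \<beta>")
      case True
      then show ?thesis by (simp add: matrix_unit_monomial)
    next
      case False
      \<comment> \<open>A vanishing truncated difference only says \<gamma> \<le> \<beta>; the
        falling factorial supplies the opposite inequality.\<close>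
      have "falling \<beta> \<gamma> = (0 :: 'k)" if 0: "\<gamma> - \<beta> = 0"
      proof (rule ccontr)
        assume "falling \<beta> \<gamma> \<noteq> (0 :: 'k)"
        then have "lookup \<beta> i \<le> lookup \<gamma> i" for i unfolding falling_eq_0_iff by (simp add: not_less)
        moreover have "lookup \<gamma> i - lookup \<beta> i = 0" for i
          using 0 by (metis lookup_minus lookup_zero)
        ultimately have "\<gamma> = \<beta>" by (intro exponent_eqI) (simp add: le_antisym)
        then show False using False by blast
      qed
      then show ?thesis using False by (simp add: matrix_unit_monomial)
    qed
    finally show "matrix_unit \<alpha> \<beta> (monomial \<gamma>) =
        scale ?c ((x_power \<alpha> \<circ> support_projection UNIV \<circ> d_power \<beta> :: ('n, 'k) operator) (monomial \<gamma>))"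
      using nz by simp
  qed (intro lin_scale_op lin_comp lin_x_power lin_d_power lin_support_projection)
  moreover have "x_power \<alpha> \<circ> support_projection UNIV \<circ> d_power \<beta> \<in> (jac.alg :: ('n, 'k) operator set)"
    by (intro jac.comp_alg x_power_jac support_projection_jac d_power_jac)
  ultimately show ?thesis using jac.smult_alg by (simp only:)
qed

lemma F_ideal_jac: "F_ideal \<subseteq> jac.alg"
  unfolding F_ideal_def operator_span_eq
  by (rule jac.span_alg) (use matrix_unit_jac in blast)

section \<open>Regularity on right modules\<close>

lemma matrix_unit_app: "matrix_unit \<alpha> \<beta> p = scale (lookup p \<beta>) (monomial \<alpha>)"
proof (rule poly_mapping_eqI)
  fix \<gamma>
  have "lookup (matrix_unit \<alpha> \<beta> p) \<gamma> =
      (\<Sum>\<delta>\<in>Poly_Mapping.keys p. if \<delta> = \<beta> then lookup p \<beta> * lookup (monomial \<alpha>) \<gamma> else 0)"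
    unfolding matrix_unit_def linear_extension_def lookup_sum lookup_scale
    by (rule sum.cong) auto
  also have "\<dots> = lookup p \<beta> * lookup (monomial \<alpha>) \<gamma>" by (auto simp: in_keys_iff)
  finally show "lookup (matrix_unit \<alpha> \<beta> p) \<gamma> = lookup (scale (lookup p \<beta>) (monomial \<alpha>)) \<gamma>"
    by (simp only: lookup_scale)
qed

abbreviation row_action :: "('n::finite, 'k::field_char_0) operator \<Rightarrow> ('n, 'k) operator" where
  "row_action r \<equiv> (\<lambda>m. P'_act m r)"

context
  fixes r :: "('n::finite, 'k::field_char_0) operator"
  assumes r: "r \<in> jac.alg"
begin

lemma row_action_mult: "right_multiplication r (row_action r)"
  by (rule right_multiplication_P'_act) (use r in \<open>simp only: algebra_eqs\<close>)

lemma lin_row_action: "lin (row_action r)"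
  and row_action_transpose: "exponent_fact \<beta> * lookup (row_action r (monomial \<alpha>)) \<beta> =
    exponent_fact \<alpha> * lookup (r (monomial \<beta>)) \<alpha>"
  using right_multiplication_transpose[OF row_action_mult] by blast+

lemma row_action_eq_0_iff: "row_action r (monomial \<alpha>) = 0 \<longleftrightarrow> (\<forall>\<beta>. lookup (r (monomial \<beta>)) \<alpha> = 0)"
proof -
  have "lookup (row_action r (monomial \<alpha>)) \<beta> = 0 \<longleftrightarrow> lookup (r (monomial \<beta>)) \<alpha> = 0" for \<beta>
    using row_action_transpose[of \<beta> \<alpha>] exponent_fact_nonzero[of \<alpha>, where ?'k = 'k]
      exponent_fact_nonzero[of \<beta>, where ?'k = 'k] by (metis mult_eq_0_iff)
  moreover have "row_action r (monomial \<alpha>) = 0 \<longleftrightarrow> (\<forall>\<beta>. lookup (row_action r (monomial \<alpha>)) \<beta> = 0)"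
    by (metis lookup_zero poly_mapping_eqI)
  ultimately show ?thesis by blast
qed

text \<open>Faithfulness of the module: all matrix entries of r can be read off from the right
  action.\<close>

lemma row_action_zeroD:
  assumes "\<And>\<alpha>. row_action r (monomial \<alpha>) = 0" shows "r = 0"
proof (rule linear_eq_zeroI[OF jac.lin_alg[OF r]])
  fix \<gamma>
  show "r (monomial \<gamma>) = 0"
    by (rule poly_mapping_eqI) (use assms row_action_eq_0_iff in simp)
qed

text \<open>Up to factorials, a row of the infinite matrix of r is the image of a monomial under the
  right action, hence finitely supported. A general linear operator has finite columns only.\<close>

lemma finite_row: "finite {\<gamma>. lookup (r (monomial \<gamma>)) \<alpha> \<noteq> 0}"
proof (rule finite_subset)
  show "{\<gamma>. lookup (r (monomial \<gamma>)) \<alpha> \<noteq> 0} \<subseteq> Poly_Mapping.keys (row_action r (monomial \<alpha>))"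
  proof
    fix \<gamma> assume "\<gamma> \<in> {\<gamma>. lookup (r (monomial \<gamma>)) \<alpha> \<noteq> 0}"
    then have "exponent_fact \<gamma> * lookup (row_action r (monomial \<alpha>)) \<gamma> \<noteq> 0"
      unfolding row_action_transpose using exponent_fact_nonzero[of \<alpha>, where ?'k = 'k] by simp
    then show "\<gamma> \<in> Poly_Mapping.keys (row_action r (monomial \<alpha>))" by (simp add: in_keys_iff)
  qed
qed simp

end

lemma row_action_comp:
  assumes "r \<in> jac.alg" "s \<in> jac.alg"
  shows "P'_act m (r \<circ> s) = P'_act (P'_act m r) s"
  using fun_cong[OF right_multiplication_unique[OF row_action_mult[OF jac.comp_alg[OF assms]]
        right_multiplication.rm_mult[OF assms[THEN row_action_mult]]], of m] by simp

lemma jacobian_ops: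
  "carrier jacobian_algebra = jac.alg" "\<one>\<^bsub>jacobian_algebra\<^esub> = id" "\<zero>\<^bsub>jacobian_algebra\<^esub> = 0"
  "f \<otimes>\<^bsub>jacobian_algebra\<^esub> g = f \<circ> g" "f \<oplus>\<^bsub>jacobian_algebra\<^esub> g = f + g"
  unfolding algebra_eqs by (rule refl generated_algebra_simps)+

lemma left_regular_jacobian_iff:
  "c \<in> left_regular_elements jacobian_algebra \<longleftrightarrow> c \<in> jac.alg \<and> (\<forall>r\<in>jac.alg. r \<circ> c = 0 \<longrightarrow> r = 0)"
  unfolding left_regular_elements_def jacobian_ops by simp

text \<open>The matrix whose row 0 is q and whose other rows vanish; being a finite combination of
  matrix units, it lies in F_n.\<close>

definition row_operator :: "('n::finite, 'k::field_char_0) polynomial \<Rightarrow> ('n, 'k) operator" where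
  "row_operator q =
    (\<Sum>\<beta>\<in>Poly_Mapping.keys q. (\<lambda>p. scale (lookup q \<beta>) (matrix_unit 0 \<beta> p)))"

lemma row_operator_span: "row_operator q \<in> F_ideal"
  unfolding row_operator_def F_ideal_def operator_span_eq
  by (intro op.span_sum op.span_scale op.span_base) blast

lemma row_operator_monomial: "row_operator q (monomial \<gamma>) = scale (lookup q \<gamma>) (monomial 0)"
proof -
  have "row_operator q (monomial \<gamma>) =
      (\<Sum>\<beta>\<in>Poly_Mapping.keys q. if \<beta> = \<gamma> then scale (lookup q \<gamma>) (monomial 0) else 0)"
    unfolding row_operator_def sum_fun_app matrix_unit_monomial by (rule sum.cong) auto
  then show ?thesis by (simp add: in_keys_iff)
qed

text \<open>One inclusion is faithfulness: r c = 0 makes every m r vanish. For the other, each q is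
  the image of the generator 1 under some r that kills all other monomials; if q c = 0, then r c =
  0, so r = 0 and q = 0.\<close>

lemma regular_on_P'_act:
  "regular_on_right_module jacobian_algebra UNIV P'_act =
    (left_regular_elements jacobian_algebra :: ('n::finite, 'k::field_char_0) operator set)"
proof (intro subset_antisym subsetI)
  fix c :: "('n, 'k) operator"
  assume "c \<in> regular_on_right_module jacobian_algebra UNIV P'_act"
  then have c: "c \<in> jac.alg" "inj (row_action c)"
    unfolding regular_on_right_module_def jacobian_ops by auto
  have "r = 0" if r: "r \<in> jac.alg" "r \<circ> c = 0" for r
  proof (rule row_action_zeroD[OF r(1)])
    fix \<alpha>
    have "row_action c (row_action r (monomial \<alpha>)) = row_action (r \<circ> c) (monomial \<alpha>)"
      by (rule row_action_comp[OF r(1) c(1), symmetric])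
    also have "\<dots> = 0"
      unfolding row_action_eq_0_iff[OF jac.comp_alg[OF r(1) c(1)]] unfolding r(2) by simp
    also have "\<dots> = row_action c 0"
      by (rule lin_app_zero[OF lin_row_action[OF c(1)], symmetric])
    finally show "row_action r (monomial \<alpha>) = 0" by (rule injD[OF c(2)])
  qed
  then show "c \<in> left_regular_elements jacobian_algebra"
    unfolding left_regular_jacobian_iff using c(1) by blast
next
  fix c :: "('n, 'k) operator"
  assume "c \<in> left_regular_elements jacobian_algebra"
  then have c: "c \<in> jac.alg" "\<And>r. \<lbrakk>r \<in> jac.alg; r \<circ> c = 0\<rbrakk> \<Longrightarrow> r = 0"
    unfolding left_regular_jacobian_iff by auto
  have "inj (row_action c)"
  proof (rule injI)
    fix m m' :: "('n, 'k) polynomial"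
    assume eq: "row_action c m = row_action c m'"
    define q where "q = m - m'"
    have q: "row_action c q = 0"
      unfolding q_def using pol_pair.linear_diff[OF lin_row_action[OF c(1)], of m m'] eq by simp
    \<comment> \<open>The rescaling compensates the factorials of the transpose relation, so that 1
      is sent exactly to q.\<close>
    define q' where "q' = diagonal exponent_fact q"
    have r: "row_operator q' \<in> (jac.alg :: ('n, 'k) operator set)"
      using row_operator_span F_ideal_jac by blast
    have 0: "row_action (row_operator q') (monomial 0) = q"
    proof (rule poly_mapping_eqI)
      fix \<beta>
      have "exponent_fact \<beta> * lookup (row_action (row_operator q') (monomial 0)) \<beta> =
          exponent_fact \<beta> * lookup q \<beta>"
        unfolding row_action_transpose[OF r]
        unfolding row_operator_monomial lookup_scale q'_def lookup_diagonal
        by (simp add: lookup_monomial exponent_fact_def)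
      then show "lookup (row_action (row_operator q') (monomial 0)) \<beta> = lookup q \<beta>"
        using exponent_fact_nonzero[of \<beta>, where ?'k = 'k] by simp
    qed
    have "row_action (row_operator q' \<circ> c) (monomial \<alpha>) = 0" for \<alpha>
    proof (cases "\<alpha> = 0")
      case True
      show ?thesis unfolding row_action_comp[OF r c(1)] True 0 by (rule q)
    next
      case False
      then have "row_action (row_operator q') (monomial \<alpha>) = 0"
        unfolding row_action_eq_0_iff[OF r] row_operator_monomial
        by (simp add: lookup_scale lookup_monomial)
      then show ?thesis
        unfolding row_action_comp[OF r c(1)] by (simp only: lin_app_zero[OF lin_row_action[OF c(1)]])
    qed
    then have "row_operator q' \<circ> c = 0" by (rule row_action_zeroD[OF jac.comp_alg[OF r c(1)]])
    then have "row_operator q' = 0" by (rule c(2)[OF r])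
    then have "row_action (row_operator q') (monomial 0) = 0"
      unfolding row_action_eq_0_iff[OF r] by simp
    then show "m = m'" unfolding 0 q_def by simp
  qed
  then show "c \<in> regular_on_right_module jacobian_algebra UNIV P'_act"
    unfolding regular_on_right_module_def jacobian_ops using c(1) by blast
qed

lemma regular_on_F_ideal:
  "regular_on_right_module jacobian_algebra F_ideal (\<otimes>\<^bsub>jacobian_algebra\<^esub>) =
    (left_regular_elements jacobian_algebra :: ('n::finite, 'k::field_char_0) operator set)"
proof (intro subset_antisym subsetI)
  fix c :: "('n, 'k) operator"
  assume "c \<in> regular_on_right_module jacobian_algebra F_ideal (\<otimes>\<^bsub>jacobian_algebra\<^esub>)"
  then have c: "c \<in> jac.alg" "inj_on (\<lambda>m. m \<circ> c) F_ideal"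
    unfolding regular_on_right_module_def jacobian_ops by auto
  have "r = 0" if r: "r \<in> jac.alg" "r \<circ> c = 0" for r
  proof (rule ccontr)
    assume "r \<noteq> 0"
    then obtain \<beta> where "r (monomial \<beta>) \<noteq> 0" using linear_eq_zeroI[OF jac.lin_alg[OF r(1)]] by blast
    then obtain \<alpha> where \<alpha>: "lookup (r (monomial \<beta>)) \<alpha> \<noteq> 0" by (metis lookup_zero poly_mapping_eqI)
    \<comment> \<open>The row through the nonzero entry; it is a polynomial because rows are
      finite.\<close>
    define q where "q = Poly_Mapping.Abs_poly_mapping (\<lambda>\<gamma>. lookup (r (monomial \<gamma>)) \<alpha>)"
    have q: "lookup q \<gamma> = lookup (r (monomial \<gamma>)) \<alpha>" for \<gamma>
      unfolding q_def using finite_row[OF r(1)] by (simp add: Abs_poly_mapping_inverse)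
    have lin_row: "lin (row_operator q)"
      using row_operator_span F_ideal_jac jac.lin_alg by blast
    have m: "matrix_unit 0 \<alpha> \<circ> r = row_operator q"
      by (rule linear_operator_eqI[OF lin_comp[OF lin_matrix_unit jac.lin_alg[OF r(1)]] lin_row])
        (simp only: comp_apply matrix_unit_app row_operator_monomial q)
    have "row_operator q \<circ> c = matrix_unit 0 \<alpha> \<circ> (r \<circ> c)" unfolding m[symmetric] by (rule comp_assoc)
    also have "\<dots> = 0 \<circ> c" unfolding r(2) comp_zero_right[OF lin_matrix_unit] comp_zero_left ..
    finally have "row_operator q = 0"
      using inj_onD[OF c(2) _ row_operator_span] op.span_zero
      unfolding F_ideal_def operator_span_eq by blast
    then have "scale (lookup q \<beta>) (monomial 0) = (0 :: ('n, 'k) polynomial)"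
      unfolding row_operator_monomial[symmetric] by simp
    then have "lookup q \<beta> * lookup (monomial 0 :: ('n, 'k) polynomial) 0 = 0"
      by (metis lookup_scale lookup_zero)
    then show False using \<alpha> q by (simp add: lookup_monomial)
  qed
  then show "c \<in> left_regular_elements jacobian_algebra"
    unfolding left_regular_jacobian_iff using c(1) by blast
next
  fix c :: "('n, 'k) operator"
  assume "c \<in> left_regular_elements jacobian_algebra"
  then have c: "c \<in> jac.alg" "\<And>r. \<lbrakk>r \<in> jac.alg; r \<circ> c = 0\<rbrakk> \<Longrightarrow> r = 0"
    unfolding left_regular_jacobian_iff by auto
  have "inj_on (\<lambda>m. m \<circ> c) F_ideal"
  proof (rule inj_onI)
    fix m m' assume "m \<in> F_ideal" "m' \<in> F_ideal" and eq: "m \<circ> c = m' \<circ> c"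
    then have "m - m' \<in> jac.alg" using F_ideal_jac by (intro jac.diff_alg) auto
    moreover have "(m - m') \<circ> c = 0" using eq by (auto simp: fun_eq_iff)
    ultimately have "m - m' = 0" by (rule c(2))
    then show "m = m'" by simp
  qed
  then show "c \<in> regular_on_right_module jacobian_algebra F_ideal (\<otimes>\<^bsub>jacobian_algebra\<^esub>)"
    unfolding regular_on_right_module_def jacobian_ops using c(1) by blast
qed

section \<open>The elements of the ideal \<open>\<aa>\<^sub>n\<close>\<close>

interpretation setting: jacobian_setting
  "jacobian_algebra :: ('n::finite, 'k::field_char_0) operator_algebra"
  weyl.alg delta.alg "range d_power"
  by (rule jacobian_setting)

lemma torsion_iff_operator:
  "f \<in> setting.torsion \<longleftrightarrow> f \<in> jac.alg \<and> (\<exists>\<beta>. d_power \<beta> \<circ> f = 0)"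
  unfolding setting.torsion_def jacobian_ops by auto

section \<open>Commutation of operators in different variables\<close>

lemma x_op_commute: "x_op i \<circ> x_op j = (x_op j \<circ> x_op i :: ('n, 'k::field_char_0) operator)"
  by (simp add: fun_eq_iff x_op_def mult.left_commute)

lemma d_op_x_op_commute:
  "i \<noteq> j \<Longrightarrow> d_op i \<circ> x_op j = (x_op j \<circ> d_op i :: ('n::finite, 'k::field_char_0) operator)"
  by (simp add: d_op_x_op)

lemma H_inv_x_op_commute:
  assumes "i \<noteq> j"
  shows "H_inv i \<circ> x_op j = (x_op j \<circ> H_inv i :: ('n::finite, 'k::field_char_0) operator)"
proof (rule linear_operator_eqI)
  fix \<gamma> :: "'n exponent"
  have "lookup (\<gamma> + unit_exponent j) i = lookup \<gamma> i" using assms by (simp add: lookup_add lookup_unit)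
  then show "(H_inv i \<circ> x_op j) (monomial \<gamma>) =
      (x_op j \<circ> H_inv i :: ('n, 'k) operator) (monomial \<gamma>)"
    by (simp only: comp_apply x_op_monomial H_inv_monomial lin_app_scale[OF linear_x_op])
qed (intro lin_comp linear_H_inv linear_x_op)+

lemma H_inv_d_op_commute:
  assumes "i \<noteq> j"
  shows "H_inv i \<circ> d_op j = (d_op j \<circ> H_inv i :: ('n::finite, 'k::field_char_0) operator)"
proof (rule linear_operator_eqI)
  fix \<gamma> :: "'n exponent"
  have "lookup (\<gamma> - unit_exponent j) i = lookup \<gamma> i" using assms by (simp add: lookup_minus lookup_unit)
  then show "(H_inv i \<circ> d_op j) (monomial \<gamma>) =
      (d_op j \<circ> H_inv i :: ('n, 'k) operator) (monomial \<gamma>)"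
    by (simp only: comp_apply d_op_monomial H_inv_monomial lin_app_scale[OF linear_d_op]
        lin_app_scale[OF linear_H_inv] pol.scale_scale mult.commute)
qed (intro lin_comp linear_H_inv linear_d_op)+

lemma H_inv_commute: "H_inv i \<circ> H_inv j = (H_inv j \<circ> H_inv i :: ('n, 'k::field_char_0) operator)"
  unfolding H_inv_diagonal diagonal_comp by (simp only: mult.commute)

section \<open>Matrix units in one variable\<close>

lemma F_at_eq: "F_at i = op.span {matrix_unit_at i k l | k l. True}"
  unfolding F_at_def operator_span_eq ..

lemma matrix_unit_at_F: "matrix_unit_at i k l \<in> F_at i"
  unfolding F_at_eq by (rule op.span_base) blast

lemma F_at_scale: "f \<in> F_at i \<Longrightarrow> (\<lambda>p. scale c (f p)) \<in> F_at i"
  unfolding F_at_eq by (rule op.span_scale)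

lemma F_at_jac: "F_at i \<subseteq> jac.alg"
  unfolding F_at_eq by (rule jac.span_alg) (use matrix_unit_at_jac in blast)

lemma update_add_unit:
  "Poly_Mapping.update i k (\<gamma> + unit_exponent i) = Poly_Mapping.update i k \<gamma>"
  "Poly_Mapping.update i k (\<gamma> - unit_exponent i) = Poly_Mapping.update i k \<gamma>"
  "Poly_Mapping.update i k \<gamma> + unit_exponent i = Poly_Mapping.update i (k + 1) \<gamma>"
  "i \<noteq> j \<Longrightarrow> Poly_Mapping.update i k (\<gamma> + unit_exponent j) = Poly_Mapping.update i k \<gamma> + unit_exponent j"
  by (rule exponent_eqI; auto simp: lookup_update lookup_add lookup_minus lookup_unit)+

lemma matrix_unit_at_x_op:
  "matrix_unit_at i k l \<circ> x_op i =
    (if l = 0 then 0 else matrix_unit_at i k (l - 1) :: ('n::finite, 'k::field_char_0) operator)"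
proof (rule linear_operator_eqI)
  fix \<gamma> :: "'n exponent"
  show "(matrix_unit_at i k l \<circ> x_op i) (monomial \<gamma>) =
      (if l = 0 then 0 else matrix_unit_at i k (l - 1) :: ('n, 'k) operator) (monomial \<gamma>)"
    by (auto simp: x_op_monomial matrix_unit_at_monomial update_add_unit lookup_add lookup_unit)
qed (auto intro!: lin_comp lin_matrix_unit_at linear_x_op lin_zero)

lemma matrix_unit_at_d_op:
  "matrix_unit_at i k l \<circ> d_op i =
    ((\<lambda>p. scale (of_nat (l + 1)) (matrix_unit_at i k (l + 1) p)) :: ('n::finite, 'k::field_char_0) operator)"
proof (rule linear_operator_eqI)
  fix \<gamma> :: "'n exponent"
  show "(matrix_unit_at i k l \<circ> d_op i) (monomial \<gamma>) =
      scale (of_nat (l + 1)) (matrix_unit_at i k (l + 1) (monomial \<gamma>) :: ('n, 'k) polynomial)"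
    by (cases "lookup \<gamma> i = 0") (auto simp: d_op_monomial matrix_unit_at_monomial update_add_unit
        lookup_minus lookup_unit lin_app_scale[OF lin_matrix_unit_at] lin_app_zero[OF lin_matrix_unit_at])
qed (intro lin_scale_op lin_comp lin_matrix_unit_at linear_d_op)+

lemma matrix_unit_at_H_inv:
  "matrix_unit_at i k l \<circ> H_inv i =
    ((\<lambda>p. scale (inverse (of_nat (l + 1))) (matrix_unit_at i k l p)) :: ('n::finite, 'k::field_char_0) operator)"
proof (rule linear_operator_eqI)
  fix \<gamma> :: "'n exponent"
  show "(matrix_unit_at i k l \<circ> H_inv i) (monomial \<gamma>) =
      scale (inverse (of_nat (l + 1))) (matrix_unit_at i k l (monomial \<gamma>) :: ('n, 'k) polynomial)"
    by (auto simp: H_inv_monomial matrix_unit_at_monomial lin_app_scale[OF lin_matrix_unit_at])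
qed (intro lin_scale_op lin_comp lin_matrix_unit_at linear_H_inv)+

lemma F_at_comp:
  assumes "f \<in> F_at i" "c \<in> {x_op i, d_op i, H_inv i}"
  shows "f \<circ> c \<in> (F_at i :: ('n::finite, 'k::field_char_0) operator set)"
  unfolding F_at_eq
proof (rule comp_span_left[OF assms(1)[unfolded F_at_eq]], fold F_at_eq)
  fix b :: "('n, 'k) operator" assume "b \<in> {matrix_unit_at i k l | k l. True}"
  then obtain k l where b: "b = matrix_unit_at i k l" by blast
  have "0 \<in> (F_at i :: ('n, 'k) operator set)" unfolding F_at_eq by (rule op.span_zero)
  then have "b \<circ> x_op i \<in> F_at i"
    unfolding b matrix_unit_at_x_op using matrix_unit_at_F by (cases "l = 0") (simp_all only: if_True if_False refl)
  moreover have "b \<circ> d_op i \<in> F_at i" "b \<circ> H_inv i \<in> F_at i"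
    unfolding b matrix_unit_at_d_op matrix_unit_at_H_inv by (intro F_at_scale matrix_unit_at_F)+
  ultimately show "b \<circ> c \<in> F_at i" using assms(2) by blast
qed

text \<open>Integration in x_i: it sends x^\<gamma> to x^(\<gamma> + e_i) divided by \<gamma>_i + 1,
  and is a right inverse of d_i.\<close>

abbreviation x_H_inv :: "'n::finite \<Rightarrow> ('n, 'k::field_char_0) operator" where
  "x_H_inv i \<equiv> x_op i \<circ> H_inv i"

lemma lin_x_H_inv: "lin (x_H_inv i)"
  by (intro lin_comp linear_x_op linear_H_inv)

lemma x_H_inv_monomial:
  "x_H_inv i (monomial \<gamma>) = scale (inverse (of_nat (lookup \<gamma> i + 1))) (monomial (\<gamma> + unit_exponent i))"
  by (simp only: comp_apply H_inv_monomial lin_app_scale[OF linear_x_op] x_op_monomial)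

lemma x_H_inv_matrix_unit_at:
  "x_H_inv i \<circ> matrix_unit_at i k l = ((\<lambda>p. scale (inverse (of_nat (k + 1)))
    (matrix_unit_at i (k + 1) l p)) :: ('n::finite, 'k::field_char_0) operator)"
proof (rule linear_operator_eqI)
  fix \<gamma> :: "'n exponent"
  show "(x_H_inv i \<circ> matrix_unit_at i k l) (monomial \<gamma>) =
      scale (inverse (of_nat (k + 1))) (matrix_unit_at i (k + 1) l (monomial \<gamma>) :: ('n, 'k) polynomial)"
  proof (cases "lookup \<gamma> i = l")
    case True
    have k: "lookup (Poly_Mapping.update i k \<gamma>) i = k" by (simp add: lookup_update)
    have "(x_H_inv i \<circ> matrix_unit_at i k l) (monomial \<gamma>) =
        x_H_inv i (monomial (Poly_Mapping.update i k \<gamma>) :: ('n, 'k) polynomial)"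
      using True by (simp add: matrix_unit_at_monomial)
    then show ?thesis
      using True unfolding x_H_inv_monomial k update_add_unit by (simp add: matrix_unit_at_monomial)
  next
    case False
    then show ?thesis
      by (simp add: matrix_unit_at_monomial lin_app_zero[OF linear_x_op] lin_app_zero[OF linear_H_inv])
  qed
qed (intro lin_scale_op lin_comp lin_matrix_unit_at linear_H_inv linear_x_op)+

lemma x_H_inv_matrix_unit_at_commute:
  assumes "i \<noteq> j"
  shows "x_H_inv j \<circ> matrix_unit_at i k l =
    (matrix_unit_at i k l \<circ> x_H_inv j :: ('n::finite, 'k::field_char_0) operator)"
proof (rule linear_operator_eqI)
  fix \<gamma> :: "'n exponent"
  have j: "lookup (Poly_Mapping.update i k \<gamma>) j = lookup \<gamma> j"
    "lookup (\<gamma> + unit_exponent j) i = lookup \<gamma> i"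
    using assms by (simp_all add: lookup_update lookup_add lookup_unit)
  have "(matrix_unit_at i k l \<circ> x_H_inv j) (monomial \<gamma>) = scale (inverse (of_nat (lookup \<gamma> j + 1)))
      (matrix_unit_at i k l (monomial (\<gamma> + unit_exponent j)) :: ('n, 'k) polynomial)"
    unfolding comp_apply[of "matrix_unit_at i k l"] x_H_inv_monomial by (rule lin_app_scale[OF lin_matrix_unit_at])
  moreover have "(x_H_inv j \<circ> matrix_unit_at i k l) (monomial \<gamma>) = (if lookup \<gamma> i = l then
      x_H_inv j (monomial (Poly_Mapping.update i k \<gamma>)) else 0 :: ('n, 'k) polynomial)"
    by (simp add: matrix_unit_at_monomial lin_app_zero[OF linear_x_op] lin_app_zero[OF linear_H_inv])
  ultimately show "(x_H_inv j \<circ> matrix_unit_at i k l) (monomial \<gamma>) =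
      (matrix_unit_at i k l \<circ> x_H_inv j :: ('n, 'k) operator) (monomial \<gamma>)"
    unfolding x_H_inv_monomial j matrix_unit_at_monomial update_add_unit(4)[OF assms] by simp
qed (intro lin_comp lin_matrix_unit_at linear_H_inv linear_x_op)+

lemma x_H_inv_F_at_commute:
  assumes "i \<noteq> j" "f \<in> F_at i"
  shows "x_H_inv j \<circ> f = (f \<circ> x_H_inv j :: ('n::finite, 'k::field_char_0) operator)"
  using assms(2) unfolding F_at_eq
proof (induction rule: op.span_induct_alt)
  case base
  show ?case unfolding comp_zero_left by (rule comp_zero_right[OF lin_x_H_inv])
next
  case (step c f g)
  then obtain k l where f: "f = matrix_unit_at i k l" by blast
  show ?case
    unfolding comp_add_right[OF lin_x_H_inv] comp_add_left comp_scale_right[OF lin_x_H_inv]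
      comp_scale_left step f x_H_inv_matrix_unit_at_commute[OF assms(1)] ..
qed

lemma x_H_inv_F_at:
  assumes "f \<in> F_at i"
  shows "x_H_inv i \<circ> f \<in> (F_at i :: ('n::finite, 'k::field_char_0) operator set)"
  unfolding F_at_eq
proof (rule comp_span_right[OF assms[unfolded F_at_eq] _ lin_x_H_inv], fold F_at_eq)
  fix b :: "('n, 'k) operator" assume "b \<in> {matrix_unit_at i k l | k l. True}"
  then obtain k l where b: "b = matrix_unit_at i k l" by blast
  show "x_H_inv i \<circ> b \<in> F_at i"
    unfolding b x_H_inv_matrix_unit_at by (intro F_at_scale matrix_unit_at_F)
qed

section \<open>The ideal of a single tensor factor\<close>

context
  fixes i :: "'n::finite"
begin

interpretation others: operator_generators
  "x_op ` (- {i}) \<union> d_op ` (- {i}) \<union> H_inv ` (- {i}) :: ('n, 'k::field_char_0) operator set"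
  by unfold_locales (auto intro: linear_x_op linear_d_op linear_H_inv)

lemma others_eq: "carrier (jacobian_algebra_on (- {i})) = others.alg"
  by (simp only: jacobian_algebra_on_def)

lemma others_jac: "others.alg \<subseteq> jac.alg"
proof
  show "b \<in> jac.alg" if "b \<in> others.alg" for b :: "('n, 'k::field_char_0) operator"
    using that
  proof (induction rule: others.alg_induct)
    case (gen x)
    then show ?case using d_jac x_jac H_inv_jac by blast
  qed (intro jac.scale_alg jac.add_alg jac.comp_alg; assumption)+
qed

lemma others_commute:
  assumes "b \<in> others.alg" "c \<in> {x_op i, d_op i, H_inv i :: ('n, 'k::field_char_0) operator}"
  shows "c \<circ> b = b \<circ> c"
proof -
  have c: "lin c" using assms(2) by (auto intro: linear_x_op linear_d_op linear_H_inv)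
  show ?thesis
    using assms(1)
  proof (induction rule: others.alg_induct)
    case (scalar a)
    show ?case by (simp add: fun_eq_iff lin_app_scale[OF c])
  next
    case (gen b)
    then obtain j where ji: "j \<noteq> i" and b: "b \<in> {x_op j, d_op j, H_inv j}" by auto
    note ij = ji[symmetric]
    note comm = x_op_commute d_op_commute H_inv_commute d_op_x_op_commute[OF ij]
      d_op_x_op_commute[OF ji] H_inv_x_op_commute[OF ij] H_inv_x_op_commute[OF ji]
      H_inv_d_op_commute[OF ij] H_inv_d_op_commute[OF ji]
    have "b = x_op j \<or> b = d_op j \<or> b = H_inv j" "c = x_op i \<or> c = d_op i \<or> c = H_inv i"
      using b assms(2) by simp_all
    then show ?case by - (elim disjE; hypsubst; rule comm comm[symmetric])
  next
    case (add r s)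
    show ?case unfolding comp_add_right[OF c] comp_add_left add(3,4) ..
  next
    case (comp r s)
    have "c \<circ> (r \<circ> s) = (c \<circ> r) \<circ> s" by (rule comp_assoc[symmetric])
    also have "\<dots> = r \<circ> (c \<circ> s)" unfolding comp(3) by (rule comp_assoc)
    also have "\<dots> = (r \<circ> s) \<circ> c" unfolding comp(4) by (rule comp_assoc[symmetric])
    finally show ?case .
  qed
qed

lemma p_ideal_eq: "p_ideal i = op.span {f \<circ> b | f b. f \<in> F_at i \<and> b \<in> others.alg}"
  unfolding p_ideal_def operator_span_eq others_eq ..

lemma p_ideal_jac: "p_ideal i \<subseteq> jac.alg"
  unfolding p_ideal_eq
  by (rule jac.span_alg) (use F_at_jac others_jac jac.comp_alg in blast)

lemma F_at_p_ideal: "f \<in> F_at i \<Longrightarrow> b \<in> others.alg \<Longrightarrow> f \<circ> b \<in> p_ideal i"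
  unfolding p_ideal_eq by (rule op.span_base) blast

text \<open>For a product f b of an element of F in the i-th factor and an operator in the other
  variables, a generator in x_i commutes past b and is absorbed by f, while any other generator is
  absorbed by b.\<close>

lemma p_ideal_comp:
  assumes "r \<in> jac.alg" "q \<in> p_ideal i"
  shows "q \<circ> r \<in> (p_ideal i :: ('n, 'k::field_char_0) operator set)"
  using assms
proof (induction r arbitrary: q rule: jac.alg_induct)
  case (scalar c)
  have "lin q" using scalar p_ideal_jac jac.lin_alg by blast
  then have "q \<circ> scale c = (\<lambda>p. scale c (q p))" by (simp add: fun_eq_iff lin_app_scale)
  also have "\<dots> \<in> p_ideal i" using scalar unfolding p_ideal_eq by (rule op.span_scale)
  finally show ?case .
next
  case (gen x)
  show ?case
    unfolding p_ideal_eq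
  proof (rule comp_span_left[OF gen(2)[unfolded p_ideal_eq]], fold p_ideal_eq)
    fix g :: "('n, 'k) operator" assume "g \<in> {f \<circ> b | f b. f \<in> F_at i \<and> b \<in> others.alg}"
    then obtain f b where fb: "g = f \<circ> b" "f \<in> F_at i" "b \<in> others.alg" by blast
    from gen(1) obtain j where j: "x \<in> {x_op j, d_op j, H_inv j}" by blast
    show "g \<circ> x \<in> p_ideal i"
    proof (cases "j = i")
      case True
      then have x: "x \<in> {x_op i, d_op i, H_inv i}" using j by simp
      have "g \<circ> x = (f \<circ> x) \<circ> b"
        unfolding fb(1) comp_assoc others_commute[OF fb(3) x, symmetric] ..
      then show ?thesis using F_at_p_ideal[OF F_at_comp[OF fb(2) x] fb(3)] by (simp only:)
    next
      case False
      then have "x \<in> others.alg" using j by (intro others.gen_alg) blast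
      then have "f \<circ> (b \<circ> x) \<in> p_ideal i" by (intro F_at_p_ideal fb(2) others.comp_alg fb(3))
      then show ?thesis unfolding fb(1) comp_assoc .
    qed
  qed
next
  case (add r s)
  have "lin q" using add(5) p_ideal_jac jac.lin_alg by blast
  then have "q \<circ> (r + s) = (q \<circ> r) + (q \<circ> s)" by (rule comp_add_right)
  also have "\<dots> \<in> p_ideal i"
    using add(3)[OF add(5)] add(4)[OF add(5)] unfolding p_ideal_eq by (rule op.span_add)
  finally show ?case .
next
  case (comp r s)
  then have "(q \<circ> r) \<circ> s \<in> p_ideal i" by blast
  then show ?case unfolding comp_assoc .
qed

text \<open>Integration is the left multiplication by which \<open>a_ideal_eq_torsion\<close>
  recovers an element from its derivative.\<close>

lemma x_H_inv_p_ideal: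
  assumes "q \<in> p_ideal i"
  shows "x_H_inv j \<circ> q \<in> (p_ideal i :: ('n, 'k::field_char_0) operator set)"
  unfolding p_ideal_eq
proof (rule comp_span_right[OF assms[unfolded p_ideal_eq] _ lin_x_H_inv], fold p_ideal_eq)
  fix g :: "('n, 'k) operator" assume "g \<in> {f \<circ> b | f b. f \<in> F_at i \<and> b \<in> others.alg}"
  then obtain f b where fb: "g = f \<circ> b" "f \<in> F_at i" "b \<in> others.alg" by blast
  show "x_H_inv j \<circ> g \<in> p_ideal i"
  proof (cases "j = i")
    case True
    have "(x_H_inv i \<circ> f) \<circ> b \<in> p_ideal i" by (rule F_at_p_ideal[OF x_H_inv_F_at[OF fb(2)] fb(3)])
    then show ?thesis unfolding fb(1) True by (simp only: comp_assoc)
  next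
    case False
    have "x_H_inv j \<circ> g = (x_H_inv j \<circ> f) \<circ> b" unfolding fb(1) by (simp only: comp_assoc)
    also have "\<dots> = f \<circ> (x_H_inv j \<circ> b)"
      unfolding x_H_inv_F_at_commute[OF False[symmetric] fb(2)] by (simp only: comp_assoc)
    also have "\<dots> \<in> p_ideal i"
    proof (rule F_at_p_ideal[OF fb(2)])
      have "x_op j \<in> others.alg" "H_inv j \<in> others.alg"
        using False by (intro others.gen_alg; blast)+
      then show "x_H_inv j \<circ> b \<in> others.alg" by (intro others.comp_alg fb(3))
    qed
    finally show ?thesis .
  qed
qed

lemma support_projection_p_ideal:
  assumes "r \<in> jac.alg"
  shows "support_projection {i} \<circ> r \<in> (p_ideal i :: ('n, 'k::field_char_0) operator set)"
proof -
  have "support_projection {i} = (matrix_unit_at i 0 0 :: ('n, 'k) operator)"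
    by (rule linear_operator_eqI[OF lin_support_projection lin_matrix_unit_at])
      (simp add: support_projection_monomial matrix_unit_at_monomial update_self)
  then have "support_projection {i} \<circ> id \<in> (p_ideal i :: ('n, 'k) operator set)"
    using F_at_p_ideal[OF matrix_unit_at_F others.id_alg] by (simp only:)
  then show ?thesis using p_ideal_comp[OF assms] by (simp only: comp_id)
qed

lemma p_ideal_torsion: "p_ideal i \<subseteq> (setting.torsion :: ('n, 'k::field_char_0) operator set)"
proof -
  have sub: "op.subspace (setting.torsion :: ('n, 'k) operator set)"
  proof (rule op.subspaceI)
    show "0 \<in> (setting.torsion :: ('n, 'k) operator set)"
      using setting.zero_torsion unfolding jacobian_ops .
    show "f + g \<in> setting.torsion" if "f \<in> setting.torsion" "g \<in> setting.torsion" for f g :: "('n, 'k) operator"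
      using setting.torsion_add[OF that] unfolding jacobian_ops .
    show "(\<lambda>p. scale c (f p)) \<in> setting.torsion" if f: "f \<in> setting.torsion" for c and f :: "('n, 'k) operator"
    proof -
      have "scale c \<in> carrier (jacobian_algebra :: ('n, 'k) operator_algebra)"
        unfolding jacobian_ops by (rule jac.scale_alg)
      from setting.torsion_mult_left[OF f this] show ?thesis
        unfolding jacobian_ops comp_def .
    qed
  qed
  have "matrix_unit_at i k l \<in> (setting.torsion :: ('n, 'k) operator set)" for k l
  proof -
    \<comment> \<open>The image of E_kl has degree at most k in x_i, so k + 1 derivatives annihilate
      it.\<close>
    let ?\<beta> = "Poly_Mapping.single i (Suc k) :: 'n exponent"
    have "d_power ?\<beta> \<circ> matrix_unit_at i k l = (0 :: ('n, 'k) operator)"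
    proof (rule linear_eq_zeroI[OF lin_comp[OF lin_d_power lin_matrix_unit_at]])
      fix \<gamma> :: "'n exponent"
      have "falling ?\<beta> (Poly_Mapping.update i k \<gamma>) = (0 :: 'k)"
        unfolding falling_eq_0_iff by (intro exI[of _ i]) (simp add: lookup_update)
      then show "(d_power ?\<beta> \<circ> matrix_unit_at i k l) (monomial \<gamma>) = (0 :: ('n, 'k) polynomial)"
        by (simp add: matrix_unit_at_monomial d_power_monomial lin_app_zero[OF lin_d_power])
    qed
    then show ?thesis unfolding torsion_iff_operator using matrix_unit_at_jac by blast
  qed
  then have "F_at i \<subseteq> (setting.torsion :: ('n, 'k) operator set)"
    unfolding F_at_eq by (intro op.span_minimal[OF _ sub]) blast
  moreover have "f \<circ> b \<in> setting.torsion" if "f \<in> setting.torsion" "b \<in> others.alg" for f b :: "('n, 'k) operator"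
    using setting.torsion_mult_right[OF that(1), of b] others_jac that(2) unfolding jacobian_ops by blast
  ultimately show ?thesis
    unfolding p_ideal_eq by (intro op.span_minimal[OF _ sub]) blast
qed

lemma zero_p_ideal: "0 \<in> (p_ideal i :: ('n, 'k::field_char_0) operator set)"
  unfolding p_ideal_eq by (rule op.span_zero)

lemma add_p_ideal: "f \<in> p_ideal i \<Longrightarrow> g \<in> p_ideal i \<Longrightarrow> f + g \<in> (p_ideal i :: ('n, 'k::field_char_0) operator set)"
  unfolding p_ideal_eq by (rule op.span_add)

end

lemma p_ideal_a_ideal: "q \<in> p_ideal i \<Longrightarrow> q \<in> (a_ideal :: ('n::finite, 'k::field_char_0) operator set)"
proof -
  assume q: "q \<in> p_ideal i"
  have "(\<Sum>j\<in>UNIV. if j = i then q else 0) = q" by simp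
  then show ?thesis
    unfolding a_ideal_def using q zero_p_ideal
    by (intro CollectI exI[of _ "\<lambda>j. if j = i then q else 0"]) auto
qed

lemma add_a_ideal:
  assumes "f \<in> a_ideal" "g \<in> a_ideal"
  shows "f + g \<in> (a_ideal :: ('n::finite, 'k::field_char_0) operator set)"
proof -
  obtain f' g' where f': "f = (\<Sum>i\<in>UNIV. f' i)" "\<forall>i. f' i \<in> p_ideal i"
    and g': "g = (\<Sum>i\<in>UNIV. g' i)" "\<forall>i. g' i \<in> p_ideal i"
    using assms unfolding a_ideal_def by blast
  have "f + g = (\<Sum>i\<in>UNIV. f' i + g' i)" unfolding f' g' by (rule sum.distrib[symmetric])
  moreover have "\<forall>i. f' i + g' i \<in> p_ideal i" using f' g' add_p_ideal by blast
  ultimately show ?thesis unfolding a_ideal_def by blast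
qed

lemma x_H_inv_a_ideal:
  assumes "f \<in> a_ideal"
  shows "x_H_inv j \<circ> f \<in> (a_ideal :: ('n::finite, 'k::field_char_0) operator set)"
proof -
  obtain f' where f': "f = (\<Sum>i\<in>UNIV. f' i)" "\<forall>i. f' i \<in> p_ideal i"
    using assms unfolding a_ideal_def by blast
  have "x_H_inv j \<circ> f = (\<Sum>i\<in>UNIV. x_H_inv j \<circ> f' i)"
    unfolding f' by (rule comp_sum_right[OF lin_x_H_inv])
  moreover have "\<forall>i. x_H_inv j \<circ> f' i \<in> p_ideal i" using f' x_H_inv_p_ideal by blast
  ultimately show ?thesis unfolding a_ideal_def by blast
qed

text \<open>Torsion elements are recovered by integration. If d^\<beta> d_i r = 0, then d_i r lies
  in the ideal by induction, and r is the integral of d_i r plus its part constant in x_i, which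
  belongs to \<open>p_ideal i\<close>.\<close>

theorem a_ideal_eq_torsion:
  "a_ideal = (setting.torsion :: ('n::finite, 'k::field_char_0) operator set)"
proof (intro subset_antisym subsetI)
  fix f :: "('n, 'k) operator" assume "f \<in> a_ideal"
  then obtain g where g: "f = (\<Sum>i\<in>UNIV. g i)" "\<forall>i. g i \<in> p_ideal i" unfolding a_ideal_def by blast
  have "(\<Sum>i\<in>I. g i) \<in> setting.torsion" if "finite I" for I
    using that
  proof induction
    case empty
    then show ?case
      using setting.zero_torsion[where ?'k = 'k and ?'n = 'n] unfolding jacobian_ops sum.empty .
  next
    case (insert i I)
    have "g i \<in> setting.torsion" using g(2) p_ideal_torsion by blast
    from setting.torsion_add[OF this insert.IH] show ?case
      unfolding jacobian_ops sum.insert[OF insert.hyps] .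
  qed
  then show "f \<in> setting.torsion" unfolding g(1) by simp
next
  fix r :: "('n, 'k) operator" assume "r \<in> setting.torsion"
  then obtain \<beta> where "r \<in> jac.alg" "d_power \<beta> \<circ> r = 0" unfolding torsion_iff_operator by blast
  then show "r \<in> a_ideal"
  proof (induction \<beta> arbitrary: r rule: exponent_induct)
    case zero
    then have "r = 0" unfolding d_power_0 id_comp by blast
    then show ?case using p_ideal_a_ideal[OF zero_p_ideal] by (simp only:)
  next
    case (add \<beta> i)
    have "d_power \<beta> \<circ> (d_op i \<circ> r) = 0"
      using add.prems(2) unfolding d_power_add_unit comp_assoc .
    then have "d_op i \<circ> r \<in> a_ideal"
      by (rule add.IH[OF jac.comp_alg[OF d_jac add.prems(1)]])
    from x_H_inv_a_ideal[OF this, of i]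
    have "x_op i \<circ> H_inv i \<circ> d_op i \<circ> r \<in> a_ideal" by (simp only: comp_assoc)
    moreover have "support_projection {i} \<circ> r \<in> a_ideal"
      by (rule p_ideal_a_ideal[OF support_projection_p_ideal[OF add.prems(1)]])
    ultimately have "(x_op i \<circ> H_inv i \<circ> d_op i \<circ> r) + (support_projection {i} \<circ> r) \<in> a_ideal"
      by (rule add_a_ideal)
    also have "(x_op i \<circ> H_inv i \<circ> d_op i \<circ> r) + (support_projection {i} \<circ> r) = r"
      unfolding x_H_inv_d by (simp add: fun_eq_iff)
    finally show ?case .
  qed
qed

theorem theorem5p4:
  fixes A J D :: "('n::finite, 'k::field_char_0) operator_algebra"
  defines "A \<equiv> weyl_algebra" and "J \<equiv> jacobian_algebra" and "D \<equiv> Delta"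
  shows "all_equivalent
    [algebra_isomorphic (left_localization J (largest_left_regular_denominator_set J))
       (classical_left_quotient_ring A),
     left_denominator_set J (left_regular_elements J) \<and>
       algebra_isomorphic (left_localization J (left_regular_elements J))
         (classical_left_quotient_ring A),
     left_dense jacobian_factor_algebra
       (jacobian_projection ` largest_left_regular_denominator_set J)
       (carrier jacobian_factor_algebra - {\<zero>\<^bsub>jacobian_factor_algebra\<^esub>}),
     left_dense jacobian_factor_algebra
       (jacobian_projection ` left_regular_elements J)
       (carrier jacobian_factor_algebra - {\<zero>\<^bsub>jacobian_factor_algebra\<^esub>}),
     left_dense jacobian_factor_algebra
       (jacobian_projection ` (Delta_denominators :: ('n, 'k) operator set))
       (carrier jacobian_factor_algebra - {\<zero>\<^bsub>jacobian_factor_algebra\<^esub>}),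
     left_dense D Delta_denominators Delta_nonzero,
     \<forall>s\<in>Delta_nonzero. \<exists>s'\<in>Delta_nonzero.
       s' \<otimes>\<^bsub>J\<^esub> s \<in> regular_on_right_module J F_ideal (\<otimes>\<^bsub>J\<^esub>),
     \<forall>s\<in>Delta_nonzero. \<exists>s'\<in>Delta_nonzero.
       s' \<otimes>\<^bsub>J\<^esub> s \<in> regular_on_right_module J UNIV P'_act]"
proof -
  \<comment> \<open>The abstract setting treats the Weyl algebra and \<open>Delta\<close> as
    subrings of one ring, so both are rewritten as restrictions of the Jacobian algebra.\<close>
  have A: "A = J\<lparr>carrier := weyl.alg\<rparr>" and D: "D = J\<lparr>carrier := delta.alg\<rparr>"
    unfolding A_def D_def J_def algebra_eqs by (rule generated_algebra_restrict)+
  have Q: "jacobian_factor_algebra = J Quot setting.torsion"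
    unfolding jacobian_factor_algebra_def a_ideal_eq_torsion J_def ..
  have proj: "jacobian_projection = (\<lambda>r. setting.torsion +>\<^bsub>J\<^esub> r)"
    unfolding jacobian_projection_def a_ideal_eq_torsion J_def ..
  have DD: "Delta_denominators = (delta.alg \<inter> largest_left_regular_denominator_set J)"
    unfolding Delta_denominators_def J_def by (simp only: algebra_eqs)
  have "\<zero>\<^bsub>Delta\<^esub> = (\<zero>\<^bsub>J\<^esub> :: ('n, 'k) operator)"
    unfolding J_def algebra_eqs by (simp only: generated_algebra_simps)
  then have D0: "Delta_nonzero = (delta.alg - {\<zero>\<^bsub>J\<^esub>})"
    unfolding Delta_nonzero_def by (simp only: algebra_eqs)
  have F: "regular_on_right_module J F_ideal (\<otimes>\<^bsub>J\<^esub>) = left_regular_elements J"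
    and P': "regular_on_right_module J UNIV P'_act = left_regular_elements J"
    unfolding J_def by (rule regular_on_F_ideal regular_on_P'_act)+
  \<comment> \<open>Both regularity conditions have become left regularity, so the last two entries
    coincide and the set of statements is that of \<open>equivalences\<close>.\<close>
  show ?thesis
    using setting.equivalences[where ?'n = 'n and ?'k = 'k]
    unfolding A D Q proj DD D0 F P' J_def[symmetric]
    by (simp only: all_equivalent_def list.set insert_absorb2)
qed

end
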